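(* Let $A$ be a finite abelian group and $n\geq 1$. Then the map $\rho_{n,A}$ defines a Gelfand model for $G_n=A\wr S_n$.
   Context: A Gelfand model for a finite group is a representation equivalent to the multiplicity-free sum of all the group's irreducible (complex) representations; a representation over a subfield $\mathbb{K}\subset\mathbb{C}$ is regarded as complex by extension of scalars. $G_n=A\wr S_n$ is the set of pairs $(a,\pi)$, $a\in A^n$, $\pi\in S_n$, with product $(a,\pi)(b,\sigma)=(\sigma^{-1}(a)\cdot b,\pi\sigma)$, where $\pi(a)=(a_{\pi^{-1}(1)},\dots,a_{\pi^{-1}(n)})$. For $g=(a,\pi)\in G_n$ put $|g|=\pi$ and $z_g(i)=a_i$. Let $\tau\in\mathrm{Aut}(G_n)$ be ${}^\tau(a,\pi)=(a^{-1},\pi)$, let $\mathcal{I}_{G_n,\tau}=\{\omega\in G_n:\omega\cdot{}^\tau\omega=1\}$, and let $\mathcal{V}_{G_n,\tau}$ be the vector space over a fixed subfield $\mathbb{K}\subset\mathbb{C}$ with basis $\{C_\omega:\omega\in\mathcal{I}_{G_n,\tau}\}$. For $\pi\in S_n$, $\mathrm{Fix}(\pi)=\{i:\pi(i)=i\}$, $\mathrm{Inv}(\pi)=\{(i,j):1\le i<j\le n,\ \pi(i)>\pi(j)\}$, $\mathrm{Pair}(\pi)=\{(i,j):1\le i<j\le n,\ \pi(i)=j,\ \pi(j)=i\}$, and $\mathrm{sign}_{S_n}(\pi,\omega)=(-1)^{|\mathrm{Inv}(\pi)\cap\mathrm{Pair}(\omega)|}$. The map $\rho_{n,A}:G_n\to\mathrm{GL}(\mathcal{V}_{G_n,\tau})$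 is $$\rho_{n,A}(g)C_\omega=\mathrm{sign}_{G_n}(g,\omega)\,C_{g\cdot\omega\cdot{}^\tau g^{-1}},\qquad \mathrm{sign}_{G_n}(g,\omega)=\mathrm{sign}_{S_n}(|g|,|\omega|)\prod_{i\in\mathrm{Fix}(|\omega|)}\mathrm{sign}_A(z_g(i),z_\omega(i)),$$ for $g\in G_n$, $\omega\in\mathcal{I}_{G_n,\tau}$, where ${}^\tau g^{-1}=\tau(g)^{-1}$ and $\mathrm{sign}_A:A\times A\to\{\pm1\}$ is given by either of the following two definitions (the theorem holds for both). Definition 1. Let $\mathcal{I}_A=\{a\in A:a^2=1\}$ and $B=\{a^2:a\in A\}$. Fix a bijection between $A/B$ and the set $\mathrm{Irr}(\mathcal{I}_A)$ of irreducible characters of $\mathcal{I}_A$, and let $\lambda_x\in\mathrm{Irr}(\mathcal{I}_A)$ correspond to the coset $xB$. Choose maps $\tilde s_{\mathrm{orb}}:A/B\to A$ and $\tilde s:A/\mathcal{I}_A\to A$ assigning to each coset one of its elements, and set $s_{\mathrm{orb}}(a)=\tilde s_{\mathrm{orb}}(aB)$, $s(a)=\tilde s(a\mathcal{I}_A)$. Let $q(a)=\tilde s\bigl(\{b\in A:s_{\mathrm{orb}}(a)\cdot b^2=a\}\bigr)$ (the set in braces is a coset of $\mathcal{I}_A$). Then $\mathrm{sign}_A(a,x)=\lambda_x\bigl(a\cdot q(x)\cdot s(a\cdot q(x))^{-1}\bigr)$. Definition 2. Identify $\mathbb{Z}_r$ with $\{0,1,\dots,r-1\}$ under addition modulo $r$.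 For $a,x\in\mathbb{Z}_r$, let $\mathrm{sign}_r(a,x)=-1$ if $r$ is even and there is an integer $k$ with $0\le k\le r/2-1$, $x=2k+1$ and $a+k$ (computed in $\mathbb{Z}_r$) in $\{r/2,\dots,r-1\}$; otherwise $\mathrm{sign}_r(a,x)=1$. Writing $A=\prod_{i=1}^k\mathbb{Z}_{r_i}$ with each $r_i$ a prime power, $\mathrm{sign}_A(a,x)=\prod_{i=1}^k\mathrm{sign}_{r_i}(a_i,x_i)$. *)

theory Defs
  imports
    "Jordan_Normal_Form.VS_Connect"
    "HOL-Algebra.Bij"
    "HOL-Algebra.Elementary_Groups"
    "HOL-Algebra.Product_Groups"
    "HOL-Algebra.Subrings"
    "HOL-Algebra.Sym_Groups"
    "HOL-Number_Theory.Prime_Powers"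
begin

section \<open>Representations and Gelfand models\<close>

text \<open>Following \<^const>\<open>BijGroup\<close>, linear maps are extensional functions on the carrier.\<close>

definition general_linear ::
    "('k, 'm) ring_scheme \<Rightarrow> ('k, 'v, 'n) module_scheme \<Rightarrow> ('v \<Rightarrow> 'v) monoid" where
  "general_linear F V =
     BijGroup (carrier V) \<lparr>carrier := Bij (carrier V) \<inter> LinearCombinations.module_hom F V V\<rparr>"

definition representation ::
    "('k, 'm) ring_scheme \<Rightarrow> ('g, 'b) monoid_scheme \<Rightarrow> ('k, 'v, 'n) module_scheme
      \<Rightarrow> ('g \<Rightarrow> 'v \<Rightarrow> 'v) \<Rightarrow> bool" where
  "representation F G V \<rho> \<longleftrightarrow>
     group G \<and> vectorspace F V \<and> \<rho> \<in> hom G (general_linear F V)"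

text \<open>Complex representations of a finite group are treated in coordinates, as homomorphisms to
  the group of invertible complex \<open>d \<times> d\<close> matrices. Thus all irreducible complex representations,
  of whatever degree, live in a single type. The values of \<open>R\<close> outside the group are irrelevant.\<close>

definition matrix_rep ::
    "('g, 'b) monoid_scheme \<Rightarrow> nat \<Rightarrow> ('g \<Rightarrow> complex mat) \<Rightarrow> bool" where
  "matrix_rep G d R \<longleftrightarrow> R \<in> hom G (units_of (ring_mat TYPE(complex) d ()))"

definition irreducible_rep :: "('g, 'b) monoid_scheme \<Rightarrow> ('g \<Rightarrow> complex mat) \<Rightarrow> bool" where
  "irreducible_rep G R \<longleftrightarrow>
     (\<exists>d>0. matrix_rep G d R \<and>
        (\<forall>W. VectorSpace.subspace class_ring W (module_vec TYPE(complex) d) \<longrightarrow>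
           (\<forall>g\<in>carrier G. \<forall>w\<in>W. R g *\<^sub>v w \<in> W) \<longrightarrow>
           W = {0\<^sub>v d} \<or> W = carrier_vec d))"

text \<open>The intertwining matrix \<open>P\<close> does not depend on \<open>g\<close>; \<open>Q\<close> is its inverse. Over a group,
  \<^const>\<open>similar_mat_wit\<close> also forces the degrees to agree.\<close>

definition equivalent_rep ::
    "('g, 'b) monoid_scheme \<Rightarrow> ('g \<Rightarrow> complex mat) \<Rightarrow> ('g \<Rightarrow> complex mat) \<Rightarrow> bool" where
  "equivalent_rep G R S \<longleftrightarrow> (\<exists>P Q. \<forall>g\<in>carrier G. similar_mat_wit (R g) (S g) P Q)"

definition direct_sum_rep :: "('g \<Rightarrow> complex mat) list \<Rightarrow> 'g \<Rightarrow> complex mat" where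
  "direct_sum_rep Rs g = diag_block_mat (map (\<lambda>R. R g) Rs)"

text \<open>\<open>Rs\<close> lists exactly one representative of each class of irreducible complex representations.\<close>

definition complete_irreducibles ::
    "('g, 'b) monoid_scheme \<Rightarrow> ('g \<Rightarrow> complex mat) list \<Rightarrow> bool" where
  "complete_irreducibles G Rs \<longleftrightarrow>
     (\<forall>R\<in>set Rs. irreducible_rep G R) \<and>
     (\<forall>i<length Rs. \<forall>j<length Rs. i \<noteq> j \<longrightarrow> \<not> equivalent_rep G (Rs ! i) (Rs ! j)) \<and>
     (\<forall>R. irreducible_rep G R \<longrightarrow> (\<exists>S\<in>set Rs. equivalent_rep G R S))"

text \<open>For a field \<open>F\<close> of complex numbers and a representation \<open>\<rho>\<close> on a finite-dimensional
  \<open>F\<close>-space \<open>V\<close>, the complex representation on the extension of scalars of \<open>V\<close> is given by the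
  matrices of \<open>\<rho>\<close> with respect to an \<open>F\<close>-basis of \<open>V\<close>, read as complex matrices.\<close>

definition scalar_extension ::
    "complex ring \<Rightarrow> ('g, 'b) monoid_scheme \<Rightarrow> (complex, 'v, 'n) module_scheme
      \<Rightarrow> ('g \<Rightarrow> 'v \<Rightarrow> 'v) \<Rightarrow> ('g \<Rightarrow> complex mat) \<Rightarrow> bool" where
  "scalar_extension F G V \<rho> R \<longleftrightarrow>
     (\<exists>bs. distinct bs \<and> vectorspace.basis F V (set bs) \<and>
        (\<forall>g\<in>carrier G.
           R g \<in> carrier_mat (length bs) (length bs) \<and> elements_mat (R g) \<subseteq> carrier F \<and>
           (\<forall>j<length bs.
              \<rho> g (bs ! j) = (\<Oplus>\<^bsub>V\<^esub> i\<in>{..<length bs}. R g $$ (i, j) \<odot>\<^bsub>V\<^esub> (bs ! i)))))"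

definition gelfand_model ::
    "complex ring \<Rightarrow> ('g, 'b) monoid_scheme \<Rightarrow> (complex, 'v, 'n) module_scheme
      \<Rightarrow> ('g \<Rightarrow> 'v \<Rightarrow> 'v) \<Rightarrow> bool" where
  "gelfand_model F G V \<rho> \<longleftrightarrow>
     representation F G V \<rho> \<and>
     (\<exists>R Rs. scalar_extension F G V \<rho> R \<and> complete_irreducibles G Rs \<and>
        equivalent_rep G R (direct_sum_rep Rs))"

text \<open>Characters are made extensional so that equality of characters is equality of functions.\<close>

definition irr_characters :: "('g, 'b) monoid_scheme \<Rightarrow> ('g \<Rightarrow> complex) set" where
  "irr_characters G =
     {\<lambda>g\<in>carrier G. sum_list (diag_mat (R g)) |R. irreducible_rep G R}"


section \<open>The wreath product\<close>

definition perm_act :: "nat \<Rightarrow> (nat \<Rightarrow> nat) \<Rightarrow> (nat \<Rightarrow> 'a) \<Rightarrow> nat \<Rightarrow> 'a" where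
  "perm_act n \<pi> a = (\<lambda>i\<in>{1..n}. a (inv_into UNIV \<pi> i))"

definition wreath ::
    "('a, 'b) monoid_scheme \<Rightarrow> nat \<Rightarrow> ((nat \<Rightarrow> 'a) \<times> (nat \<Rightarrow> nat)) monoid" where
  "wreath A n =
     (let An = product_group {1..n} (\<lambda>_. A); S = sym_group n in
      \<lparr>carrier = carrier An \<times> carrier S,
       monoid.mult = (\<lambda>(a, \<pi>) (b, \<sigma>).
         (perm_act n (inv_into UNIV \<sigma>) a \<otimes>\<^bsub>An\<^esub> b, \<pi> \<otimes>\<^bsub>S\<^esub> \<sigma>)),
       one = (\<one>\<^bsub>An\<^esub>, \<one>\<^bsub>S\<^esub>)\<rparr>)"

definition tau ::
    "('a, 'b) monoid_scheme \<Rightarrow> nat \<Rightarrow> (nat \<Rightarrow> 'a) \<times> (nat \<Rightarrow> nat)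
      \<Rightarrow> (nat \<Rightarrow> 'a) \<times> (nat \<Rightarrow> nat)" where
  "tau A n = (\<lambda>(a, \<pi>). (inv\<^bsub>product_group {1..n} (\<lambda>_. A)\<^esub> a, \<pi>))"

definition twisted_involutions ::
    "('a, 'b) monoid_scheme \<Rightarrow> nat \<Rightarrow> ((nat \<Rightarrow> 'a) \<times> (nat \<Rightarrow> nat)) set" where
  "twisted_involutions A n =
     {\<omega> \<in> carrier (wreath A n). \<omega> \<otimes>\<^bsub>wreath A n\<^esub> tau A n \<omega> = \<one>\<^bsub>wreath A n\<^esub>}"


section \<open>The signs\<close>

definition Fix :: "nat \<Rightarrow> (nat \<Rightarrow> nat) \<Rightarrow> nat set" where
  "Fix n \<pi> = {i \<in> {1..n}. \<pi> i = i}"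

definition Inv :: "nat \<Rightarrow> (nat \<Rightarrow> nat) \<Rightarrow> (nat \<times> nat) set" where
  "Inv n \<pi> = {(i, j). 1 \<le> i \<and> i < j \<and> j \<le> n \<and> \<pi> i > \<pi> j}"

definition Pair :: "nat \<Rightarrow> (nat \<Rightarrow> nat) \<Rightarrow> (nat \<times> nat) set" where
  "Pair n \<pi> = {(i, j). 1 \<le> i \<and> i < j \<and> j \<le> n \<and> \<pi> i = j \<and> \<pi> j = i}"

definition sign_S :: "nat \<Rightarrow> (nat \<Rightarrow> nat) \<Rightarrow> (nat \<Rightarrow> nat) \<Rightarrow> complex" where
  "sign_S n \<pi> \<theta> = (-1) ^ card (Inv n \<pi> \<inter> Pair n \<theta>)"

definition sign_G ::
    "nat \<Rightarrow> ('a \<Rightarrow> 'a \<Rightarrow> complex) \<Rightarrow> (nat \<Rightarrow> 'a) \<times> (nat \<Rightarrow> nat)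
      \<Rightarrow> (nat \<Rightarrow> 'a) \<times> (nat \<Rightarrow> nat) \<Rightarrow> complex" where
  "sign_G n sgA g \<omega> =
     sign_S n (snd g) (snd \<omega>) * (\<Prod>i\<in>Fix n (snd \<omega>). sgA (fst g i) (fst \<omega> i))"

definition involution_set :: "('a, 'b) monoid_scheme \<Rightarrow> 'a set" where
  "involution_set A = {a \<in> carrier A. a \<otimes>\<^bsub>A\<^esub> a = \<one>\<^bsub>A\<^esub>}"

definition square_set :: "('a, 'b) monoid_scheme \<Rightarrow> 'a set" where
  "square_set A = {a \<otimes>\<^bsub>A\<^esub> a |a. a \<in> carrier A}"

text \<open>\<open>sgA\<close> is the first kind of sign function for some choice of the bijection \<open>lam\<close> and of the
  coset representatives \<open>t_orb\<close> and \<open>t\<close>.\<close>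

definition is_character_sign ::
    "('a, 'b) monoid_scheme \<Rightarrow> ('a \<Rightarrow> 'a \<Rightarrow> complex) \<Rightarrow> bool" where
  "is_character_sign A sgA \<longleftrightarrow>
     (let IA = involution_set A; B = square_set A in
      \<exists>(lam :: 'a set \<Rightarrow> 'a \<Rightarrow> complex) (t_orb :: 'a set \<Rightarrow> 'a) (t :: 'a set \<Rightarrow> 'a).
        bij_betw lam (carrier (A Mod B)) (irr_characters (A\<lparr>carrier := IA\<rparr>)) \<and>
        (\<forall>X\<in>carrier (A Mod B). t_orb X \<in> X) \<and>
        (\<forall>X\<in>carrier (A Mod IA). t X \<in> X) \<and>
        (\<forall>a\<in>carrier A. \<forall>x\<in>carrier A.
           let s_orb = (\<lambda>y. t_orb (B #>\<^bsub>A\<^esub> y));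
               s = (\<lambda>y. t (IA #>\<^bsub>A\<^esub> y));
               q = (\<lambda>y. t {b \<in> carrier A. s_orb y \<otimes>\<^bsub>A\<^esub> (b \<otimes>\<^bsub>A\<^esub> b) = y});
               c = a \<otimes>\<^bsub>A\<^esub> q x
           in sgA a x = lam (B #>\<^bsub>A\<^esub> x) (c \<otimes>\<^bsub>A\<^esub> inv\<^bsub>A\<^esub> (s c))))"

text \<open>The elements of \<^term>\<open>integer_mod_group r\<close> are the integers \<open>0, \<dots>, r - 1\<close>.\<close>

definition sign_cyclic :: "nat \<Rightarrow> int \<Rightarrow> int \<Rightarrow> complex" where
  "sign_cyclic r a x =
     (if even r \<and>
         (\<exists>k::int. 0 \<le> k \<and> k \<le> int r div 2 - 1 \<and> x = 2 * k + 1 \<and>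
            (a + k) mod int r \<in> {int r div 2..int r - 1})
      then -1 else 1)"

text \<open>\<open>sgA\<close> is the second kind of sign function for some decomposition of \<open>A\<close> into cyclic groups
  of prime power order.\<close>

definition is_cyclic_sign ::
    "('a, 'b) monoid_scheme \<Rightarrow> ('a \<Rightarrow> 'a \<Rightarrow> complex) \<Rightarrow> bool" where
  "is_cyclic_sign A sgA \<longleftrightarrow>
     (\<exists>(k :: nat) (r :: nat \<Rightarrow> nat) (\<phi> :: 'a \<Rightarrow> nat \<Rightarrow> int).
        (\<forall>i\<in>{1..k}. primepow (r i)) \<and>
        \<phi> \<in> iso A (product_group {1..k} (\<lambda>i. integer_mod_group (r i))) \<and>
        (\<forall>a\<in>carrier A. \<forall>x\<in>carrier A.
           sgA a x = (\<Prod>i\<in>{1..k}. sign_cyclic (r i) (\<phi> a i) (\<phi> x i))))"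


section \<open>The map \<open>\<rho>\<close>\<close>

definition subfield_ring :: "complex set \<Rightarrow> complex ring" where
  "subfield_ring K = class_ring\<lparr>carrier := K\<rparr>"

text \<open>The space with basis the \<open>C\<^sub>\<omega>\<close> is realised as the space of \<open>K\<close>-valued functions on the (finite)
  set of all \<open>\<omega>\<close>, where \<open>C\<^sub>\<omega>\<close> is the indicator function of \<open>\<omega>\<close>.\<close>

definition model_space ::
    "complex set \<Rightarrow> ('a, 'b) monoid_scheme \<Rightarrow> nat
      \<Rightarrow> (complex, (nat \<Rightarrow> 'a) \<times> (nat \<Rightarrow> nat) \<Rightarrow> complex) module" where
  "model_space K A n = ring.func_space (subfield_ring K) (twisted_involutions A n)"

definition C_basis ::
    "('a, 'b) monoid_scheme \<Rightarrow> nat \<Rightarrow> (nat \<Rightarrow> 'a) \<times> (nat \<Rightarrow> nat)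
      \<Rightarrow> (nat \<Rightarrow> 'a) \<times> (nat \<Rightarrow> nat) \<Rightarrow> complex" where
  "C_basis A n \<omega> = (\<lambda>\<omega>'\<in>twisted_involutions A n. if \<omega>' = \<omega> then 1 else 0)"

text \<open>\<open>rho K A n sgA g\<close> is the linear extension of
  \<open>C\<^sub>\<omega> \<mapsto> sign\<^sub>G(g, \<omega>) C\<^sub>\<omega>'\<close> with \<open>\<omega>' = g \<cdot> \<omega> \<cdot> \<tau>(g)\<^sup>-\<^sup>1\<close>.\<close>

definition rho ::
    "complex set \<Rightarrow> ('a, 'b) monoid_scheme \<Rightarrow> nat \<Rightarrow> ('a \<Rightarrow> 'a \<Rightarrow> complex)
      \<Rightarrow> (nat \<Rightarrow> 'a) \<times> (nat \<Rightarrow> nat)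
      \<Rightarrow> ((nat \<Rightarrow> 'a) \<times> (nat \<Rightarrow> nat) \<Rightarrow> complex)
      \<Rightarrow> (nat \<Rightarrow> 'a) \<times> (nat \<Rightarrow> nat) \<Rightarrow> complex" where
  "rho K A n sgA g =
     (let G = wreath A n; V = model_space K A n in
      (\<lambda>v\<in>carrier V. \<Oplus>\<^bsub>V\<^esub> \<omega>\<in>twisted_involutions A n.
        (v \<omega> * sign_G n sgA g \<omega>) \<odot>\<^bsub>V\<^esub>
          C_basis A n (g \<otimes>\<^bsub>G\<^esub> \<omega> \<otimes>\<^bsub>G\<^esub> inv\<^bsub>G\<^esub> (tau A n g))))"

end

theory Submission
  imports Defs "Jordan_Normal_Form.Char_Poly" "HOL-Computational_Algebra.Fundamental_Theorem_Algebra"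
begin

text \<open>Let \<open>f g\<close> be the number of \<open>u\<close> with \<open>u \<otimes> \<tau> u = g\<close>. For an irreducible character \<open>\<chi>\<close> of a
  finite group with an involutive automorphism \<open>\<tau>\<close>, the inner product of \<open>f\<close> and \<open>\<chi>\<close> is the twisted
  Frobenius--Schur indicator of \<open>\<chi>\<close>, the mean of \<open>\<chi> (v \<otimes> \<tau> v)\<close>. If every \<open>g\<close> is conjugate to
  \<open>inv (\<tau> g)\<close>, then the twist of \<open>\<chi>\<close> by \<open>\<tau>\<close> is dual to \<open>\<chi>\<close>, and the indicator is \<open>1\<close> or \<open>- 1\<close>
  (\<open>twisted_frobenius_schur\<close>). If \<open>f\<close> is moreover the character of a representation, the inner
  products are multiplicities, so all of them are \<open>1\<close>. This is \<open>gelfand_criterion\<close>; it rests on Schur's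
  lemma, on the orthogonality relations (\<open>character_inner_product\<close>) and on Maschke's theorem
  (\<open>complete_reducibility\<close>).

  An element \<open>(a, \<pi>)\<close> of the wreath product is a monomial matrix that sends the point \<open>i\<close> to \<open>\<pi> i\<close> with
  coefficient \<open>a i\<close>. Then \<open>inv (\<tau> g)\<close> is the transpose of \<open>g\<close>, the twisted involutions are the symmetric
  monomial matrices, and \<open>\<rho> g\<close> is congruence by \<open>g\<close> up to signs. Reversing the direction of every
  cycle, with suitable coefficients, conjugates \<open>g\<close> to its transpose (\<open>conjugate_to_inverse_twist\<close>).

  It remains to see that the trace of \<open>\<rho> g\<close> is \<open>f g\<close>. The trace is a signed count of the symmetric
  matrices fixed by \<open>g\<close>, which is compared with the count of the \<open>u\<close> with \<open>u \<otimes> \<tau> u = g\<close>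
  (\<open>signed_fixed_points\<close>). The permutation of either kind of object permutes the cycles of \<open>\<pi> = |g|\<close>, and
  both counts factor accordingly (\<open>signed_fixed_points_eq_roots\<close>). If two different cycles are exchanged,
  there is a bijection between the two kinds, and all signs are \<open>1\<close> (\<open>swapped_cycles_identity\<close>). A
  single cycle of odd length whose coefficients have product \<open>1\<close> contributes \<open>|A|\<close> to both counts, and any
  other cycle contributes \<open>0\<close>: a cycle of even length has no square root, and the contributions of the
  involution fixing it pointwise and of its half turn cancel (\<open>cycle_identity\<close>).

  Of the sign function of \<open>A\<close> only three properties are used, collected in the locale \<open>abelian_sign\<close>: it is
  \<open>\<plusminus>1\<close>-valued, a cocycle for the action \<open>x \<mapsto> b \<otimes> b \<otimes> x\<close>, and its sum over \<open>x\<close> vanishes for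
  every involution \<open>a \<noteq> \<one>\<close>. They are verified for either kind of sign in \<open>character_sign_axioms\<close> and
  \<open>cyclic_sign_axioms\<close>.\<close>

section \<open>Complex matrices\<close>

definition tr :: "complex mat \<Rightarrow> complex" where
  "tr A = (\<Sum>i<dim_row A. A $$ (i, i))"

lemma tr_eq_sum_list_diag: "tr A = sum_list (diag_mat A)"
  by (simp add: tr_def diag_mat_def sum_list_sum_nth atLeast0LessThan)

lemma index_mult_mat_sum:
  assumes "A \<in> carrier_mat m n" "B \<in> carrier_mat n k" "i < m" "j < k"
  shows "(A * B) $$ (i, j) = (\<Sum>l<n. A $$ (i, l) * B $$ (l, j))"
  using assms by (auto simp: scalar_prod_def atLeast0LessThan)

lemma index_mult_mat_vec_sum:
  assumes "A \<in> carrier_mat m n" "v \<in> carrier_vec n" "i < m"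
  shows "(A *\<^sub>v v) $ i = (\<Sum>l<n. A $$ (i, l) * v $ l)"
  using assms by (auto simp: scalar_prod_def atLeast0LessThan)

lemma tr_mult_comm:
  assumes "A \<in> carrier_mat m n" "B \<in> carrier_mat n m"
  shows "tr (A * B) = tr (B * A)"
proof -
  have "tr (A * B) = (\<Sum>i<m. \<Sum>l<n. A $$ (i, l) * B $$ (l, i))"
    using assms by (auto simp: tr_def index_mult_mat_sum simp del: index_mult_mat(1))
  also have "\<dots> = (\<Sum>l<n. \<Sum>i<m. A $$ (i, l) * B $$ (l, i))"
    by (rule sum.swap)
  also have "\<dots> = tr (B * A)"
    using assms by (auto simp: tr_def index_mult_mat_sum mult.commute simp del: index_mult_mat(1))
  finally show ?thesis .
qed

lemma tr_one [simp]: "tr (1\<^sub>m d) = of_nat d"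
  by (simp add: tr_def)

lemma tr_similar:
  assumes "similar_mat_wit A B P Q" shows "tr A = tr B"
proof -
  define n where "n = dim_row A"
  note s = similar_mat_witD[OF n_def assms]
  have "tr A = tr (P * (B * Q))" by (subst s(3)) (use s(5-7) in \<open>simp add: assoc_mult_mat[of _ n n]\<close>)
  also have "\<dots> = tr (B * Q * P)" by (rule tr_mult_comm) (use s(5-7) in auto)
  also have "B * Q * P = B" using s(2,5-7) by (simp add: assoc_mult_mat[of _ n n])
  finally show ?thesis .
qed

lemma inverse_pair_imp_square:
  fixes P :: "complex mat"
  assumes "P \<in> carrier_mat m n" "Q \<in> carrier_mat n m" "P * Q = 1\<^sub>m m" "Q * P = 1\<^sub>m n"
  shows "m = n"
proof -
  have "of_nat m = (of_nat n :: complex)"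
    using tr_mult_comm[OF assms(1,2)] assms(3,4) by simp
  then show ?thesis by simp
qed

lemma mult_unit_vec_eq_col:
  fixes A :: "complex mat"
  assumes "A \<in> carrier_mat m n" "j < n"
  shows "A *\<^sub>v unit_vec n j = col A j"
  using assms by (intro eq_vecI) auto

lemma mat_eq_if_mult_vec_eq:
  fixes A :: "complex mat"
  assumes A: "A \<in> carrier_mat m n" and B: "B \<in> carrier_mat m n"
    and eq: "\<And>v. v \<in> carrier_vec n \<Longrightarrow> A *\<^sub>v v = B *\<^sub>v v"
  shows "A = B"
proof (rule eq_matI)
  fix i j assume ij: "i < dim_row B" "j < dim_col B"
  have "col A j = col B j"
    using eq[of "unit_vec n j"] ij A B by (auto simp: mult_unit_vec_eq_col[of _ m n])
  then show "A $$ (i, j) = B $$ (i, j)"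
    using ij A B by (metis carrier_matD index_col)
qed (use assms in auto)

text \<open>Padding with zero rows gives a singular square matrix with the same kernel.\<close>

lemma kernel_vector_if_wide:
  fixes A :: "complex mat"
  assumes A: "A \<in> carrier_mat m n" and "m < n"
  shows "\<exists>v\<in>carrier_vec n. v \<noteq> 0\<^sub>v n \<and> A *\<^sub>v v = 0\<^sub>v m"
proof -
  define A' where "A' = mat n n (\<lambda>(i, j). if i < m then A $$ (i, j) else 0)"
  have A': "A' \<in> carrier_mat n n" by (simp add: A'_def)
  have "transpose_mat A' *\<^sub>v unit_vec n (n - 1) = 0\<^sub>v n"
  proof (rule eq_vecI)
    fix i assume "i < dim_vec (0\<^sub>v n :: complex vec)"
    then show "(transpose_mat A' *\<^sub>v unit_vec n (n - 1)) $ i = 0\<^sub>v n $ i"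
      using \<open>m < n\<close> A' by (simp add: A'_def)
  qed (use A' in simp)
  moreover have "unit_vec n (n - 1) \<noteq> (0\<^sub>v n :: complex vec)"
    using \<open>m < n\<close> by simp
  ultimately have "det (transpose_mat A') = 0"
    using det_0_iff_vec_prod_zero[of "transpose_mat A'" n] A' by (auto intro!: exI[of _ "unit_vec n (n - 1)"])
  then have "det A' = 0" using det_transpose[OF A'] by simp
  then obtain v where v: "v \<in> carrier_vec n" "v \<noteq> 0\<^sub>v n" "A' *\<^sub>v v = 0\<^sub>v n"
    using det_0_iff_vec_prod_zero[OF A'] by auto
  have "A *\<^sub>v v = 0\<^sub>v m"
  proof (rule eq_vecI)
    fix i assume i: "i < dim_vec (0\<^sub>v m :: complex vec)"
    then have "(A *\<^sub>v v) $ i = (A' *\<^sub>v v) $ i"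
      using A A' v(1) \<open>m < n\<close> by (simp add: index_mult_mat_vec_sum del: index_mult_mat_vec) (simp add: A'_def)
    with v(3) i \<open>m < n\<close> show "(A *\<^sub>v v) $ i = 0\<^sub>v m $ i" by simp
  qed (use A in simp)
  with v show ?thesis by blast
qed

text \<open>Injective matrices have at most as many columns as rows, so an injective matrix with columns
  in the subspace and as many columns as possible exists; its columns then span.\<close>

lemma subspace_as_range:
  fixes W :: "complex vec set"
  assumes W: "W \<subseteq> carrier_vec d" "0\<^sub>v d \<in> W"
    and add: "\<And>v w. v \<in> W \<Longrightarrow> w \<in> W \<Longrightarrow> v + w \<in> W"
    and smult: "\<And>c v. v \<in> W \<Longrightarrow> c \<cdot>\<^sub>v v \<in> W"
  shows "\<exists>r. \<exists>B\<in>carrier_mat d r. (\<forall>v\<in>carrier_vec r. B *\<^sub>v v \<in> W)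
     \<and> (\<forall>v\<in>carrier_vec r. B *\<^sub>v v = 0\<^sub>v d \<longrightarrow> v = 0\<^sub>v r) \<and> (\<forall>w\<in>W. \<exists>v\<in>carrier_vec r. B *\<^sub>v v = w)"
proof -
  define P where "P r = (\<exists>B\<in>carrier_mat d r. (\<forall>v\<in>carrier_vec r. B *\<^sub>v v \<in> W)
     \<and> (\<forall>v\<in>carrier_vec r. B *\<^sub>v v = 0\<^sub>v d \<longrightarrow> v = 0\<^sub>v r))" for r
  have bound: "r \<le> d" if "P r" for r
  proof (rule ccontr)
    assume "\<not> r \<le> d"
    with that show False using kernel_vector_if_wide[of _ d r] unfolding P_def by auto
  qed
  have "P 0"
  proof -
    have "0\<^sub>m d 0 *\<^sub>v v = 0\<^sub>v d" if "v \<in> carrier_vec 0" for v :: "complex vec"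
      using that by (auto simp: scalar_prod_def)
    then show ?thesis unfolding P_def using W by (intro bexI[of _ "0\<^sub>m d 0"]) auto
  qed
  define r where "r = (GREATEST r. P r)"
  have "P r" unfolding r_def by (rule GreatestI_nat[of P 0 d]) (use \<open>P 0\<close> bound in auto)
  then obtain B where B: "B \<in> carrier_mat d r" "\<And>v. v \<in> carrier_vec r \<Longrightarrow> B *\<^sub>v v \<in> W"
      "\<And>v. v \<in> carrier_vec r \<Longrightarrow> B *\<^sub>v v = 0\<^sub>v d \<Longrightarrow> v = 0\<^sub>v r"
    unfolding P_def by blast
  have "\<exists>v\<in>carrier_vec r. B *\<^sub>v v = w" if w: "w \<in> W" for w
  proof (rule ccontr)
    assume no: "\<not> (\<exists>v\<in>carrier_vec r. B *\<^sub>v v = w)"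
    have wd: "w \<in> carrier_vec d" using w W by auto
    define B' where "B' = mat d (Suc r) (\<lambda>(i, j). if j < r then B $$ (i, j) else w $ i)"
    have B': "B' \<in> carrier_mat d (Suc r)" by (simp add: B'_def)
    have split: "B' *\<^sub>v v = B *\<^sub>v vec r (($) v) + v $ r \<cdot>\<^sub>v w" if v: "v \<in> carrier_vec (Suc r)" for v
    proof (rule eq_vecI)
      fix i assume "i < dim_vec (B *\<^sub>v vec r (($) v) + v $ r \<cdot>\<^sub>v w)"
      then have i: "i < d" using wd B by simp
      show "(B' *\<^sub>v v) $ i = (B *\<^sub>v vec r (($) v) + v $ r \<cdot>\<^sub>v w) $ i"
        using i wd B(1) B' v by (simp add: index_mult_mat_vec_sum del: index_mult_mat_vec)
         (simp add: B'_def)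
    qed (use B(1) B' wd in simp)
    have "P (Suc r)" unfolding P_def
    proof (intro bexI[OF _ B'] conjI ballI impI)
      fix v :: "complex vec" assume v: "v \<in> carrier_vec (Suc r)"
      show "B' *\<^sub>v v \<in> W" unfolding split[OF v] using B(2) w add smult by simp
      assume 0: "B' *\<^sub>v v = 0\<^sub>v d"
      let ?u = "vec r (($) v)"
      have eq: "B *\<^sub>v ?u + v $ r \<cdot>\<^sub>v w = 0\<^sub>v d" using 0 split[OF v] by simp
      have vr: "v $ r = 0"
      proof (rule ccontr)
        assume nz: "v $ r \<noteq> 0"
        have "B *\<^sub>v ((- 1 / v $ r) \<cdot>\<^sub>v ?u) = (- 1 / v $ r) \<cdot>\<^sub>v (B *\<^sub>v ?u)"
          using B(1) by (simp add: mult_mat_vec)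
        also have "\<dots> = w"
        proof (rule eq_vecI)
          fix i assume i: "i < dim_vec w"
          then have "(B *\<^sub>v ?u) $ i + v $ r * w $ i = 0"
            using arg_cong[OF eq, of "\<lambda>x. x $ i"] wd B(1) by simp
          then have "(B *\<^sub>v ?u) $ i = - (v $ r * w $ i)" by (simp add: add_eq_0_iff2)
          with i nz wd B(1) show "((- 1 / v $ r) \<cdot>\<^sub>v (B *\<^sub>v ?u)) $ i = w $ i" by simp
        qed (use wd B(1) in simp)
        finally show False using no by auto
      qed
      moreover have "0 \<cdot>\<^sub>v w = 0\<^sub>v d" using wd by (intro eq_vecI) auto
      ultimately have "B *\<^sub>v ?u = 0\<^sub>v d" using eq wd B(1) by simp
      then have "?u = 0\<^sub>v r" using B(3) by simp
      show "v = 0\<^sub>v (Suc r)"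
      proof (rule eq_vecI)
        fix i assume "i < dim_vec (0\<^sub>v (Suc r) :: complex vec)"
        then show "v $ i = 0\<^sub>v (Suc r) $ i"
          using vr arg_cong[OF \<open>?u = 0\<^sub>v r\<close>, of "\<lambda>x. x $ i"] by (cases "i = r") auto
      qed (use v in simp)
    qed
    then have "Suc r \<le> r" unfolding r_def by (intro Greatest_le_nat[of P _ d]) (use bound in auto)
    then show False by simp
  qed
  with B show ?thesis by blast
qed

lemma invertible_if_inj:
  fixes M :: "complex mat"
  assumes M: "M \<in> carrier_mat r r" and inj: "\<And>v. v \<in> carrier_vec r \<Longrightarrow> M *\<^sub>v v = 0\<^sub>v r \<Longrightarrow> v = 0\<^sub>v r"
  shows "\<exists>N\<in>carrier_mat r r. N * M = 1\<^sub>m r \<and> M * N = 1\<^sub>m r"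
proof -
  have "det M \<noteq> 0" using det_0_iff_vec_prod_zero[OF M] inj by blast
  then have "M \<in> Units (ring_mat TYPE(complex) r ())" by (rule det_non_zero_imp_unit[OF M])
  then show ?thesis by (auto simp: Units_def ring_mat_def)
qed

text \<open>With \<open>H\<close> the conjugate transpose of \<open>B\<close>, a kernel vector \<open>v\<close> of \<open>H * B\<close> satisfies
  \<open>\<parallel>B v\<parallel>\<^sup>2 = 0\<close>, so \<open>H * B\<close> is injective and hence invertible.\<close>

lemma left_inverse_if_inj:
  fixes B :: "complex mat"
  assumes B: "B \<in> carrier_mat d r" and inj: "\<And>v. v \<in> carrier_vec r \<Longrightarrow> B *\<^sub>v v = 0\<^sub>v d \<Longrightarrow> v = 0\<^sub>v r"
  shows "\<exists>C\<in>carrier_mat r d. C * B = 1\<^sub>m r"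
proof -
  define H where "H = mat r d (\<lambda>(i, j). cnj (B $$ (j, i)))"
  have H: "H \<in> carrier_mat r d" by (simp add: H_def)
  have inj': "v = 0\<^sub>v r" if v: "v \<in> carrier_vec r" and 0: "(H * B) *\<^sub>v v = 0\<^sub>v r" for v
  proof (rule inj[OF v])
    let ?u = "B *\<^sub>v v"
    have u: "?u \<in> carrier_vec d" using B v by simp
    have Hu: "H *\<^sub>v ?u = 0\<^sub>v r" using 0 H B v by (simp add: assoc_mult_mat_vec)
    have "(\<Sum>k<d. cnj (?u $ k) * ?u $ k) = (\<Sum>k<d. \<Sum>i<r. cnj (B $$ (k, i)) * cnj (v $ i) * ?u $ k)"
    proof (rule sum.cong[OF refl])
      fix k assume k: "k \<in> {..<d}"
      have "cnj (?u $ k) = (\<Sum>i<r. cnj (B $$ (k, i)) * cnj (v $ i))"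
        using k by (subst index_mult_mat_vec_sum[OF B v]) (auto simp: cnj_sum)
      then show "cnj (?u $ k) * ?u $ k = (\<Sum>i<r. cnj (B $$ (k, i)) * cnj (v $ i) * ?u $ k)"
        by (simp add: sum_distrib_right)
    qed
    also have "\<dots> = (\<Sum>i<r. \<Sum>k<d. cnj (B $$ (k, i)) * cnj (v $ i) * ?u $ k)" by (rule sum.swap)
    also have "\<dots> = (\<Sum>i<r. cnj (v $ i) * (H *\<^sub>v ?u) $ i)"
    proof (rule sum.cong[OF refl])
      fix i assume i: "i \<in> {..<r}"
      have "(H *\<^sub>v ?u) $ i = (\<Sum>k<d. cnj (B $$ (k, i)) * ?u $ k)"
        using i by (subst index_mult_mat_vec_sum[OF H u]) (auto simp: H_def)
      then show "(\<Sum>k<d. cnj (B $$ (k, i)) * cnj (v $ i) * ?u $ k) = cnj (v $ i) * (H *\<^sub>v ?u) $ i"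
        by (simp add: sum_distrib_left mult_ac)
    qed
    also have "\<dots> = 0" using Hu by simp
    finally have "(\<Sum>k<d. cnj (?u $ k) * ?u $ k) = 0" .
    moreover have "cnj (?u $ k) * ?u $ k = of_real ((cmod (?u $ k))\<^sup>2)" for k
      by (subst complex_norm_square) (rule mult.commute)
    ultimately have "complex_of_real (\<Sum>k<d. (cmod (?u $ k))\<^sup>2) = 0"
      by (simp only: of_real_sum)
    then have "(\<Sum>k<d. (cmod (?u $ k))\<^sup>2) = 0" by (simp only: of_real_eq_0_iff)
    then have "\<forall>k<d. ?u $ k = 0" by (subst (asm) sum_nonneg_eq_0_iff) auto
    then show "?u = 0\<^sub>v d" using u B by (intro eq_vecI) auto
  qed
  obtain N where N: "N \<in> carrier_mat r r" "N * (H * B) = 1\<^sub>m r"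
    using invertible_if_inj[OF mult_carrier_mat[OF H B] inj'] by blast
  have "N * H * B = 1\<^sub>m r" using N(2) assoc_mult_mat[OF N(1) H B] by simp
  then show ?thesis using H N by (intro bexI[of _ "N * H"]) auto
qed

text \<open>Matrices of all formats share one type, which has no neutral element for addition; the format of
  the sum is therefore an argument.\<close>

definition mat_sum :: "nat \<Rightarrow> nat \<Rightarrow> ('g \<Rightarrow> complex mat) \<Rightarrow> 'g set \<Rightarrow> complex mat" where
  "mat_sum m n F S = mat m n (\<lambda>ij. \<Sum>g\<in>S. F g $$ ij)"

lemma mat_sum_carrier [simp]: "mat_sum m n F S \<in> carrier_mat m n"
  by (simp add: mat_sum_def)

lemma mat_sum_index: "i < m \<Longrightarrow> j < n \<Longrightarrow> mat_sum m n F S $$ (i, j) = (\<Sum>g\<in>S. F g $$ (i, j))"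
  by (simp add: mat_sum_def)

lemma mult_mat_sum:
  assumes A: "A \<in> carrier_mat k m" and F: "\<And>g. g \<in> S \<Longrightarrow> F g \<in> carrier_mat m n"
  shows "A * mat_sum m n F S = mat_sum k n (\<lambda>g. A * F g) S"
proof (rule eq_matI)
  fix i j assume "i < dim_row (mat_sum k n (\<lambda>g. A * F g) S)" "j < dim_col (mat_sum k n (\<lambda>g. A * F g) S)"
  then have ij: "i < k" "j < n" by (auto simp: mat_sum_def)
  have "(A * mat_sum m n F S) $$ (i, j) = (\<Sum>l<m. \<Sum>g\<in>S. A $$ (i, l) * F g $$ (l, j))"
    by (subst index_mult_mat_sum[OF A mat_sum_carrier ij])
      (auto simp: mat_sum_index ij sum_distrib_left intro!: sum.cong)
  also have "\<dots> = (\<Sum>g\<in>S. \<Sum>l<m. A $$ (i, l) * F g $$ (l, j))" by (rule sum.swap)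
  also have "\<dots> = mat_sum k n (\<lambda>g. A * F g) S $$ (i, j)"
    unfolding mat_sum_index[OF ij] by (rule sum.cong[OF refl]) (simp add: index_mult_mat_sum[OF A F ij])
  finally show "(A * mat_sum m n F S) $$ (i, j) = mat_sum k n (\<lambda>g. A * F g) S $$ (i, j)" .
qed (use A in \<open>auto simp: mat_sum_def\<close>)

lemma mat_sum_mult:
  assumes A: "A \<in> carrier_mat n k" and F: "\<And>g. g \<in> S \<Longrightarrow> F g \<in> carrier_mat m n"
  shows "mat_sum m n F S * A = mat_sum m k (\<lambda>g. F g * A) S"
proof (rule eq_matI)
  fix i j assume "i < dim_row (mat_sum m k (\<lambda>g. F g * A) S)" "j < dim_col (mat_sum m k (\<lambda>g. F g * A) S)"
  then have ij: "i < m" "j < k" by (auto simp: mat_sum_def)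
  have "(mat_sum m n F S * A) $$ (i, j) = (\<Sum>l<n. \<Sum>g\<in>S. F g $$ (i, l) * A $$ (l, j))"
    by (subst index_mult_mat_sum[OF mat_sum_carrier A ij])
      (auto simp: mat_sum_index ij sum_distrib_right intro!: sum.cong)
  also have "\<dots> = (\<Sum>g\<in>S. \<Sum>l<n. F g $$ (i, l) * A $$ (l, j))" by (rule sum.swap)
  also have "\<dots> = mat_sum m k (\<lambda>g. F g * A) S $$ (i, j)"
    unfolding mat_sum_index[OF ij] by (rule sum.cong[OF refl]) (simp add: index_mult_mat_sum[OF F A ij])
  finally show "(mat_sum m n F S * A) $$ (i, j) = mat_sum m k (\<lambda>g. F g * A) S $$ (i, j)" .
qed (use A in \<open>auto simp: mat_sum_def\<close>)

lemma mat_sum_cong: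
  assumes "\<And>g. g \<in> S \<Longrightarrow> F g = F' g" shows "mat_sum m n F S = mat_sum m n F' S"
  using assms by (auto simp: mat_sum_def intro!: sum.cong)

lemma mat_sum_reindex:
  assumes "bij_betw h S T" shows "mat_sum m n F T = mat_sum m n (\<lambda>g. F (h g)) S"
  unfolding mat_sum_def using sum.reindex_bij_betw[OF assms, of "\<lambda>g. F g $$ _"] by simp


section \<open>Schur's lemma\<close>

lemma subspace_module_vec_iff:
  "VectorSpace.subspace class_ring W (module_vec TYPE(complex) d) \<longleftrightarrow>
     W \<subseteq> carrier_vec d \<and> 0\<^sub>v d \<in> W \<and> (\<forall>v\<in>W. \<forall>w\<in>W. v + w \<in> W) \<and> (\<forall>c. \<forall>v\<in>W. c \<cdot>\<^sub>v v \<in> W)"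
proof -
  interpret vec_space "TYPE(complex)" d .
  show ?thesis
    using vec_vs vec_module
    by (auto simp: VectorSpace.subspace_def submodule_def module_vec_simps class_ring_simps)
qed

text \<open>A multiplicative map that preserves the identity takes inverses to inverses.\<close>

lemma (in group) matrix_rep_iff:
  "matrix_rep G d R \<longleftrightarrow> (\<forall>g\<in>carrier G. R g \<in> carrier_mat d d) \<and>
     (\<forall>g\<in>carrier G. \<forall>h\<in>carrier G. R (g \<otimes> h) = R g * R h) \<and> R \<one> = 1\<^sub>m d"
  (is "?L \<longleftrightarrow> ?A \<and> ?B \<and> ?C")
proof
  let ?U = "units_of (ring_mat TYPE(complex) d ())"
  have car: "carrier ?U = {A \<in> carrier_mat d d. \<exists>B\<in>carrier_mat d d. B * A = 1\<^sub>m d \<and> A * B = 1\<^sub>m d}"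
    by (simp add: units_of_def Units_def ring_mat_def)
  have mult: "A \<otimes>\<^bsub>?U\<^esub> B = A * B" for A B by (simp add: units_of_def ring_mat_def)
  {
    assume L: ?L
    then have 1: ?A and 2: ?B unfolding matrix_rep_def hom_def by (auto simp: car mult)
    have R1: "R \<one> \<in> carrier_mat d d" using 1 by simp
    have "R \<one> \<in> carrier ?U" using L unfolding matrix_rep_def hom_def by auto
    then obtain B where B: "B \<in> carrier_mat d d" "B * R \<one> = 1\<^sub>m d" by (auto simp: car)
    have "R \<one> = (B * R \<one>) * R \<one>" using R1 B by simp
    also have "\<dots> = B * (R \<one> * R \<one>)" by (rule assoc_mult_mat[OF B(1) R1 R1])
    also have "R \<one> * R \<one> = R \<one>" using 2[rule_format, of \<one> \<one>] by simp
    finally show "?A \<and> ?B \<and> ?C" using 1 2 B by simp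
  next
    assume R: "?A \<and> ?B \<and> ?C"
    have "R g \<in> carrier ?U" if g: "g \<in> carrier G" for g
    proof -
      have "R (inv g) * R g = 1\<^sub>m d" "R g * R (inv g) = 1\<^sub>m d"
        using R g by (metis inv_closed l_inv, metis inv_closed r_inv)
      then show ?thesis unfolding car using R g by blast
    qed
    then show ?L using R unfolding matrix_rep_def hom_def by (auto simp: mult)
  }
qed

context group
begin

lemma matrix_repD:
  assumes "matrix_rep G d R"
  shows "\<And>g. g \<in> carrier G \<Longrightarrow> R g \<in> carrier_mat d d"
    and "\<And>g h. g \<in> carrier G \<Longrightarrow> h \<in> carrier G \<Longrightarrow> R (g \<otimes> h) = R g * R h"
    and "R \<one> = 1\<^sub>m d"
  using assms unfolding matrix_rep_iff by auto

lemma matrix_rep_inv: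
  assumes "matrix_rep G d R" "g \<in> carrier G"
  shows "R (inv g) * R g = 1\<^sub>m d" "R g * R (inv g) = 1\<^sub>m d"
  using matrix_repD[OF assms(1)] assms(2) by (metis inv_closed l_inv, metis inv_closed r_inv)

lemma irreducible_repE:
  assumes "irreducible_rep G R"
  obtains d where "d > 0" "matrix_rep G d R"
    "\<And>W. W \<subseteq> carrier_vec d \<Longrightarrow> 0\<^sub>v d \<in> W \<Longrightarrow> (\<And>v w. v \<in> W \<Longrightarrow> w \<in> W \<Longrightarrow> v + w \<in> W) \<Longrightarrow>
      (\<And>c v. v \<in> W \<Longrightarrow> c \<cdot>\<^sub>v v \<in> W) \<Longrightarrow> (\<And>g w. g \<in> carrier G \<Longrightarrow> w \<in> W \<Longrightarrow> R g *\<^sub>v w \<in> W) \<Longrightarrow>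
      W = {0\<^sub>v d} \<or> W = carrier_vec d"
proof -
  obtain d where d: "d > 0" "matrix_rep G d R"
    "\<forall>W. VectorSpace.subspace class_ring W (module_vec TYPE(complex) d) \<longrightarrow>
           (\<forall>g\<in>carrier G. \<forall>w\<in>W. R g *\<^sub>v w \<in> W) \<longrightarrow> W = {0\<^sub>v d} \<or> W = carrier_vec d"
    using assms unfolding irreducible_rep_def by blast
  show thesis
  proof (rule that[OF d(1,2)], goal_cases)
    case (1 W)
    then have "VectorSpace.subspace class_ring W (module_vec TYPE(complex) d)"
      unfolding subspace_module_vec_iff by blast
    then show ?case using 1(5) d(3) by blast
  qed
qed

lemma matrix_rep_degree_unique:
  assumes "matrix_rep G d R" "matrix_rep G e R" shows "d = e"
  using matrix_repD(1)[OF assms(1), of \<one>] matrix_repD(1)[OF assms(2), of \<one>] by auto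

text \<open>Schur's lemma: the kernel and the range of an intertwining matrix are invariant.\<close>

lemma schur_kernel:
  assumes R: "matrix_rep G m R" and S: "irreducible_rep G S" "matrix_rep G n S"
    and T: "T \<in> carrier_mat m n" and comm: "\<And>g. g \<in> carrier G \<Longrightarrow> R g * T = T * S g"
    and nz: "T \<noteq> 0\<^sub>m m n" and v: "v \<in> carrier_vec n" "T *\<^sub>v v = 0\<^sub>v m"
  shows "v = 0\<^sub>v n"
proof -
  note Rc = matrix_repD(1)[OF R] and Sc = matrix_repD(1)[OF S(2)]
  have eqv: "R g *\<^sub>v (T *\<^sub>v v) = T *\<^sub>v (S g *\<^sub>v v)" if "g \<in> carrier G" "v \<in> carrier_vec n" for g v
    using comm[OF that(1)] assoc_mult_mat_vec[OF Rc[OF that(1)] T that(2)]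
      assoc_mult_mat_vec[OF T Sc[OF that(1)] that(2)] by simp
  define K where "K = {v \<in> carrier_vec n. T *\<^sub>v v = 0\<^sub>v m}"
  have "K = {0\<^sub>v n} \<or> K = carrier_vec n"
  proof (rule irreducible_repE[OF S(1)], goal_cases)
    case (1 e)
    have e: "e = n" using matrix_rep_degree_unique[OF 1(2) S(2)] .
    show ?case
    proof (rule 1(3)[unfolded e])
      fix g w assume g: "g \<in> carrier G" and w: "w \<in> K"
      have "R g *\<^sub>v 0\<^sub>v m = 0\<^sub>v m" using Rc[OF g] by (intro eq_vecI) auto
      then show "S g *\<^sub>v w \<in> K" using eqv[OF g, of w] w Sc[OF g] by (auto simp: K_def)
    qed (use T in \<open>auto simp: K_def mult_add_distrib_mat_vec[of _ m n] mult_mat_vec[of _ m n] intro!: eq_vecI\<close>)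
  qed
  moreover have "K \<noteq> carrier_vec n"
  proof
    assume "K = carrier_vec n"
    have "T = 0\<^sub>m m n"
    proof (rule mat_eq_if_mult_vec_eq[OF T])
      fix v :: "complex vec" assume v: "v \<in> carrier_vec n"
      then have "T *\<^sub>v v = 0\<^sub>v m" using \<open>K = carrier_vec n\<close> by (auto simp: K_def)
      then show "T *\<^sub>v v = 0\<^sub>m m n *\<^sub>v v" using v by (auto intro!: eq_vecI)
    qed simp
    with nz show False by simp
  qed
  ultimately show ?thesis using v by (auto simp: K_def)
qed

lemma schur_right_inverse:
  assumes R: "irreducible_rep G R" "matrix_rep G m R" and S: "matrix_rep G n S"
    and T: "T \<in> carrier_mat m n" and comm: "\<And>g. g \<in> carrier G \<Longrightarrow> R g * T = T * S g"
    and nz: "T \<noteq> 0\<^sub>m m n"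
  shows "\<exists>Q\<in>carrier_mat n m. T * Q = 1\<^sub>m m"
proof -
  note Rc = matrix_repD(1)[OF R(2)] and Sc = matrix_repD(1)[OF S]
  have eqv: "R g *\<^sub>v (T *\<^sub>v v) = T *\<^sub>v (S g *\<^sub>v v)" if "g \<in> carrier G" "v \<in> carrier_vec n" for g v
    using comm[OF that(1)] assoc_mult_mat_vec[OF Rc[OF that(1)] T that(2)]
      assoc_mult_mat_vec[OF T Sc[OF that(1)] that(2)] by simp
  define I where "I = {T *\<^sub>v v |v. v \<in> carrier_vec n}"
  have "I = {0\<^sub>v m} \<or> I = carrier_vec m"
  proof (rule irreducible_repE[OF R(1)], goal_cases)
    case (1 e)
    have e: "e = m" using matrix_rep_degree_unique[OF 1(2) R(2)] .
    show ?case
    proof (rule 1(3)[unfolded e])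
      show "I \<subseteq> carrier_vec m" using T by (auto simp: I_def)
      have "T *\<^sub>v 0\<^sub>v n = 0\<^sub>v m" using T by (intro eq_vecI) auto
      then show "0\<^sub>v m \<in> I" unfolding I_def by (metis (mono_tags, lifting) mem_Collect_eq zero_carrier_vec)
      show "v + w \<in> I" if vw: "v \<in> I" "w \<in> I" for v w
      proof -
        obtain a b where "v = T *\<^sub>v a" "w = T *\<^sub>v b" "a \<in> carrier_vec n" "b \<in> carrier_vec n"
          using vw unfolding I_def by blast
        then show ?thesis unfolding I_def using mult_add_distrib_mat_vec[OF T, of a b]
          by (metis (mono_tags, lifting) add_carrier_vec mem_Collect_eq)
      qed
      show "c \<cdot>\<^sub>v v \<in> I" if v: "v \<in> I" for c v
      proof -
        obtain a where "v = T *\<^sub>v a" "a \<in> carrier_vec n"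
          using v unfolding I_def by blast
        then show ?thesis unfolding I_def using mult_mat_vec[OF T, of a c]
          by (metis (mono_tags, lifting) smult_carrier_vec mem_Collect_eq)
      qed
      show "R g *\<^sub>v v \<in> I" if g: "g \<in> carrier G" and v: "v \<in> I" for g v
      proof -
        obtain a where "v = T *\<^sub>v a" "a \<in> carrier_vec n"
          using v unfolding I_def by blast
        then show ?thesis unfolding I_def using eqv[OF g, of a] Sc[OF g]
          by (metis (mono_tags, lifting) mult_mat_vec_carrier mem_Collect_eq)
      qed
    qed
  qed
  moreover have "I \<noteq> {0\<^sub>v m}"
  proof
    assume "I = {0\<^sub>v m}"
    then have z: "T *\<^sub>v v = 0\<^sub>v m" if "v \<in> carrier_vec n" for v using that by (auto simp: I_def)
    have "T = 0\<^sub>m m n"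
    proof (rule mat_eq_if_mult_vec_eq[OF T])
      fix v :: "complex vec" assume v: "v \<in> carrier_vec n"
      then show "T *\<^sub>v v = 0\<^sub>m m n *\<^sub>v v" using z[OF v] by (auto intro!: eq_vecI)
    qed simp
    with nz show False by simp
  qed
  ultimately have I: "I = carrier_vec m" by simp
  have "\<exists>q. q \<in> carrier_vec n \<and> T *\<^sub>v q = unit_vec m j" for j
    using I unit_vec_carrier[of m j] unfolding I_def by (smt (verit) mem_Collect_eq)
  then obtain q where q: "\<And>j. q j \<in> carrier_vec n" "\<And>j. T *\<^sub>v q j = unit_vec m j" by metis
  define Q where "Q = mat n m (\<lambda>(i, j). q j $ i)"
  have Q: "Q \<in> carrier_mat n m" by (simp add: Q_def)
  have colQ: "col Q j = q j" if "j < m" for j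
    using that q(1)[of j] by (intro eq_vecI) (auto simp: Q_def)
  have TQ: "T * Q = 1\<^sub>m m"
  proof (rule eq_matI)
    fix i j assume "i < dim_row (1\<^sub>m m :: complex mat)" "j < dim_col (1\<^sub>m m :: complex mat)"
    then have ij: "i < m" "j < m" by auto
    have "(T * Q) $$ (i, j) = (T *\<^sub>v col Q j) $ i" using ij T Q by simp
    also have "\<dots> = 1\<^sub>m m $$ (i, j)" using ij q(2)[of j] by (simp add: colQ)
    finally show "(T * Q) $$ (i, j) = 1\<^sub>m m $$ (i, j)" .
  qed (use T Q in auto)
  with Q show ?thesis by blast
qed

lemma schur_invertible:
  assumes R: "irreducible_rep G R" "matrix_rep G m R" and S: "irreducible_rep G S" "matrix_rep G n S"
    and T: "T \<in> carrier_mat m n" and comm: "\<And>g. g \<in> carrier G \<Longrightarrow> R g * T = T * S g"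
    and nz: "T \<noteq> 0\<^sub>m m n"
  shows "\<exists>Q\<in>carrier_mat n m. T * Q = 1\<^sub>m m \<and> Q * T = 1\<^sub>m n"
proof -
  obtain Q where Q: "Q \<in> carrier_mat n m" and TQ: "T * Q = 1\<^sub>m m"
    using schur_right_inverse[OF R S(2) T comm nz] by blast
  have "Q * T = 1\<^sub>m n"
  proof (rule mat_eq_if_mult_vec_eq[of _ n n])
    fix v :: "complex vec" assume v: "v \<in> carrier_vec n"
    have "T *\<^sub>v ((Q * T) *\<^sub>v v) = T *\<^sub>v v"
      using assoc_mult_mat_vec[OF mult_carrier_mat[OF T Q] T v] assoc_mult_mat_vec[OF Q T v] 
        assoc_mult_mat_vec[OF T Q mult_mat_vec_carrier[OF T v]] TQ T v by simp
    then have "T *\<^sub>v ((Q * T) *\<^sub>v v - v) = 0\<^sub>v m"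
      using T Q v by (simp add: mult_minus_distrib_mat_vec[of _ m n])
    then have z: "(Q * T) *\<^sub>v v - v = 0\<^sub>v n"
      by (intro schur_kernel[OF R(2) S T comm nz]) (use T Q v in auto)
    show "(Q * T) *\<^sub>v v = 1\<^sub>m n *\<^sub>v v"
    proof (rule eq_vecI)
      fix i assume "i < dim_vec (1\<^sub>m n *\<^sub>v v)"
      then have "((Q * T) *\<^sub>v v - v) $ i = 0" "i < n" using z v by auto
      then show "((Q * T) *\<^sub>v v) $ i = (1\<^sub>m n *\<^sub>v v) $ i" using v Q T by simp
    qed (use Q in simp)
  qed (use T Q in auto)
  with TQ Q show ?thesis by blast
qed

lemma equivalent_rep_if_invertible_intertwiner:
  assumes R: "matrix_rep G m R" and S: "matrix_rep G n S"
    and T: "T \<in> carrier_mat m n" and comm: "\<And>g. g \<in> carrier G \<Longrightarrow> R g * T = T * S g"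
    and Q: "Q \<in> carrier_mat n m" "T * Q = 1\<^sub>m m" "Q * T = 1\<^sub>m n"
  shows "equivalent_rep G R S"
  unfolding equivalent_rep_def
proof (intro exI ballI)
  fix g assume g: "g \<in> carrier G"
  have mn: "m = n" by (rule inverse_pair_imp_square[OF T Q])
  note Rg = matrix_repD(1)[OF R g]
  have "R g = R g * (T * Q)" using Q(2) Rg by simp
  also have "\<dots> = T * S g * Q" using assoc_mult_mat[OF Rg T Q(1)] comm[OF g] by simp
  finally show "similar_mat_wit (R g) (S g) T Q"
    by (intro similar_mat_witI[of _ _ m]) (use mn Q T Rg matrix_repD(1)[OF S g] in auto)
qed

lemma schur_equivalent:
  assumes R: "irreducible_rep G R" "matrix_rep G m R" and S: "irreducible_rep G S" "matrix_rep G n S"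
    and T: "T \<in> carrier_mat m n" and comm: "\<And>g. g \<in> carrier G \<Longrightarrow> R g * T = T * S g"
    and nz: "T \<noteq> 0\<^sub>m m n"
  shows "equivalent_rep G R S"
  using schur_invertible[OF assms] equivalent_rep_if_invertible_intertwiner[OF R(2) S(2) T comm] by blast

text \<open>Algebraic closedness of the complex numbers enters here.\<close>

lemma ex_eigenvector:
  fixes T :: "complex mat"
  assumes T: "T \<in> carrier_mat d d" and "d > 0"
  shows "\<exists>c. \<exists>v\<in>carrier_vec d. v \<noteq> 0\<^sub>v d \<and> T *\<^sub>v v = c \<cdot>\<^sub>v v"
proof -
  have "degree (char_poly T) = d" using degree_monic_char_poly[OF T] by simp
  then have "\<not> constant (poly (char_poly T))" using \<open>d > 0\<close> by (simp add: constant_degree)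
  then obtain c where "poly (char_poly T) c = 0" using fundamental_theorem_of_algebra by blast
  then have "eigenvalue T c" using eigenvalue_root_char_poly[OF T] by simp
  then show ?thesis using T unfolding eigenvalue_def eigenvector_def by auto
qed

text \<open>The eigenspaces of an intertwining matrix are invariant.\<close>

lemma schur_scalar:
  assumes R: "irreducible_rep G R" "matrix_rep G d R"
    and T: "T \<in> carrier_mat d d" and comm: "\<And>g. g \<in> carrier G \<Longrightarrow> R g * T = T * R g"
  shows "\<exists>c. T = c \<cdot>\<^sub>m 1\<^sub>m d"
proof -
  note Rc = matrix_repD(1)[OF R(2)]
  have "d > 0" using irreducible_repE[OF R(1)] matrix_rep_degree_unique[OF R(2)] by metis
  then obtain c v where v: "v \<in> carrier_vec d" "v \<noteq> 0\<^sub>v d" "T *\<^sub>v v = c \<cdot>\<^sub>v v"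
    using ex_eigenvector[OF T] by blast
  define K where "K = {v \<in> carrier_vec d. T *\<^sub>v v = c \<cdot>\<^sub>v v}"
  have "K = {0\<^sub>v d} \<or> K = carrier_vec d"
  proof (rule irreducible_repE[OF R(1)], goal_cases)
    case (1 e)
    have e: "e = d" using matrix_rep_degree_unique[OF 1(2) R(2)] .
    show ?case
    proof (rule 1(3)[unfolded e])
      fix g w assume g: "g \<in> carrier G" and w: "w \<in> K"
      then have wd: "w \<in> carrier_vec d" by (simp add: K_def)
      have "T *\<^sub>v (R g *\<^sub>v w) = R g *\<^sub>v (T *\<^sub>v w)"
        using comm[OF g] assoc_mult_mat_vec[OF Rc[OF g] T wd] assoc_mult_mat_vec[OF T Rc[OF g] wd] by simp
      also have "\<dots> = c \<cdot>\<^sub>v (R g *\<^sub>v w)" using w mult_mat_vec[OF Rc[OF g] wd] by (simp add: K_def)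
      finally show "R g *\<^sub>v w \<in> K" using wd Rc[OF g] by (simp add: K_def)
    qed (use T in \<open>auto simp: K_def mult_add_distrib_mat_vec[of _ d d] mult_mat_vec[of _ d d]
           smult_add_distrib_vec[of _ d] smult_smult_assoc mult.commute intro!: eq_vecI\<close>)
  qed
  moreover have "v \<in> K" using v by (simp add: K_def)
  ultimately have K: "K = carrier_vec d" using v(2) by auto
  have "T = c \<cdot>\<^sub>m 1\<^sub>m d"
  proof (rule mat_eq_if_mult_vec_eq[OF T])
    fix w :: "complex vec" assume w: "w \<in> carrier_vec d"
    then have "T *\<^sub>v w = c \<cdot>\<^sub>v w" using K by (auto simp: K_def)
    also have "\<dots> = (c \<cdot>\<^sub>m 1\<^sub>m d) *\<^sub>v w" using w by (intro eq_vecI) auto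
    finally show "T *\<^sub>v w = (c \<cdot>\<^sub>m 1\<^sub>m d) *\<^sub>v w" .
  qed simp
  then show ?thesis by blast
qed

end


section \<open>Orthogonality of characters and complete reducibility\<close>

locale finite_group = group G for G (structure) +
  assumes finite_carrier: "finite (carrier G)"

context finite_group
begin

lemma card_nz: "card (carrier G) > 0"
  using finite_carrier one_closed by (metis card_gt_0_iff empty_iff)

text \<open>Without division by the group order; what matters is that the result intertwines \<open>S\<close> and \<open>R\<close>.\<close>

definition average :: "nat \<Rightarrow> nat \<Rightarrow> ('a \<Rightarrow> complex mat) \<Rightarrow> ('a \<Rightarrow> complex mat) \<Rightarrow> complex mat \<Rightarrow> complex mat" where
  "average m n R S X = mat_sum m n (\<lambda>g. R g * X * S (inv g)) (carrier G)"

lemma average_carrier [simp]: "average m n R S X \<in> carrier_mat m n"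
  by (simp add: average_def)

lemma bij_betw_mult_left:
  assumes "h \<in> carrier G" shows "bij_betw ((\<otimes>) h) (carrier G) (carrier G)"
  by (rule bij_betw_byWitness[where f' = "(\<otimes>) (inv h)"])
    (use assms in \<open>auto simp: inv_solve_left m_assoc[symmetric]\<close>)

lemma average_intertwines:
  assumes R: "matrix_rep G m R" and S: "matrix_rep G n S" and X: "X \<in> carrier_mat m n"
    and h: "h \<in> carrier G"
  shows "R h * average m n R S X = average m n R S X * S h"
proof -
  note Rc = matrix_repD(1)[OF R] and Sc = matrix_repD(1)[OF S]
  have car: "R g * X * S g' \<in> carrier_mat m n" if "g \<in> carrier G" "g' \<in> carrier G" for g g'
    by (rule mult_carrier_mat[OF mult_carrier_mat[OF Rc[OF that(1)] X] Sc[OF that(2)]])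
  have "average m n R S X * S h = mat_sum m n (\<lambda>g. R g * X * S (inv g) * S h) (carrier G)"
    unfolding average_def by (rule mat_sum_mult[OF Sc[OF h] car]) auto
  also have "\<dots> = mat_sum m n (\<lambda>g. R (h \<otimes> g) * X * S (inv (h \<otimes> g)) * S h) (carrier G)"
    by (rule mat_sum_reindex[OF bij_betw_mult_left[OF h]])
  also have "\<dots> = mat_sum m n (\<lambda>g. R h * (R g * X * S (inv g))) (carrier G)"
  proof (rule mat_sum_cong)
    fix g assume g: "g \<in> carrier G"
    have "S (inv (h \<otimes> g)) * S h = S (inv g)"
      using g h matrix_repD(2)[OF S, of "inv (h \<otimes> g)" h, symmetric] by (simp add: inv_mult_group m_assoc)
    moreover have "R (h \<otimes> g) * X * S (inv (h \<otimes> g)) * S h = R (h \<otimes> g) * X * (S (inv (h \<otimes> g)) * S h)"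
      by (rule assoc_mult_mat[of _ m n _ n _ n]) (use g h X Rc Sc in \<open>auto intro!: mult_carrier_mat[of _ m m _ n]\<close>)
    moreover have "R (h \<otimes> g) * X = R h * (R g * X)"
      using g h matrix_repD(2)[OF R h g] assoc_mult_mat[OF Rc[OF h] Rc[OF g] X] by simp
    moreover have "R h * (R g * X) * S (inv g) = R h * (R g * X * S (inv g))"
      by (rule assoc_mult_mat[of _ m m _ n _ n]) (use g h X Rc Sc in \<open>auto intro!: mult_carrier_mat[of _ m m _ n]\<close>)
    ultimately show "R (h \<otimes> g) * X * S (inv (h \<otimes> g)) * S h = R h * (R g * X * S (inv g))"
      by simp
  qed
  also have "\<dots> = R h * average m n R S X"
    unfolding average_def by (rule mult_mat_sum[OF Rc[OF h] car, symmetric]) auto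
  finally show ?thesis by simp
qed

definition elementary :: "nat \<Rightarrow> nat \<Rightarrow> nat \<Rightarrow> nat \<Rightarrow> complex mat" where
  "elementary m n k l = mat m n (\<lambda>(i, j). if i = k \<and> j = l then 1 else 0)"

lemma average_elementary:
  assumes R: "matrix_rep G m R" and S: "matrix_rep G n S"
    and "i < m" "k < m" "l < n" "j < n"
  shows "average m n R S (elementary m n k l) $$ (i, j) = (\<Sum>g\<in>carrier G. R g $$ (i, k) * S (inv g) $$ (l, j))"
proof -
  have "(R g * elementary m n k l * S (inv g)) $$ (i, j) = R g $$ (i, k) * S (inv g) $$ (l, j)"
    if g: "g \<in> carrier G" for g
  proof -
    have E: "elementary m n k l \<in> carrier_mat m n" by (simp add: elementary_def)
    note Rg = matrix_repD(1)[OF R g] and Sg = matrix_repD(1)[OF S inv_closed[OF g]]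
    have "(R g * elementary m n k l) $$ (i, b) = (if b = l then R g $$ (i, k) else 0)" if "b < n" for b
      using assms that by (subst index_mult_mat_sum[OF Rg E])
        (auto simp: elementary_def if_distrib[of "\<lambda>x. _ * x"] cong: if_cong)
    then show ?thesis
      using assms by (subst index_mult_mat_sum[OF mult_carrier_mat[OF Rg E] Sg])
        (auto simp: if_distrib[of "\<lambda>x. x * _"] cong: if_cong)
  qed
  then show ?thesis using assms by (simp add: average_def mat_sum_index)
qed

lemma matrix_coefficients_orthogonal:
  assumes R: "irreducible_rep G R" "matrix_rep G m R" and S: "irreducible_rep G S" "matrix_rep G n S"
    and ne: "\<not> equivalent_rep G R S" and ind: "i < m" "k < m" "l < n" "j < n"
  shows "(\<Sum>g\<in>carrier G. R g $$ (i, k) * S (inv g) $$ (l, j)) = 0"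
proof -
  have E: "elementary m n k l \<in> carrier_mat m n" by (simp add: elementary_def)
  have "average m n R S (elementary m n k l) = 0\<^sub>m m n"
    using schur_equivalent[OF R S average_carrier average_intertwines[OF R(2) S(2) E]] ne by blast
  then show ?thesis using ind by (simp add: average_elementary[OF R(2) S(2) ind, symmetric])
qed

text \<open>Averaging an elementary matrix gives a scalar matrix by Schur's lemma; its trace determines the
  scalar.\<close>

lemma matrix_coefficients_orthonormal:
  assumes R: "irreducible_rep G R" "matrix_rep G d R" and ind: "i < d" "k < d" "l < d" "j < d"
  shows "(\<Sum>g\<in>carrier G. R g $$ (i, k) * R (inv g) $$ (l, j)) =
    (if i = j \<and> k = l then of_nat (card (carrier G)) / of_nat d else 0)"
proof -
  have E: "elementary d d k l \<in> carrier_mat d d" by (simp add: elementary_def)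
  have d: "d > 0" using ind by simp
  obtain c where c: "average d d R R (elementary d d k l) = c \<cdot>\<^sub>m 1\<^sub>m d"
    using schur_scalar[OF R average_carrier average_intertwines[OF R(2) R(2) E]] by blast
  have entry: "(\<Sum>g\<in>carrier G. R g $$ (a, k) * R (inv g) $$ (l, b)) = (if a = b then c else 0)"
    if "a < d" "b < d" for a b
    using that ind average_elementary[OF R(2) R(2) that(1) ind(2,3) that(2)] by (simp add: c split: if_splits)
  have "of_nat d * c = (\<Sum>a<d. \<Sum>g\<in>carrier G. R g $$ (a, k) * R (inv g) $$ (l, a))"
    by (simp add: entry)
  also have "\<dots> = (\<Sum>g\<in>carrier G. \<Sum>a<d. R (inv g) $$ (l, a) * R g $$ (a, k))"
    by (subst sum.swap) (simp add: mult.commute)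
  also have "\<dots> = (\<Sum>g\<in>carrier G. if k = l then 1 else 0)"
  proof (rule sum.cong[OF refl])
    fix g assume g: "g \<in> carrier G"
    have "(\<Sum>a<d. R (inv g) $$ (l, a) * R g $$ (a, k)) = (R (inv g) * R g) $$ (l, k)"
      using g ind matrix_repD(1)[OF R(2)] by (subst index_mult_mat_sum[of _ d d _ d]) auto
    also have "\<dots> = (if k = l then 1 else 0)" using matrix_rep_inv(1)[OF R(2) g] ind by simp
    finally show "(\<Sum>a<d. R (inv g) $$ (l, a) * R g $$ (a, k)) = (if k = l then 1 else 0)" .
  qed
  finally have "of_nat d * c = (if k = l then of_nat (card (carrier G)) else 0)" by auto
  then have "c = (if k = l then of_nat (card (carrier G)) / of_nat d else 0)"
    using d by (auto simp: field_simps split: if_splits)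
  then show ?thesis using entry[OF ind(1,4)] by simp
qed

lemma character_sum_eq:
  assumes R: "matrix_rep G m R" and S: "matrix_rep G n S"
  shows "(\<Sum>g\<in>carrier G. tr (R g) * tr (S (inv g))) =
    (\<Sum>i<m. \<Sum>j<n. \<Sum>g\<in>carrier G. R g $$ (i, i) * S (inv g) $$ (j, j))"
proof -
  have "tr (R g) * tr (S (inv g)) = (\<Sum>i<m. \<Sum>j<n. R g $$ (i, i) * S (inv g) $$ (j, j))"
    if g: "g \<in> carrier G" for g
    using matrix_repD(1)[OF R g] matrix_repD(1)[OF S inv_closed[OF g]] by (simp add: tr_def sum_product)
  then have "(\<Sum>g\<in>carrier G. tr (R g) * tr (S (inv g))) =
      (\<Sum>g\<in>carrier G. \<Sum>i<m. \<Sum>j<n. R g $$ (i, i) * S (inv g) $$ (j, j))" by simp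
  also have "\<dots> = (\<Sum>i<m. \<Sum>g\<in>carrier G. \<Sum>j<n. R g $$ (i, i) * S (inv g) $$ (j, j))" by (rule sum.swap)
  also have "\<dots> = (\<Sum>i<m. \<Sum>j<n. \<Sum>g\<in>carrier G. R g $$ (i, i) * S (inv g) $$ (j, j))"
    by (intro sum.cong refl sum.swap)
  finally show ?thesis .
qed

lemma irreducible_has_matrix_rep:
  assumes "irreducible_rep G R" obtains d where "d > 0" "matrix_rep G d R"
  using irreducible_repE[OF assms] by metis

lemma characters_orthogonal:
  assumes R: "irreducible_rep G R" and S: "irreducible_rep G S" and ne: "\<not> equivalent_rep G R S"
  shows "(\<Sum>g\<in>carrier G. tr (R g) * tr (S (inv g))) = 0"
proof -
  obtain m n where mn: "matrix_rep G m R" "matrix_rep G n S"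
    using irreducible_has_matrix_rep[OF R] irreducible_has_matrix_rep[OF S] by metis
  show ?thesis unfolding character_sum_eq[OF mn]
    by (intro sum.neutral ballI matrix_coefficients_orthogonal[OF R mn(1) S mn(2) ne]) auto
qed

lemma characters_orthonormal:
  assumes R: "irreducible_rep G R"
  shows "(\<Sum>g\<in>carrier G. tr (R g) * tr (R (inv g))) = of_nat (card (carrier G))"
proof -
  obtain d where d: "d > 0" "matrix_rep G d R" using irreducible_has_matrix_rep[OF R] by metis
  have "(\<Sum>g\<in>carrier G. tr (R g) * tr (R (inv g))) =
      (\<Sum>i<d. \<Sum>j<d. if i = j then of_nat (card (carrier G)) / of_nat d else 0)"
    unfolding character_sum_eq[OF d(2) d(2)]
    by (intro sum.cong refl) (simp add: matrix_coefficients_orthonormal[OF R d(2)])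
  also have "\<dots> = of_nat (card (carrier G))" using d(1) by (simp add: sum.delta)
  finally show ?thesis .
qed

lemma equivalent_rep_tr:
  assumes "equivalent_rep G R S" "g \<in> carrier G" shows "tr (R g) = tr (S g)"
  using assms tr_similar unfolding equivalent_rep_def by blast

lemma equivalent_rep_sym: "equivalent_rep G R S \<Longrightarrow> equivalent_rep G S R"
  unfolding equivalent_rep_def using similar_mat_wit_sym by blast

lemma equivalent_rep_trans: "equivalent_rep G R S \<Longrightarrow> equivalent_rep G S T \<Longrightarrow> equivalent_rep G R T"
  unfolding equivalent_rep_def using similar_mat_wit_trans by blast

lemma equivalent_rep_refl: "matrix_rep G d R \<Longrightarrow> equivalent_rep G R R"
  unfolding equivalent_rep_def using matrix_repD(1) similar_mat_wit_refl by blast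

lemma character_inner_product:
  assumes R: "irreducible_rep G R" and S: "irreducible_rep G S"
  shows "(\<Sum>g\<in>carrier G. tr (R g) * tr (S (inv g))) = (if equivalent_rep G R S then of_nat (card (carrier G)) else 0)"
proof (cases "equivalent_rep G R S")
  case True
  then have "(\<Sum>g\<in>carrier G. tr (R g) * tr (S (inv g))) = (\<Sum>g\<in>carrier G. tr (R g) * tr (R (inv g)))"
    by (intro sum.cong refl) (simp add: equivalent_rep_tr)
  with True characters_orthonormal[OF R] show ?thesis by simp
qed (use characters_orthogonal[OF R S] in simp)

text \<open>Let \<open>W\<close> be the range of an injective matrix \<open>B\<close>. Averaging a left inverse of \<open>B\<close> over the group
  gives a left inverse \<open>C\<close> that intertwines, so the kernel of \<open>C\<close> is an invariant complement of \<open>W\<close>.\<close>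

lemma maschke_split:
  assumes R: "matrix_rep G d R" and W: "W \<subseteq> carrier_vec d" "0\<^sub>v d \<in> W"
    and add: "\<And>v w. v \<in> W \<Longrightarrow> w \<in> W \<Longrightarrow> v + w \<in> W"
    and smult: "\<And>c v. v \<in> W \<Longrightarrow> c \<cdot>\<^sub>v v \<in> W"
    and inv: "\<And>g w. g \<in> carrier G \<Longrightarrow> w \<in> W \<Longrightarrow> R g *\<^sub>v w \<in> W"
    and proper: "W \<noteq> {0\<^sub>v d}" "W \<noteq> carrier_vec d"
  shows "\<exists>r s R1 R2. r < d \<and> s < d \<and> matrix_rep G r R1 \<and> matrix_rep G s R2 \<and>
    equivalent_rep G R (\<lambda>g. four_block_mat (R1 g) (0\<^sub>m r s) (0\<^sub>m s r) (R2 g))"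
proof -
  note Rc = matrix_repD(1)[OF R]
  obtain r B where B: "B \<in> carrier_mat d r" "\<And>v. v \<in> carrier_vec r \<Longrightarrow> B *\<^sub>v v \<in> W"
      "\<And>v. v \<in> carrier_vec r \<Longrightarrow> B *\<^sub>v v = 0\<^sub>v d \<Longrightarrow> v = 0\<^sub>v r"
      "\<And>w. w \<in> W \<Longrightarrow> \<exists>v\<in>carrier_vec r. B *\<^sub>v v = w"
    using subspace_as_range[OF W add smult] by blast
  have factor: "\<exists>X\<in>carrier_mat e k. Y = B0 * X"
    if B0: "B0 \<in> carrier_mat d e" and Y: "Y \<in> carrier_mat d k"
      and ran: "\<And>j. j < k \<Longrightarrow> \<exists>v\<in>carrier_vec e. B0 *\<^sub>v v = col Y j" for B0 Y :: "complex mat" and e k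
  proof -
    obtain x where x: "\<And>j. j < k \<Longrightarrow> x j \<in> carrier_vec e \<and> B0 *\<^sub>v x j = col Y j" using ran by metis
    define X where "X = mat e k (\<lambda>(i, j). x j $ i)"
    have X: "X \<in> carrier_mat e k" by (simp add: X_def)
    have "Y = B0 * X"
    proof (rule eq_matI)
      fix i j assume "i < dim_row (B0 * X)" "j < dim_col (B0 * X)"
      then have ij: "i < d" "j < k" using B0 X by auto
      have "col X j = x j" using ij x[OF ij(2)] by (intro eq_vecI) (auto simp: X_def)
      then have "(B0 * X) $$ (i, j) = (B0 *\<^sub>v x j) $ i" using ij B0 X by simp
      also have "\<dots> = Y $$ (i, j)" using x[OF ij(2)] ij Y by simp
      finally show "Y $$ (i, j) = (B0 * X) $$ (i, j)" by simp
    qed (use B0 X Y in auto)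
    with X show ?thesis by blast
  qed
  obtain C0 where C0: "C0 \<in> carrier_mat r d" "C0 * B = 1\<^sub>m r"
    using left_inverse_if_inj[OF B(1,3)] by blast
  have block: "matrix_rep G e (\<lambda>g. D * R g * B0) \<and> (\<forall>g\<in>carrier G. R g * B0 = B0 * (D * R g * B0))"
    if B0: "B0 \<in> carrier_mat d e" and D: "D \<in> carrier_mat e d" "D * B0 = 1\<^sub>m e"
      and ran: "\<And>g. g \<in> carrier G \<Longrightarrow> \<exists>X\<in>carrier_mat e e. R g * B0 = B0 * X" for B0 D e
  proof -
    have inter: "R g * B0 = B0 * (D * R g * B0)" if g: "g \<in> carrier G" for g
    proof -
      obtain X where X: "X \<in> carrier_mat e e" "R g * B0 = B0 * X" using ran[OF g] by blast
      have "D * R g * B0 = D * (B0 * X)" using assoc_mult_mat[OF D(1) Rc[OF g] B0] X(2) by simp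
      also have "\<dots> = X" using assoc_mult_mat[OF D(1) B0 X(1)] D(2) X(1) by simp
      finally show ?thesis using X(2) by simp
    qed
    have "D * R (g \<otimes> h) * B0 = (D * R g * B0) * (D * R h * B0)" if gh: "g \<in> carrier G" "h \<in> carrier G" for g h
    proof -
      note c = Rc[OF gh(1)] Rc[OF gh(2)]
      have "D * R (g \<otimes> h) * B0 = D * R g * (R h * B0)"
        using matrix_repD(2)[OF R gh] c D B0
        by (simp add: assoc_mult_mat[of _ e d _ d _ e] assoc_mult_mat[of _ d d _ d _ e])
      also have "R h * B0 = B0 * (D * R h * B0)" using inter gh by simp
      also have "D * R g * (B0 * (D * R h * B0)) = (D * R g * B0) * (D * R h * B0)"
        by (rule assoc_mult_mat[symmetric, of _ e d _ e _ e]) (use c D B0 in auto)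
      finally show ?thesis .
    qed
    moreover have "D * R \<one> * B0 = 1\<^sub>m e" using matrix_repD(3)[OF R] D B0 by simp
    ultimately have "matrix_rep G e (\<lambda>g. D * R g * B0)"
      unfolding matrix_rep_iff using Rc D B0 by auto
    with inter show ?thesis by blast
  qed
  define R1 where "R1 g = C0 * R g * B" for g
  have ranB: "\<exists>X\<in>carrier_mat r r. R g * B = B * X" if g: "g \<in> carrier G" for g
  proof (rule factor[OF B(1) mult_carrier_mat[OF Rc[OF g] B(1)]])
    fix j assume j: "j < r"
    have "col (R g * B) j = R g *\<^sub>v col B j" by (rule col_mult2[OF Rc[OF g] B(1) j])
    also have "col B j = B *\<^sub>v unit_vec r j" using mult_unit_vec_eq_col[OF B(1) j] by simp
    finally have "col (R g * B) j \<in> W" using inv[OF g B(2)[of "unit_vec r j"]] by simp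
    then show "\<exists>v\<in>carrier_vec r. B *\<^sub>v v = col (R g * B) j" by (rule B(4))
  qed
  have R1: "matrix_rep G r R1" "\<And>g. g \<in> carrier G \<Longrightarrow> R g * B = B * R1 g"
    using block[OF B(1) C0 ranB] unfolding R1_def by auto
  note R1c = matrix_repD(1)[OF R1(1)]
  define N where "N = complex_of_nat (card (carrier G))"
  have N: "N \<noteq> 0" using card_nz by (simp add: N_def)
  define C where "C = (1 / N) \<cdot>\<^sub>m average r d R1 R C0"
  have C: "C \<in> carrier_mat r d" by (simp add: C_def)
  have CB: "C * B = 1\<^sub>m r"
  proof -
    have "average r d R1 R C0 * B = mat_sum r r (\<lambda>g. R1 g * C0 * R (inv g) * B) (carrier G)"
      unfolding average_def by (rule mat_sum_mult[OF B(1) mult_carrier_mat[OF mult_carrier_mat[OF R1c C0(1)] Rc]]) auto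
    also have "\<dots> = mat_sum r r (\<lambda>g. 1\<^sub>m r) (carrier G)"
    proof (rule mat_sum_cong)
      fix g assume g: "g \<in> carrier G"
      note c = R1c[OF g] R1c[OF inv_closed[OF g]] Rc[OF inv_closed[OF g]]
      have "R1 g * C0 * R (inv g) * B = R1 g * C0 * (R (inv g) * B)"
        by (rule assoc_mult_mat[of _ r d _ d _ r]) (use c C0 B in auto)
      also have "\<dots> = R1 g * C0 * (B * R1 (inv g))" using R1(2) g by simp
      also have "\<dots> = R1 g * (C0 * (B * R1 (inv g)))"
        by (rule assoc_mult_mat[of _ r r _ d _ r]) (use c C0 B in auto)
      also have "C0 * (B * R1 (inv g)) = R1 (inv g)"
        using assoc_mult_mat[OF C0(1) B(1) c(2)] C0(2) c(2) by simp
      also have "R1 g * R1 (inv g) = 1\<^sub>m r" by (rule matrix_rep_inv(2)[OF R1(1) g])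
      finally show "R1 g * C0 * R (inv g) * B = 1\<^sub>m r" .
    qed
    also have "\<dots> = N \<cdot>\<^sub>m 1\<^sub>m r"
      by (rule eq_matI) (auto simp: mat_sum_def N_def)
    finally have "average r d R1 R C0 * B = N \<cdot>\<^sub>m 1\<^sub>m r" .
    then have "C * B = (1 / N) \<cdot>\<^sub>m (N \<cdot>\<^sub>m 1\<^sub>m r)"
      unfolding C_def using B(1) by (simp add: mult_smult_assoc_mat[of _ r d _ r])
    also have "\<dots> = 1\<^sub>m r" using N by (intro eq_matI) auto
    finally show ?thesis .
  qed
  have CR: "C * R g = R1 g * C" if g: "g \<in> carrier G" for g
    unfolding C_def using average_intertwines[OF R1(1) R C0(1) g] R1c[OF g] Rc[OF g]
    by (simp add: mult_smult_assoc_mat[of _ r d _ d] mult_smult_distrib[of _ r r _ d])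
  define W' where "W' = {v \<in> carrier_vec d. C *\<^sub>v v = 0\<^sub>v r}"
  have W'sub: "W' \<subseteq> carrier_vec d" "0\<^sub>v d \<in> W'"
    using C by (auto simp: W'_def intro!: eq_vecI)
  have W'add: "v + w \<in> W'" if "v \<in> W'" "w \<in> W'" for v w
    using that C by (auto simp: W'_def mult_add_distrib_mat_vec[of _ r d])
  have W'smult: "c \<cdot>\<^sub>v v \<in> W'" if "v \<in> W'" for c v
    using that C by (auto simp: W'_def mult_mat_vec[of _ r d] intro!: eq_vecI)
  obtain s B' where B': "B' \<in> carrier_mat d s" "\<And>v. v \<in> carrier_vec s \<Longrightarrow> B' *\<^sub>v v \<in> W'"
      "\<And>v. v \<in> carrier_vec s \<Longrightarrow> B' *\<^sub>v v = 0\<^sub>v d \<Longrightarrow> v = 0\<^sub>v s"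
      "\<And>w. w \<in> W' \<Longrightarrow> \<exists>v\<in>carrier_vec s. B' *\<^sub>v v = w"
    using subspace_as_range[OF W'sub W'add W'smult] by blast
  have CB': "C * B' = 0\<^sub>m r s"
  proof (rule mat_eq_if_mult_vec_eq[of _ r s])
    fix v :: "complex vec" assume v: "v \<in> carrier_vec s"
    have "C * B' *\<^sub>v v = 0\<^sub>v r" using B'(2)[OF v] assoc_mult_mat_vec[OF C B'(1) v] by (simp add: W'_def)
    then show "C * B' *\<^sub>v v = 0\<^sub>m r s *\<^sub>v v" using v by (auto intro!: eq_vecI)
  qed (use C B' in auto)
  \<comment> \<open>The projection to the kernel of \<open>C\<close> along \<open>W\<close>; below it is factored as \<open>B' * C'\<close>.\<close>
  define E where "E = 1\<^sub>m d - B * C"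
  have E: "E \<in> carrier_mat d d" unfolding E_def by (rule minus_carrier_mat[OF mult_carrier_mat[OF B(1) C]])
  have CE: "C * E = 0\<^sub>m r d"
  proof -
    have "C * E = C * 1\<^sub>m d - C * (B * C)" unfolding E_def
      by (rule mult_minus_distrib_mat[of _ r d _ d]) (use B C in auto)
    also have "C * (B * C) = C" using assoc_mult_mat[OF C B(1) C] CB C by simp
    finally show ?thesis using C by simp
  qed
  have EB: "E * B = 0\<^sub>m d r"
  proof -
    have "E * B = 1\<^sub>m d * B - B * C * B" unfolding E_def
      by (rule minus_mult_distrib_mat[of _ d d _ _ r]) (use B C in auto)
    also have "B * C * B = B" using assoc_mult_mat[OF B(1) C B(1)] CB B(1) by simp
    finally show ?thesis using B(1) by simp
  qed
  have EB': "E * B' = B'"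
  proof -
    have "E * B' = 1\<^sub>m d * B' - B * C * B'" unfolding E_def
      by (rule minus_mult_distrib_mat[of _ d d _ _ s]) (use B C B' in auto)
    also have "B * C * B' = 0\<^sub>m d s" using assoc_mult_mat[OF B(1) C B'(1)] CB' B(1) by simp
    also have "1\<^sub>m d * B' - 0\<^sub>m d s = B'" using B'(1) by (intro eq_matI) auto
    finally show ?thesis .
  qed
  obtain C' where C': "C' \<in> carrier_mat s d" "E = B' * C'"
  proof -
    have "\<exists>v\<in>carrier_vec s. B' *\<^sub>v v = col E j" if j: "j < d" for j
    proof (rule B'(4))
      have "C *\<^sub>v col E j = col (C * E) j" by (rule col_mult2[OF C E j, symmetric])
      also have "\<dots> = 0\<^sub>v r" using j by (simp add: CE)
      finally show "col E j \<in> W'" using E by (auto simp: W'_def intro!: carrier_vecI)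
    qed
    from factor[OF B'(1) E this] show thesis using that by blast
  qed
  have inj: "X = Y" if "X \<in> carrier_mat s k" "Y \<in> carrier_mat s k" "B' * X = B' * Y" for X Y k
  proof -
    obtain D where D: "D \<in> carrier_mat s d" "D * B' = 1\<^sub>m s"
      using left_inverse_if_inj[OF B'(1,3)] by blast
    have "X = D * (B' * X)" using assoc_mult_mat[OF D(1) B'(1) that(1)] D(2) that(1) by simp
    also have "\<dots> = D * B' * Y" unfolding that(3) by (rule assoc_mult_mat[OF D(1) B'(1) that(2), symmetric])
    also have "\<dots> = Y" using D(2) that(2) by simp
    finally show ?thesis .
  qed
  have C'B': "C' * B' = 1\<^sub>m s"
    by (rule inj[of _ s]) (use C' B' EB' assoc_mult_mat[OF B'(1) C'(1) B'(1)] in auto)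
  have C'B: "C' * B = 0\<^sub>m s r"
    by (rule inj[of _ r]) (use C' B B' EB assoc_mult_mat[OF B'(1) C'(1) B(1)] in auto)
  have sum1: "B * C + B' * C' = 1\<^sub>m d"
    unfolding C'(2)[symmetric] E_def using B(1) C by (intro eq_matI) auto
  \<comment> \<open>The base change matrices \<open>(B B')\<close> and, stacked, \<open>(C C')\<close>; the other two blocks are empty.\<close>
  define P where "P = four_block_mat B B' (0\<^sub>m 0 r) (0\<^sub>m 0 s)"
  define Q where "Q = four_block_mat C (0\<^sub>m r 0) C' (0\<^sub>m s 0)"
  have P: "P \<in> carrier_mat d (r + s)" using four_block_carrier_mat[of B d r "0\<^sub>m 0 s" 0 s] B(1) by (simp add: P_def)
  have Q: "Q \<in> carrier_mat (r + s) d" using four_block_carrier_mat[of C r d "0\<^sub>m s 0" s 0] C by (simp add: Q_def)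
  have PQ: "P * Q = 1\<^sub>m d"
  proof -
    have "P * Q = four_block_mat (B * C + B' * C') (B * 0\<^sub>m r 0 + B' * 0\<^sub>m s 0)
        (0\<^sub>m 0 r * C + 0\<^sub>m 0 s * C') (0\<^sub>m 0 r * 0\<^sub>m r 0 + 0\<^sub>m 0 s * 0\<^sub>m s 0)"
      unfolding P_def Q_def by (rule mult_four_block_mat) (use B B' C C' in auto)
    also have "\<dots> = 1\<^sub>m d" unfolding sum1 by (rule eq_matI) auto
    finally show ?thesis .
  qed
  have QP: "Q * P = 1\<^sub>m (r + s)"
  proof -
    have "Q * P = four_block_mat (C * B + 0\<^sub>m r 0 * 0\<^sub>m 0 r) (C * B' + 0\<^sub>m r 0 * 0\<^sub>m 0 s)
       (C' * B + 0\<^sub>m s 0 * 0\<^sub>m 0 r) (C' * B' + 0\<^sub>m s 0 * 0\<^sub>m 0 s)"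
      unfolding P_def Q_def by (rule mult_four_block_mat) (use B B' C C' in auto)
    also have "\<dots> = 1\<^sub>m (r + s)" unfolding CB CB' C'B C'B' by (rule eq_matI) auto
    finally show ?thesis .
  qed
  have drs: "d = r + s" by (rule inverse_pair_imp_square[OF P Q PQ QP])
  define R2 where "R2 g = C' * R g * B'" for g
  have ranB': "\<exists>X\<in>carrier_mat s s. R g * B' = B' * X" if g: "g \<in> carrier G" for g
  proof (rule factor[OF B'(1) mult_carrier_mat[OF Rc[OF g] B'(1)]])
    fix j assume j: "j < s"
    have "C * (R g * B') = R1 g * (C * B')"
      using assoc_mult_mat[OF C Rc[OF g] B'(1)] assoc_mult_mat[OF R1c[OF g] C B'(1)] CR[OF g] by simp
    also have "\<dots> = 0\<^sub>m r s" using R1c[OF g] by (simp add: CB')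
    finally have z: "C * (R g * B') = 0\<^sub>m r s" .
    have "C *\<^sub>v col (R g * B') j = col (C * (R g * B')) j"
      using j mult_carrier_mat[OF Rc[OF g] B'(1)] by (subst col_mult2[OF C]) auto
    then have "col (R g * B') j \<in> W'" using z j Rc[OF g] B'(1) by (auto simp: W'_def intro!: carrier_vecI)
    then show "\<exists>v\<in>carrier_vec s. B' *\<^sub>v v = col (R g * B') j" by (rule B'(4))
  qed
  have R2: "matrix_rep G s R2" "\<And>g. g \<in> carrier G \<Longrightarrow> R g * B' = B' * R2 g"
    using block[OF B'(1) C'(1) C'B' ranB'] unfolding R2_def by auto
  note R2c = matrix_repD(1)[OF R2(1)]
  let ?S = "\<lambda>g. four_block_mat (R1 g) (0\<^sub>m r s) (0\<^sub>m s r) (R2 g)"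
  have RP: "R g * P = P * ?S g" if g: "g \<in> carrier G" for g
  proof -
    have "P * ?S g = four_block_mat (B * R1 g + B' * 0\<^sub>m s r) (B * 0\<^sub>m r s + B' * R2 g)
       (0\<^sub>m 0 r * R1 g + 0\<^sub>m 0 s * 0\<^sub>m s r) (0\<^sub>m 0 r * 0\<^sub>m r s + 0\<^sub>m 0 s * R2 g)"
      unfolding P_def by (rule mult_four_block_mat) (use B B' R1c[OF g] R2c[OF g] in auto)
    also have "\<dots> = four_block_mat (R g * B) (R g * B') (0\<^sub>m 0 r) (0\<^sub>m 0 s)"
      using B B' R1c[OF g] R2c[OF g] R1(2)[OF g] R2(2)[OF g] by simp
    also have "\<dots> = R g * P"
    proof -
      have "four_block_mat (R g) (0\<^sub>m d 0) (0\<^sub>m 0 d) (0\<^sub>m 0 0) * P = 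
        four_block_mat (R g * B + 0\<^sub>m d 0 * 0\<^sub>m 0 r) (R g * B' + 0\<^sub>m d 0 * 0\<^sub>m 0 s)
         (0\<^sub>m 0 d * B + 0\<^sub>m 0 0 * 0\<^sub>m 0 r) (0\<^sub>m 0 d * B' + 0\<^sub>m 0 0 * 0\<^sub>m 0 s)"
        unfolding P_def by (rule mult_four_block_mat) (use B B' Rc[OF g] in auto)
      moreover have "four_block_mat (R g) (0\<^sub>m d 0) (0\<^sub>m 0 d) (0\<^sub>m 0 0) = R g"
        using Rc[OF g] by (intro eq_matI) auto
      ultimately show ?thesis using Rc[OF g] B B' by simp
    qed
    finally show ?thesis by simp
  qed
  have "equivalent_rep G R ?S" unfolding equivalent_rep_def
  proof (intro exI ballI)
    fix g assume g: "g \<in> carrier G"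
    have "R g = R g * (P * Q)" using PQ Rc[OF g] by simp
    also have "\<dots> = P * ?S g * Q" using assoc_mult_mat[OF Rc[OF g] P Q] RP[OF g] by simp
    finally show "similar_mat_wit (R g) (?S g) P Q"
      by (intro similar_mat_witI[of _ _ d])
       (use drs Q P QP PQ Rc[OF g] four_block_carrier_mat[OF R1c[OF g] R2c[OF g]] in auto)
  qed
  moreover have "r < d"
  proof -
    have "s \<noteq> 0"
    proof
      assume "s = 0"
      then have "B' * C' = 0\<^sub>m d d" using B'(1) C'(1) by (intro eq_matI) (auto simp: scalar_prod_def)
      then have "B * C = 1\<^sub>m d" using sum1 mult_carrier_mat[OF B(1) C] by simp
      have "carrier_vec d \<subseteq> W"
      proof
        fix v :: "complex vec" assume v: "v \<in> carrier_vec d"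
        have "B *\<^sub>v (C *\<^sub>v v) = v"
          using assoc_mult_mat_vec[OF B(1) C v, symmetric] v unfolding \<open>B * C = 1\<^sub>m d\<close> by simp
        then show "v \<in> W" using B(2)[OF mult_mat_vec_carrier[OF C v]] by simp
      qed
      then have "W = carrier_vec d" using W(1) by blast
      then show False using proper(2) by contradiction
    qed
    then show ?thesis using drs by simp
  qed
  moreover have "s < d"
  proof -
    have "r \<noteq> 0"
    proof
      assume "r = 0"
      have "w = 0\<^sub>v d" if w: "w \<in> W" for w
      proof -
        obtain v where "v \<in> carrier_vec r" "B *\<^sub>v v = w" using B(4)[OF w] by blast
        then show ?thesis using \<open>r = 0\<close> B(1) by (intro eq_vecI) (auto simp: scalar_prod_def)
      qed
      then have "W = {0\<^sub>v d}" using W(2) by blast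
      then show False using proper(1) by contradiction
    qed
    then show ?thesis using drs by simp
  qed
  ultimately show ?thesis using R1(1) R2(1) by blast
qed

lemma tr_four_block_diag:
  assumes "A \<in> carrier_mat r r" "D \<in> carrier_mat s s"
  shows "tr (four_block_mat A (0\<^sub>m r s) (0\<^sub>m s r) D) = tr A + tr D"
proof -
  have "tr (four_block_mat A (0\<^sub>m r s) (0\<^sub>m s r) D) =
      (\<Sum>i<r + s. if i < r then A $$ (i, i) else D $$ (i - r, i - r))"
    using assms by (auto simp: tr_def intro!: sum.cong)
  also have "\<dots> = (\<Sum>i<r. A $$ (i, i)) + (\<Sum>i<s. D $$ (i, i))"
    by (induction s) auto
  finally show ?thesis using assms by (simp add: tr_def)
qed

lemma direct_sum_rep_append:
  assumes "direct_sum_rep Rs g \<in> carrier_mat r r" "direct_sum_rep Ss g \<in> carrier_mat s s"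
  shows "direct_sum_rep (Rs @ Ss) g =
    four_block_mat (direct_sum_rep Rs g) (0\<^sub>m r s) (0\<^sub>m s r) (direct_sum_rep Ss g)"
  using assms unfolding direct_sum_rep_def by (simp add: diag_block_mat_append Let_def)

lemma tr_direct_sum_rep:
  assumes "\<forall>S\<in>set Rs. irreducible_rep G S" and g: "g \<in> carrier G"
  shows "\<exists>d. direct_sum_rep Rs g \<in> carrier_mat d d"
    and "tr (direct_sum_rep Rs g) = (\<Sum>S\<leftarrow>Rs. tr (S g))"
proof -
  have "(\<exists>d. direct_sum_rep Rs g \<in> carrier_mat d d) \<and> tr (direct_sum_rep Rs g) = (\<Sum>S\<leftarrow>Rs. tr (S g))"
    using assms(1)
  proof (induction Rs)
    case Nil
    then show ?case by (auto simp: direct_sum_rep_def tr_def intro!: exI[of _ 0])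
  next
    case (Cons S Rs)
    then obtain d where d: "direct_sum_rep Rs g \<in> carrier_mat d d"
      and t: "tr (direct_sum_rep Rs g) = (\<Sum>S\<leftarrow>Rs. tr (S g))" by auto
    obtain e where "matrix_rep G e S" using irreducible_has_matrix_rep[of S] Cons.prems by auto
    from matrix_repD(1)[OF this g] have e: "S g \<in> carrier_mat e e" .
    have "direct_sum_rep (S # Rs) g = four_block_mat (S g) (0\<^sub>m e d) (0\<^sub>m d e) (direct_sum_rep Rs g)"
      using d e unfolding direct_sum_rep_def by (simp add: Let_def)
    then show ?case using four_block_carrier_mat[OF e d] tr_four_block_diag[OF e d] t by auto
  qed
  then show "\<exists>d. direct_sum_rep Rs g \<in> carrier_mat d d"
    and "tr (direct_sum_rep Rs g) = (\<Sum>S\<leftarrow>Rs. tr (S g))" by blast+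
qed

lemma equivalent_rep_block_sum:
  assumes R1: "matrix_rep G r R1" and R2: "matrix_rep G s R2"
    and e1: "equivalent_rep G R1 (direct_sum_rep Rs)" and e2: "equivalent_rep G R2 (direct_sum_rep Ss)"
  shows "equivalent_rep G (\<lambda>g. four_block_mat (R1 g) (0\<^sub>m r s) (0\<^sub>m s r) (R2 g)) (direct_sum_rep (Rs @ Ss))"
proof -
  obtain P1 Q1 where 1: "\<And>g. g \<in> carrier G \<Longrightarrow> similar_mat_wit (R1 g) (direct_sum_rep Rs g) P1 Q1"
    using e1 unfolding equivalent_rep_def by blast
  obtain P2 Q2 where 2: "\<And>g. g \<in> carrier G \<Longrightarrow> similar_mat_wit (R2 g) (direct_sum_rep Ss g) P2 Q2"
    using e2 unfolding equivalent_rep_def by blast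
  show ?thesis unfolding equivalent_rep_def
  proof (intro exI ballI)
    fix g assume g: "g \<in> carrier G"
    note c = matrix_repD(1)[OF R1 g] matrix_repD(1)[OF R2 g]
    note d1 = similar_mat_witD2[OF c(1) 1[OF g]] and d2 = similar_mat_witD2[OF c(2) 2[OF g]]
    show "similar_mat_wit (four_block_mat (R1 g) (0\<^sub>m r s) (0\<^sub>m s r) (R2 g)) (direct_sum_rep (Rs @ Ss) g)
       (four_block_mat P1 (0\<^sub>m r s) (0\<^sub>m s r) P2) (four_block_mat Q1 (0\<^sub>m r s) (0\<^sub>m s r) Q2)"
      unfolding direct_sum_rep_append[OF d1(5) d2(5)]
      by (rule similar_mat_wit_four_block[OF 1[OF g] 2[OF g]]) (use c d1(6,7) d2(6,7) in auto)
  qed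
qed

lemma not_irreducible_invariant_subspace:
  assumes "matrix_rep G d R" "d > 0" "\<not> irreducible_rep G R"
  obtains W where "W \<subseteq> carrier_vec d" "0\<^sub>v d \<in> W" "\<And>v w. v \<in> W \<Longrightarrow> w \<in> W \<Longrightarrow> v + w \<in> W"
    "\<And>c v. v \<in> W \<Longrightarrow> c \<cdot>\<^sub>v v \<in> W" "\<And>g w. g \<in> carrier G \<Longrightarrow> w \<in> W \<Longrightarrow> R g *\<^sub>v w \<in> W"
    "W \<noteq> {0\<^sub>v d}" "W \<noteq> carrier_vec d"
proof -
  have "\<exists>W. VectorSpace.subspace class_ring W (module_vec TYPE(complex) d) \<and>
      (\<forall>g\<in>carrier G. \<forall>w\<in>W. R g *\<^sub>v w \<in> W) \<and> \<not> (W = {0\<^sub>v d} \<or> W = carrier_vec d)"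
    using assms unfolding irreducible_rep_def by meson
  then obtain W where W: "VectorSpace.subspace class_ring W (module_vec TYPE(complex) d)"
      "\<forall>g\<in>carrier G. \<forall>w\<in>W. R g *\<^sub>v w \<in> W" "W \<noteq> {0\<^sub>v d}" "W \<noteq> carrier_vec d"
    by metis
  show thesis by (rule that[of W]) (use W in \<open>auto simp: subspace_module_vec_iff\<close>)
qed

theorem complete_reducibility:
  assumes "matrix_rep G d R"
  shows "\<exists>Rs. (\<forall>S\<in>set Rs. irreducible_rep G S) \<and> equivalent_rep G R (direct_sum_rep Rs)"
  using assms
proof (induction d arbitrary: R rule: less_induct)
  case (less d)
  consider "d = 0" | "d > 0" "irreducible_rep G R" | "d > 0" "\<not> irreducible_rep G R" by auto
  then show ?case
  proof cases
    case 1
    have "R g = direct_sum_rep [] g" if "g \<in> carrier G" for g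
      using matrix_repD(1)[OF less.prems that] 1 by (intro eq_matI) (auto simp: direct_sum_rep_def)
    then have "equivalent_rep G R (direct_sum_rep [])"
      using equivalent_rep_refl[OF less.prems] unfolding equivalent_rep_def by simp
    then show ?thesis by (intro exI[of _ "[]"]) auto
  next
    case 2
    have "direct_sum_rep [R] = R" by (rule ext) (simp add: direct_sum_rep_def del: diag_block_mat.simps)
    then show ?thesis using 2 equivalent_rep_refl[OF less.prems] by (intro exI[of _ "[R]"]) auto
  next
    case 3
    obtain W where W: "W \<subseteq> carrier_vec d" "0\<^sub>v d \<in> W" "\<And>v w. v \<in> W \<Longrightarrow> w \<in> W \<Longrightarrow> v + w \<in> W"
      "\<And>c v. v \<in> W \<Longrightarrow> c \<cdot>\<^sub>v v \<in> W" "\<And>g w. g \<in> carrier G \<Longrightarrow> w \<in> W \<Longrightarrow> R g *\<^sub>v w \<in> W"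
      "W \<noteq> {0\<^sub>v d}" "W \<noteq> carrier_vec d"
      by (rule not_irreducible_invariant_subspace[OF less.prems 3]) (rule that)
    have "\<exists>r s R1 R2. r < d \<and> s < d \<and> matrix_rep G r R1 \<and> matrix_rep G s R2 \<and>
        equivalent_rep G R (\<lambda>g. four_block_mat (R1 g) (0\<^sub>m r s) (0\<^sub>m s r) (R2 g))"
      by (rule maschke_split[OF less.prems W(1,2)]; fact W)
    then obtain r s R1 R2 where b: "r < d" "s < d" "matrix_rep G r R1" "matrix_rep G s R2"
      and e: "equivalent_rep G R (\<lambda>g. four_block_mat (R1 g) (0\<^sub>m r s) (0\<^sub>m s r) (R2 g))"
      by (elim exE conjE) (rule that)
    obtain Rs where Rs: "\<forall>S\<in>set Rs. irreducible_rep G S" "equivalent_rep G R1 (direct_sum_rep Rs)"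
      using less.IH[OF b(1,3)] by blast
    obtain Ss where Ss: "\<forall>S\<in>set Ss. irreducible_rep G S" "equivalent_rep G R2 (direct_sum_rep Ss)"
      using less.IH[OF b(2,4)] by blast
    have "equivalent_rep G R (direct_sum_rep (Rs @ Ss))"
      by (rule equivalent_rep_trans[OF e equivalent_rep_block_sum[OF b(3,4) Rs(2) Ss(2)]])
    with Rs Ss show ?thesis by (intro exI[of _ "Rs @ Ss"]) auto
  qed
qed

lemma tr_conjugate:
  assumes S: "matrix_rep G d S" and gs: "g \<in> carrier G" "s \<in> carrier G"
  shows "tr (S (s \<otimes> g \<otimes> inv s)) = tr (S g)"
proof -
  note c = matrix_repD(1)[OF S]
  have "S (s \<otimes> g \<otimes> inv s) = S s * (S g * S (inv s))"
    using gs by (simp add: matrix_repD(2)[OF S] m_assoc)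
  then have "tr (S (s \<otimes> g \<otimes> inv s)) = tr (S g * S (inv s) * S s)"
    using gs c tr_mult_comm[of "S s" d d "S g * S (inv s)"] by (simp add: mult_carrier_mat[of _ d d])
  also have "S g * S (inv s) * S s = S (g \<otimes> inv s \<otimes> s)" using gs by (simp add: matrix_repD(2)[OF S])
  also have "g \<otimes> inv s \<otimes> s = g" using gs by (simp add: m_assoc)
  finally show ?thesis .
qed

lemma tr_transpose: "A \<in> carrier_mat d d \<Longrightarrow> tr (transpose_mat A) = tr A"
  by (simp add: tr_def)

end

section \<open>Twisted Frobenius--Schur indicators\<close>

locale involutive_automorphism = finite_group +
  fixes \<tau> :: "'a \<Rightarrow> 'a"
  assumes tau_hom: "\<tau> \<in> hom G G"
    and tau_tau [simp]: "g \<in> carrier G \<Longrightarrow> \<tau> (\<tau> g) = g"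
begin

lemma tau_closed [simp]: "g \<in> carrier G \<Longrightarrow> \<tau> g \<in> carrier G"
  using tau_hom by (auto simp: hom_def)

lemma tau_mult [simp]: "g \<in> carrier G \<Longrightarrow> h \<in> carrier G \<Longrightarrow> \<tau> (g \<otimes> h) = \<tau> g \<otimes> \<tau> h"
  using tau_hom by (auto simp: hom_def)

lemma tau_one [simp]: "\<tau> \<one> = \<one>"
  using tau_hom hom_one is_group by blast

lemma tau_inv [simp]: "g \<in> carrier G \<Longrightarrow> \<tau> (inv g) = inv (\<tau> g)"
  by (rule inv_equality[symmetric]) (use tau_mult[of "inv g" g] in simp_all)

lemma twist_irreducible:
  assumes S: "irreducible_rep G S" "matrix_rep G d S"
  shows "matrix_rep G d (\<lambda>g. S (\<tau> g))" "irreducible_rep G (\<lambda>g. S (\<tau> g))"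
proof -
  show 1: "matrix_rep G d (\<lambda>g. S (\<tau> g))"
    using matrix_repD[OF S(2)] unfolding matrix_rep_iff by auto
  obtain e where e: "e > 0" "matrix_rep G e S" "\<forall>W. VectorSpace.subspace class_ring W (module_vec TYPE(complex) e) \<longrightarrow>
           (\<forall>g\<in>carrier G. \<forall>w\<in>W. S g *\<^sub>v w \<in> W) \<longrightarrow> W = {0\<^sub>v e} \<or> W = carrier_vec e"
    using S(1) unfolding irreducible_rep_def by blast
  have ed: "e = d" using matrix_rep_degree_unique[OF e(2) S(2)] .
  show "irreducible_rep G (\<lambda>g. S (\<tau> g))"
    unfolding irreducible_rep_def
  proof (intro exI[of _ d] conjI allI impI)
    fix W assume W: "VectorSpace.subspace class_ring W (module_vec TYPE(complex) d)"
      "\<forall>g\<in>carrier G. \<forall>w\<in>W. S (\<tau> g) *\<^sub>v w \<in> W"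
    have "\<forall>g\<in>carrier G. \<forall>w\<in>W. S g *\<^sub>v w \<in> W"
    proof (intro ballI)
      fix g w assume "g \<in> carrier G" "w \<in> W"
      then show "S g *\<^sub>v w \<in> W" using bspec[OF W(2), of "\<tau> g"] by simp
    qed
    with W(1) show "W = {0\<^sub>v d} \<or> W = carrier_vec d" using e(3) unfolding ed by simp
  qed (use e 1 ed in simp_all)
qed

text \<open>An intertwiner \<open>M\<close> between the twist \<open>T\<close> and the dual \<open>D\<close> of \<open>S\<close> is unique up to a scalar, and
  its transpose \<open>N\<close> is another one; hence \<open>M\<close> is symmetric or skew, and the sign is the indicator.\<close>

theorem twisted_frobenius_schur:
  assumes S: "irreducible_rep G S" 
    and conj: "\<And>g. g \<in> carrier G \<Longrightarrow> \<exists>s\<in>carrier G. s \<otimes> g \<otimes> inv s = inv (\<tau> g)"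
  shows "\<exists>c. c\<^sup>2 = 1 \<and> (\<Sum>v\<in>carrier G. tr (S (v \<otimes> \<tau> v))) = c * of_nat (card (carrier G))"
proof -
  obtain d where d: "d > 0" "matrix_rep G d S" using irreducible_has_matrix_rep[OF S] by metis
  note Sc = matrix_repD(1)[OF d(2)] and Sm = matrix_repD(2)[OF d(2)]
  define D where "D g = transpose_mat (S (inv g))" for g
  define T where "T g = S (\<tau> g)" for g
  have T: "matrix_rep G d T" "irreducible_rep G T" 
    using twist_irreducible[OF S d(2)] unfolding T_def by auto
  have D: "matrix_rep G d D"
    unfolding matrix_rep_iff D_def
  proof (intro conjI ballI)
    fix g h assume gh: "g \<in> carrier G" "h \<in> carrier G"
    have "S (inv (g \<otimes> h)) = S (inv h) * S (inv g)" using gh by (simp add: inv_mult_group Sm)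
    then show "transpose_mat (S (inv (g \<otimes> h))) = transpose_mat (S (inv g)) * transpose_mat (S (inv h))"
      using transpose_mult[OF Sc[OF inv_closed[OF gh(2)]] Sc[OF inv_closed[OF gh(1)]]] by simp
  qed (use Sc matrix_repD(3)[OF d(2)] in auto)
  have trT: "tr (T g) = tr (S (inv g))" if g: "g \<in> carrier G" for g
  proof -
    obtain s where s: "s \<in> carrier G" "s \<otimes> inv g \<otimes> inv s = inv (\<tau> (inv g))" using conj[of "inv g"] g by auto
    then have "s \<otimes> inv g \<otimes> inv s = \<tau> g" using g by simp
    then show ?thesis using tr_conjugate[OF d(2), of "inv g" s] s g unfolding T_def by simp
  qed
  have "(\<Sum>g\<in>carrier G. tr (T g) * tr (D (inv g))) = (\<Sum>g\<in>carrier G. tr (S g) * tr (S (inv g)))"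
  proof (rule sum.cong[OF refl])
    fix g assume g: "g \<in> carrier G"
    have "tr (D (inv g)) = tr (S g)" using g tr_transpose[OF Sc[OF g]] by (simp add: D_def)
    then show "tr (T g) * tr (D (inv g)) = tr (S g) * tr (S (inv g))" using trT[OF g] by simp
  qed
  \<comment> \<open>\<open>T\<close> and \<open>D\<close> have the same character, so some average of an elementary matrix between them is
    nonzero.\<close>
  then have "(\<Sum>i<d. \<Sum>j<d. \<Sum>g\<in>carrier G. T g $$ (i, i) * D (inv g) $$ (j, j)) \<noteq> 0"
    using characters_orthonormal[OF S] card_nz by (simp flip: character_sum_eq[OF T(1) D])
  then obtain i j where ij: "i < d" "j < d" "(\<Sum>g\<in>carrier G. T g $$ (i, i) * D (inv g) $$ (j, j)) \<noteq> 0"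
    by (smt (verit) lessThan_iff sum.neutral)
  define M where "M = average d d T D (elementary d d i j)"
  have M: "M \<in> carrier_mat d d" by (simp add: M_def)
  have MD: "T g * M = M * D g" if "g \<in> carrier G" for g
    unfolding M_def by (rule average_intertwines[OF T(1) D _ that]) (simp add: elementary_def)
  have "M $$ (i, j) \<noteq> 0" unfolding M_def using average_elementary[OF T(1) D ij(1,1,2,2)] ij(3) by simp
  then have Mnz: "M \<noteq> 0\<^sub>m d d" using ij by auto
  \<comment> \<open>Irreducibility of \<open>T\<close> gives a right inverse of \<open>M\<close>, which is two-sided because \<open>M\<close> is square.\<close>
  obtain Q where Q: "Q \<in> carrier_mat d d" "M * Q = 1\<^sub>m d"
    using schur_right_inverse[OF T(2,1) D M MD Mnz] by blast
  have QM: "Q * M = 1\<^sub>m d" using mat_mult_left_right_inverse[OF M Q] .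
  have Dinv: "D g * transpose_mat (S g) = 1\<^sub>m d" "transpose_mat (S g) * D g = 1\<^sub>m d" if g: "g \<in> carrier G" for g
    using g transpose_mult[OF Sc[OF g] Sc[OF inv_closed[OF g]], symmetric] transpose_mult[OF Sc[OF inv_closed[OF g]] Sc[OF g], symmetric]
     matrix_rep_inv[OF d(2) g] by (simp_all add: D_def)
  define N where "N = transpose_mat M"
  have N: "N \<in> carrier_mat d d" using M by (simp add: N_def)
  have ND: "T g * N = N * D g" if g: "g \<in> carrier G" for g
  proof -
    have g': "\<tau> g \<in> carrier G" using g by simp
    have Tg: "T (\<tau> g) = S g" using g by (simp add: T_def)
    note c = Sc[OF g] Sc[OF g'] matrix_repD(1)[OF D g'] matrix_repD(1)[OF D g] matrix_repD(1)[OF T(1) g]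
    have "S g * M * transpose_mat (T g) = M * (D (\<tau> g) * transpose_mat (S (\<tau> g)))"
      using MD[OF g'] assoc_mult_mat[OF M c(3), of "transpose_mat (T g)" d] c unfolding Tg by (simp add: T_def)
    also have "\<dots> = M" using Dinv(1)[OF g'] M by simp
    finally have "transpose_mat (S g * M * transpose_mat (T g)) = N" by (simp add: N_def)
    moreover have "transpose_mat (S g * M * transpose_mat (T g)) = T g * (N * transpose_mat (S g))"
      using transpose_mult[OF mult_carrier_mat[OF c(1) M], of "transpose_mat (T g)" d] transpose_mult[OF c(1) M] c(5) 
      by (simp add: N_def)
    ultimately have "N = T g * (N * transpose_mat (S g))" by simp
    then have "N * D g = T g * (N * transpose_mat (S g)) * D g" by simp
    also have "\<dots> = T g * (N * transpose_mat (S g) * D g)"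
      by (rule assoc_mult_mat[of _ d d _ d _ d]) (use c N in auto)
    also have "N * transpose_mat (S g) * D g = N * (transpose_mat (S g) * D g)"
      by (rule assoc_mult_mat[of _ d d _ d _ d]) (use c N in auto)
    also have "\<dots> = N" using Dinv(2)[OF g] N by simp
    finally show ?thesis by simp
  qed
  have comm: "T g * (N * Q) = (N * Q) * T g" if g: "g \<in> carrier G" for g
  proof -
    note c = matrix_repD(1)[OF D g] matrix_repD(1)[OF T(1) g]
    have DQ: "D g * Q = Q * T g"
    proof -
      have "Q * T g = Q * (T g * (M * Q))" using Q c by simp
      also have "T g * (M * Q) = M * D g * Q" using assoc_mult_mat[OF c(2) M Q(1)] MD[OF g] by simp
      also have "M * D g * Q = M * (D g * Q)" by (rule assoc_mult_mat[OF M c(1) Q(1)])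
      also have "Q * (M * (D g * Q)) = Q * M * (D g * Q)"
        by (rule assoc_mult_mat[symmetric, of _ d d _ d _ d]) (use c Q M in auto)
      also have "\<dots> = D g * Q" using QM c Q mult_carrier_mat[OF c(1) Q(1)] by simp
      finally show ?thesis by simp
    qed
    have "T g * (N * Q) = N * D g * Q" using assoc_mult_mat[OF c(2) N Q(1)] ND[OF g] by simp
    also have "\<dots> = N * (Q * T g)" using assoc_mult_mat[OF N c(1) Q(1)] DQ by simp
    also have "\<dots> = (N * Q) * T g" using assoc_mult_mat[OF N Q(1) c(2)] by simp
    finally show ?thesis .
  qed
  obtain c where c: "N * Q = c \<cdot>\<^sub>m 1\<^sub>m d" using schur_scalar[OF T(2,1) mult_carrier_mat[OF N Q(1)] comm] by blast
  have NcM: "N = c \<cdot>\<^sub>m M"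
  proof -
    have "N = N * (Q * M)" using QM N by simp
    also have "\<dots> = N * Q * M" by (rule assoc_mult_mat[OF N Q(1) M, symmetric])
    also have "\<dots> = c \<cdot>\<^sub>m M" unfolding c using mult_smult_assoc_mat[of "1\<^sub>m d" d d M d c] M by simp
    finally show ?thesis .
  qed
  have sym: "M $$ (b, a) = c * M $$ (a, b)" if "a < d" "b < d" for a b
    using arg_cong[OF NcM, of "\<lambda>X. X $$ (a, b)"] that M by (simp add: N_def)
  have "M $$ (i, j) = c * (c * M $$ (i, j))" using sym ij by metis
  then have c2: "c\<^sup>2 = 1" using \<open>M $$ (i, j) \<noteq> 0\<close> by (simp add: power2_eq_square)
  have TQ: "T g = M * D g * Q" if g: "g \<in> carrier G" for g
  proof -
    note c = matrix_repD(1)[OF D g] matrix_repD(1)[OF T(1) g]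
    have "T g = T g * (M * Q)" using Q c by simp
    also have "\<dots> = M * D g * Q" using assoc_mult_mat[OF c(2) M Q(1)] MD[OF g] by simp
    finally show ?thesis .
  qed
  have entry: "T g $$ (y, x) = (\<Sum>b<d. \<Sum>a<d. M $$ (y, a) * Q $$ (b, x) * S (inv g) $$ (b, a))"
    if g: "g \<in> carrier G" and xy: "x < d" "y < d" for g x y
  proof -
    note c = matrix_repD(1)[OF D g]
    have "T g $$ (y, x) = (\<Sum>b<d. (M * D g) $$ (y, b) * Q $$ (b, x))"
      unfolding TQ[OF g] by (rule index_mult_mat_sum[OF mult_carrier_mat[OF M c] Q(1)]) (use xy in auto)
    also have "\<dots> = (\<Sum>b<d. \<Sum>a<d. M $$ (y, a) * Q $$ (b, x) * S (inv g) $$ (b, a))"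
    proof (rule sum.cong[OF refl])
      fix b assume b: "b \<in> {..<d}"
      then have "(M * D g) $$ (y, b) = (\<Sum>a<d. M $$ (y, a) * D g $$ (a, b))"
        by (intro index_mult_mat_sum[OF M c]) (use xy in auto)
      also have "\<dots> = (\<Sum>a<d. M $$ (y, a) * S (inv g) $$ (b, a))"
        using b Sc[OF inv_closed[OF g]] by (intro sum.cong) (auto simp: D_def)
      finally show "(M * D g) $$ (y, b) * Q $$ (b, x) = (\<Sum>a<d. M $$ (y, a) * Q $$ (b, x) * S (inv g) $$ (b, a))"
        by (simp add: sum_distrib_left sum_distrib_right mult_ac)
    qed
    finally show ?thesis .
  qed
  \<comment> \<open>Writing \<open>T v\<close> as \<open>M * D v * Q\<close> turns the sum into products of coefficients of \<open>S v\<close> and \<open>S (inv v)\<close>.\<close>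
  let ?k = "of_nat (card (carrier G)) / of_nat d :: complex"
  have "(\<Sum>v\<in>carrier G. tr (S (v \<otimes> \<tau> v))) =
     (\<Sum>v\<in>carrier G. \<Sum>x<d. \<Sum>y<d. \<Sum>b<d. \<Sum>a<d. M $$ (y, a) * Q $$ (b, x) * (S v $$ (x, y) * S (inv v) $$ (b, a)))"
  proof (rule sum.cong[OF refl])
    fix v assume v: "v \<in> carrier G"
    have "S (v \<otimes> \<tau> v) = S v * T v" using v by (simp add: Sm T_def)
    then have "tr (S (v \<otimes> \<tau> v)) = (\<Sum>x<d. \<Sum>y<d. S v $$ (x, y) * T v $$ (y, x))"
      using Sc[OF v] matrix_repD(1)[OF T(1) v]
      by (simp add: tr_def index_mult_mat_sum[of _ d d _ d] del: index_mult_mat(1))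
    also have "\<dots> = (\<Sum>x<d. \<Sum>y<d. \<Sum>b<d. \<Sum>a<d. M $$ (y, a) * Q $$ (b, x) * (S v $$ (x, y) * S (inv v) $$ (b, a)))"
      by (intro sum.cong refl) (simp add: entry[OF v] sum_distrib_left mult_ac)
    finally show "tr (S (v \<otimes> \<tau> v)) = \<dots>" .
  qed
  also have "\<dots> = (\<Sum>x<d. \<Sum>y<d. \<Sum>b<d. \<Sum>a<d. M $$ (y, a) * Q $$ (b, x) * (\<Sum>v\<in>carrier G. S v $$ (x, y) * S (inv v) $$ (b, a)))"
    unfolding sum_distrib_left
    by (rule trans[OF sum.swap], rule sum.cong[OF refl], rule trans[OF sum.swap], rule sum.cong[OF refl],
        rule trans[OF sum.swap], rule sum.cong[OF refl], rule sum.swap)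
  also have "\<dots> = (\<Sum>x<d. \<Sum>y<d. \<Sum>b<d. \<Sum>a<d. if a = x then if b = y then M $$ (y, x) * Q $$ (y, x) * ?k else 0 else 0)"
    by (intro sum.cong refl) (auto simp: matrix_coefficients_orthonormal[OF S d(2)])
  also have "\<dots> = (\<Sum>x<d. \<Sum>y<d. M $$ (y, x) * Q $$ (y, x) * ?k)"
    by (intro sum.cong refl) (simp add: sum.delta)
  also have "\<dots> = (\<Sum>x<d. \<Sum>y<d. c * M $$ (x, y) * Q $$ (y, x) * ?k)"
    by (intro sum.cong refl arg_cong2[where f = "(*)"] sym) auto
  also have "\<dots> = (\<Sum>x<d. \<Sum>y<d. M $$ (x, y) * Q $$ (y, x)) * (c * ?k)"
    by (simp add: sum_distrib_right sum_distrib_left mult_ac)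
  also have "(\<Sum>x<d. \<Sum>y<d. M $$ (x, y) * Q $$ (y, x)) = tr (M * Q)"
    using M Q(1) by (simp add: tr_def index_mult_mat_sum[of _ d d _ d] del: index_mult_mat(1))
  also have "tr (M * Q) * (c * ?k) = c * of_nat (card (carrier G))" using d(1) by (simp add: Q(2))
  finally show ?thesis using c2 by blast
qed

text \<open>Multiplicities are inner products of characters. Here they are twisted indicators, which are
  \<open>\<plusminus>1\<close>, and a multiplicity is never negative. The automorphism enters the substitution
  \<open>u = inv (\<tau> v)\<close>, under which \<open>inv (u \<otimes> \<tau> u)\<close> becomes \<open>v \<otimes> \<tau> v\<close>.\<close>

theorem gelfand_criterion:
  assumes R: "matrix_rep G d R"
    and character: "\<And>g. g \<in> carrier G \<Longrightarrow> tr (R g) = of_nat (card {u \<in> carrier G. u \<otimes> \<tau> u = g})"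
    and conj: "\<And>g. g \<in> carrier G \<Longrightarrow> \<exists>s\<in>carrier G. s \<otimes> g \<otimes> inv s = inv (\<tau> g)"
  shows "\<exists>Rs. complete_irreducibles G Rs \<and> equivalent_rep G R (direct_sum_rep Rs)"
proof -
  obtain Rs where irr: "\<forall>S\<in>set Rs. irreducible_rep G S" and eq: "equivalent_rep G R (direct_sum_rep Rs)"
    using complete_reducibility[OF R] by blast
  have mult1: "card {i. i < length Rs \<and> equivalent_rep G (Rs ! i) S} = 1" if S: "irreducible_rep G S" for S
  proof -
    let ?I = "{i. i < length Rs \<and> equivalent_rep G (Rs ! i) S}"
    have "(\<Sum>g\<in>carrier G. tr (R g) * tr (S (inv g))) =
        (\<Sum>g\<in>carrier G. \<Sum>i<length Rs. tr ((Rs ! i) g) * tr (S (inv g)))"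
      by (intro sum.cong refl)
        (simp add: equivalent_rep_tr[OF eq] tr_direct_sum_rep(2)[OF irr] sum_list_sum_nth atLeast0LessThan
          sum_distrib_right)
    also have "\<dots> = (\<Sum>i<length Rs. \<Sum>g\<in>carrier G. tr ((Rs ! i) g) * tr (S (inv g)))" by (rule sum.swap)
    also have "\<dots> = (\<Sum>i<length Rs. if equivalent_rep G (Rs ! i) S then of_nat (card (carrier G)) else 0)"
      by (intro sum.cong refl character_inner_product) (use irr S in auto)
    also have "\<dots> = of_nat (card ?I) * of_nat (card (carrier G))"
      by (subst sum.inter_filter[symmetric]) (auto simp: lessThan_def)
    finally have 1: "(\<Sum>g\<in>carrier G. tr (R g) * tr (S (inv g))) = of_nat (card ?I) * of_nat (card (carrier G))" .
    have "(\<Sum>g\<in>carrier G. tr (R g) * tr (S (inv g))) =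
        (\<Sum>g\<in>carrier G. \<Sum>u | u \<in> carrier G \<and> u \<otimes> \<tau> u = g. tr (S (inv (u \<otimes> \<tau> u))))"
      by (intro sum.cong refl) (simp add: character)
    also have "\<dots> = (\<Sum>u\<in>carrier G. tr (S (inv (u \<otimes> \<tau> u))))"
      by (rule sum.group[of "carrier G" "carrier G" "\<lambda>u. u \<otimes> \<tau> u"]) (use finite_carrier in auto)
    also have "\<dots> = (\<Sum>v\<in>carrier G. tr (S (v \<otimes> \<tau> v)))"
    proof (rule sum.reindex_bij_witness[where i = "\<lambda>v. inv (\<tau> v)" and j = "\<lambda>v. inv (\<tau> v)"])
      fix u assume u: "u \<in> carrier G"
      then show "tr (S (inv (\<tau> u) \<otimes> \<tau> (inv (\<tau> u)))) = tr (S (inv (u \<otimes> \<tau> u)))"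
        by (simp add: inv_mult_group)
    qed auto
    finally have 2: "(\<Sum>g\<in>carrier G. tr (R g) * tr (S (inv g))) = (\<Sum>v\<in>carrier G. tr (S (v \<otimes> \<tau> v)))" .
    obtain c where c: "c\<^sup>2 = 1" "(\<Sum>v\<in>carrier G. tr (S (v \<otimes> \<tau> v))) = c * of_nat (card (carrier G))"
      using twisted_frobenius_schur[OF S conj] by blast
    have "of_nat (card ?I) = c" using 1 2 c(2) card_nz by simp
    then have "(of_nat ((card ?I)\<^sup>2) :: complex) = of_nat 1" using c(1) by simp
    then have "(card ?I)\<^sup>2 = 1" by (simp only: of_nat_eq_iff)
    then show ?thesis by (simp add: power2_eq_square)
  qed
  have "complete_irreducibles G Rs" unfolding complete_irreducibles_def
  proof (intro conjI allI impI)
    fix i j assume ij: "i < length Rs" "j < length Rs" "i \<noteq> j"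
    show "\<not> equivalent_rep G (Rs ! i) (Rs ! j)"
    proof
      assume e: "equivalent_rep G (Rs ! i) (Rs ! j)"
      have irrj: "irreducible_rep G (Rs ! j)" using irr ij by simp
      obtain e where "matrix_rep G e (Rs ! j)" using irreducible_has_matrix_rep[OF irrj] by metis
      then have "{i, j} \<subseteq> {k. k < length Rs \<and> equivalent_rep G (Rs ! k) (Rs ! j)}"
        using e ij equivalent_rep_refl by auto
      from card_mono[OF _ this] show False using mult1[OF irrj] ij(3) by simp
    qed
  next
    fix S assume S: "irreducible_rep G S"
    then have "{i. i < length Rs \<and> equivalent_rep G (Rs ! i) S} \<noteq> {}"
      using mult1[OF S] by (metis card.empty zero_neq_one)
    then show "\<exists>S'\<in>set Rs. equivalent_rep G S S'" using equivalent_rep_sym nth_mem by blast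
  qed (use irr in auto)
  with eq show ?thesis by blast
qed

end


section \<open>Cycles of a monomial element\<close>

text \<open>Congruence by \<open>b\<close> multiplies a diagonal coefficient by \<open>b \<otimes> b\<close>, whence the form of the cocycle rule.
  The last condition says that the trace is the required one for the wreath product with a single point:
  if \<open>a\<close> is an involution it fixes all \<open>x\<close>, and \<open>u \<otimes> inv u = a\<close> has a solution only for \<open>a = \<one>\<close>.\<close>

locale abelian_sign = comm_group A for A (structure) +
  fixes sgA :: "'a \<Rightarrow> 'a \<Rightarrow> complex"
  assumes finite_A: "finite (carrier A)"
    and sign_pm1: "a \<in> carrier A \<Longrightarrow> x \<in> carrier A \<Longrightarrow> sgA a x = 1 \<or> sgA a x = - 1"
    and sign_cocycle: "a \<in> carrier A \<Longrightarrow> b \<in> carrier A \<Longrightarrow> x \<in> carrier A \<Longrightarrow>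
      sgA (a \<otimes> b) x = sgA a (b \<otimes> b \<otimes> x) * sgA b x"
    and sign_sum: "a \<in> carrier A \<Longrightarrow> a \<otimes> a = \<one> \<Longrightarrow>
      (\<Sum>x\<in>carrier A. sgA a x) = (if a = \<one> then of_nat (card (carrier A)) else 0)"

text \<open>A monomial element on an arbitrary finite set of points, so that it can be restricted to unions of
  cycles.\<close>

locale monomial_element = abelian_sign A sgA for A :: "('a, 'b) monoid_scheme" (structure) and sgA +
  fixes S0 :: "nat set" and a :: "nat \<Rightarrow> 'a" and \<pi> :: "nat \<Rightarrow> nat"
  assumes finite_S0: "finite S0" and perm: "\<pi> permutes S0" and a_closed: "i \<in> S0 \<Longrightarrow> a i \<in> carrier A"
begin

text \<open>The \<open>k\<close>-th point after \<open>i\<close> on its cycle; \<open>path_prod\<close> is used for the product of coefficients met on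
  the first \<open>k\<close> steps.\<close>

definition p :: "nat \<Rightarrow> nat \<Rightarrow> nat" where "p i k = (\<pi> ^^ k) i"
definition period :: "nat \<Rightarrow> nat" where "period i = (LEAST m. m > 0 \<and> p i m = i)"
definition cyc :: "nat \<Rightarrow> nat set" where "cyc i = range (p i)"
definition path_prod :: "(nat \<Rightarrow> 'a) \<Rightarrow> nat \<Rightarrow> 'a" where "path_prod f k = finprod A f {..<k}"

lemma p_0 [simp]: "p i 0 = i" by (simp add: p_def)
lemma p_Suc: "p i (Suc k) = \<pi> (p i k)" by (simp add: p_def)
lemma p_add: "p i (k + l) = p (p i k) l" by (simp add: p_def funpow_add funpow_swap1 add.commute[of k l])
lemma p_pi: "p (\<pi> i) k = \<pi> (p i k)" by (simp add: p_def funpow_swap1)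

lemma pi_inj: "\<pi> i = \<pi> j \<longleftrightarrow> i = j"
  using permutes_inj[OF perm] by (auto dest: injD)

lemma p_inj: "p i k = p j k \<longleftrightarrow> i = j"
  by (induction k) (auto simp: p_Suc pi_inj)

lemma period_props: "period i > 0 \<and> p i (period i) = i"
proof -
  have "permutation \<pi>" using finite_S0 perm permutation_permutes by blast
  then obtain m where "(\<pi> ^^ m) = id" "m > 0" using permutation_is_nilpotent by metis
  then have "m > 0 \<and> p i m = i" by (simp add: p_def)
  then show ?thesis unfolding period_def by (rule LeastI)
qed

lemma p_mod: "p i (k mod period i) = p i k"
  unfolding p_def by (rule funpow_mod_eq) (use period_props[of i] in \<open>simp add: p_def\<close>)

lemma period_minimal: "0 < k \<Longrightarrow> k < period i \<Longrightarrow> p i k \<noteq> i"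
  unfolding period_def using not_less_Least by blast

lemma p_eq_iff: "p i k = p i l \<longleftrightarrow> k mod period i = l mod period i"
proof
  have *: "k = l" if "k \<le> l" "l < period i" "p i k = p i l" for k l
  proof (rule ccontr)
    assume "k \<noteq> l"
    have "p (p i (l - k)) k = p i k"
      using p_add[of i "l - k" k] that by simp
    then have "p i (l - k) = i" by (simp add: p_inj)
    then show False using period_minimal[of "l - k" i] that \<open>k \<noteq> l\<close> by auto
  qed
  assume "p i k = p i l"
  then have e: "p i (k mod period i) = p i (l mod period i)" by (simp add: p_mod)
  have "k mod period i < period i" "l mod period i < period i" using period_props[of i] by auto
  then show "k mod period i = l mod period i"
    using *[of "k mod period i" "l mod period i"] *[of "l mod period i" "k mod period i"] e by linarith
next
  assume "k mod period i = l mod period i"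
  then show "p i k = p i l" by (metis p_mod)
qed

lemma p_in_cyc [simp]: "p i k \<in> cyc i" by (simp add: cyc_def)
lemma self_in_cyc [simp]: "i \<in> cyc i" using p_in_cyc[of i 0] by simp

lemma bij_betw_cyc: "bij_betw (p i) {..<period i} (cyc i)"
proof -
  have "inj_on (p i) {..<period i}" by (auto simp: inj_on_def p_eq_iff)
  moreover have "p i ` {..<period i} = cyc i"
  proof -
    have "p i k \<in> p i ` {..<period i}" for k
      using period_props[of i] by (metis imageI lessThan_iff mod_less_divisor p_mod)
    then show ?thesis unfolding cyc_def by blast
  qed
  ultimately show ?thesis by (simp add: bij_betw_def)
qed

lemma finite_cyc [simp]: "finite (cyc i)"
  using bij_betw_finite[OF bij_betw_cyc[of i]] by simp

lemma pi_cyc: "\<pi> j \<in> cyc i \<longleftrightarrow> j \<in> cyc i"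
proof
  assume "j \<in> cyc i"
  then obtain k where "j = p i k" unfolding cyc_def by blast
  then have "\<pi> j = p i (Suc k)" by (simp add: p_Suc)
  then show "\<pi> j \<in> cyc i" by simp
next
  assume "\<pi> j \<in> cyc i"
  then obtain k where k: "\<pi> j = p i k" unfolding cyc_def by blast
  have "p i k = p i (k + period i)" by (simp add: p_eq_iff)
  also have "k + period i = Suc (k + period i - 1)" using period_props[of i] by simp
  finally have "\<pi> j = \<pi> (p i (k + period i - 1))" using k p_Suc by metis
  then have "j = p i (k + period i - 1)" by (simp add: pi_inj)
  then show "j \<in> cyc i" by simp
qed

lemma cyc_subset:
  assumes "\<And>i. i \<in> S \<Longrightarrow> \<pi> i \<in> S" "i \<in> S" shows "cyc i \<subseteq> S"
proof -
  have "p i k \<in> S" for k by (induction k) (use assms in \<open>auto simp: p_Suc\<close>)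
  then show ?thesis unfolding cyc_def by blast
qed

lemma cyc_disjoint: "j \<notin> cyc i \<Longrightarrow> cyc i \<inter> cyc j = {}"
proof (rule ccontr)
  assume j: "j \<notin> cyc i" and "cyc i \<inter> cyc j \<noteq> {}"
  then obtain y where "y \<in> cyc i" "y \<in> cyc j" by blast
  then obtain k where "p j k \<in> cyc i" unfolding cyc_def[of j] by blast
  then have "j \<in> cyc i" by (induction k) (auto simp: p_Suc pi_cyc)
  with j show False by simp
qed

lemma p_in_S0: "i \<in> S0 \<Longrightarrow> p i k \<in> S0"
  by (induction k) (auto simp: p_Suc permutes_in_image[OF perm])

lemma ap_closed [simp]: "i \<in> S0 \<Longrightarrow> a (p i k) \<in> carrier A"
  using p_in_S0 a_closed by blast

lemma path_prod_0 [simp]: "path_prod f 0 = \<one>" by (simp add: path_prod_def)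

lemma path_prod_closed [simp]: "(\<And>k. f k \<in> carrier A) \<Longrightarrow> path_prod f m \<in> carrier A"
  unfolding path_prod_def by (rule finprod_closed) auto

lemma path_prod_Suc: "(\<And>k. f k \<in> carrier A) \<Longrightarrow> path_prod f (Suc m) = f m \<otimes> path_prod f m"
  unfolding path_prod_def lessThan_Suc by (subst finprod_insert) auto

lemma path_prod_mult:
  "(\<And>k. f k \<in> carrier A) \<Longrightarrow> (\<And>k. g k \<in> carrier A) \<Longrightarrow> path_prod (\<lambda>k. f k \<otimes> g k) m = path_prod f m \<otimes> path_prod g m"
  unfolding path_prod_def by (rule finprod_multf) auto

lemma path_prod_add:
  assumes "\<And>k. f k \<in> carrier A" shows "path_prod f (m + l) = path_prod f m \<otimes> path_prod (\<lambda>k. f (m + k)) l"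
proof (induction l)
  case (Suc l)
  then show ?case using assms by (simp add: path_prod_Suc m_lcomm)
qed (use assms in simp)

definition cycle_prod :: "nat \<Rightarrow> 'a" where "cycle_prod i = path_prod (\<lambda>k. a (p i k)) (period i)"

lemma cycle_prod_closed [simp]: "i \<in> S0 \<Longrightarrow> cycle_prod i \<in> carrier A" unfolding cycle_prod_def by simp

text \<open>Solutions of a first-order recursion along a cycle are determined by their value at one point,
  which is arbitrary if the product of the multipliers around the cycle is trivial.\<close>

lemma lift_values:
  assumes h: "\<And>k. h (p i k) \<in> carrier A" and x: "\<And>j. j \<in> cyc i \<Longrightarrow> x j \<in> carrier A"
    and rec: "\<And>j. j \<in> cyc i \<Longrightarrow> x (\<pi> j) = h j \<otimes> x j"
  shows "x (p i k) = path_prod (\<lambda>l. h (p i l)) k \<otimes> x i"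
proof (induction k)
  case (Suc k)
  have "x (p i (Suc k)) = h (p i k) \<otimes> x (p i k)" by (simp add: p_Suc rec)
  then show ?case using Suc h x[of i] by (simp add: path_prod_Suc m_assoc)
qed (use x[of i] in simp)

lemma lift_exists:
  assumes h: "\<And>k. h (p i k) \<in> carrier A" and x0: "x0 \<in> carrier A"
    and closing: "path_prod (\<lambda>l. h (p i l)) (period i) = \<one>"
  shows "\<exists>x\<in>cyc i \<rightarrow>\<^sub>E carrier A. x i = x0 \<and> (\<forall>j\<in>cyc i. x (\<pi> j) = h j \<otimes> x j)"
proof -
  let ?q = "the_inv_into {..<period i} (p i)"
  note bij = bij_betw_cyc[of i]
  have q: "?q (p i k) = k" if "k < period i" for k
    using that bij by (intro the_inv_into_f_f) (auto simp: bij_betw_def)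
  define x where "x = (\<lambda>j\<in>cyc i. path_prod (\<lambda>l. h (p i l)) (?q j) \<otimes> x0)"
  have xp: "x (p i k) = path_prod (\<lambda>l. h (p i l)) k \<otimes> x0" if "k < period i" for k
    using q[OF that] by (simp add: x_def)
  have "x i = x0" using xp[of 0] period_props[of i] x0 by simp
  moreover have "x (\<pi> j) = h j \<otimes> x j" if j: "j \<in> cyc i" for j
  proof -
    obtain k where k: "k < period i" "j = p i k" using j bij unfolding bij_betw_def by auto
    have eq: "h j \<otimes> x j = path_prod (\<lambda>l. h (p i l)) (Suc k) \<otimes> x0"
      using h x0 k by (simp add: xp path_prod_Suc m_assoc)
    show ?thesis
    proof (cases "Suc k < period i")
      case True
      then show ?thesis using xp[OF True] eq k by (simp add: p_Suc)
    next
      case False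
      then have "Suc k = period i" using k by simp
      then have "\<pi> j = i" using k period_props[of i] by (metis p_Suc)
      then show ?thesis using eq closing x0 \<open>x i = x0\<close> \<open>Suc k = period i\<close> by simp
    qed
  qed
  moreover have "x \<in> cyc i \<rightarrow>\<^sub>E carrier A" using h x0 by (auto simp: x_def)
  ultimately show ?thesis by blast
qed

lemma bij_betw_lift:
  assumes h: "\<And>k. h (p i k) \<in> carrier A" and closing: "path_prod (\<lambda>l. h (p i l)) (period i) = \<one>"
  shows "bij_betw (\<lambda>x. x i) {x \<in> cyc i \<rightarrow>\<^sub>E carrier A. \<forall>j\<in>cyc i. x (\<pi> j) = h j \<otimes> x j} (carrier A)"
    (is "bij_betw _ ?X _")
proof (rule bij_betw_imageI)
  show "inj_on (\<lambda>x. x i) ?X"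
  proof (rule inj_onI)
    fix x y assume x: "x \<in> ?X" and y: "y \<in> ?X" and eq: "x i = y i"
    have "x j = y j" if j: "j \<in> cyc i" for j
    proof -
      obtain k where k: "j = p i k" using j unfolding cyc_def by blast
      have "x (p i k) = path_prod (\<lambda>l. h (p i l)) k \<otimes> x i"
        by (rule lift_values[where h = h, OF h]) (use x in auto)
      moreover have "y (p i k) = path_prod (\<lambda>l. h (p i l)) k \<otimes> y i"
        by (rule lift_values[where h = h, OF h]) (use y in auto)
      ultimately show ?thesis using eq k by simp
    qed
    then show "x = y" using x y by (intro PiE_ext[of x "cyc i" "\<lambda>_. carrier A" y]) auto
  qed
  show "(\<lambda>x. x i) ` ?X = carrier A"
    using lift_exists[where h = h, OF h _ closing] by (auto simp: image_iff)
qed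

text \<open>Shifting the starting point does not change the product around the cycle.\<close>

lemma path_prod_square: "i \<in> S0 \<Longrightarrow> path_prod (\<lambda>k. a (p i k) \<otimes> a (p i (K + k))) (period i) = cycle_prod i \<otimes> cycle_prod i"
proof -
  assume i: "i \<in> S0"
  have "path_prod (\<lambda>k. a (p i k)) (K + period i) = path_prod (\<lambda>k. a (p i k)) K \<otimes> path_prod (\<lambda>k. a (p i (K + k))) (period i)"
    by (rule path_prod_add) (use i in simp)
  moreover have "path_prod (\<lambda>k. a (p i k)) (period i + K) = cycle_prod i \<otimes> path_prod (\<lambda>k. a (p i (period i + k))) K"
    unfolding cycle_prod_def by (rule path_prod_add) (use i in simp)
  moreover have "p i (period i + k) = p i k" for k by (simp add: p_eq_iff)
  ultimately have "path_prod (\<lambda>k. a (p i (K + k))) (period i) \<otimes> path_prod (\<lambda>k. a (p i k)) K = cycle_prod i \<otimes> path_prod (\<lambda>k. a (p i k)) K"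
    using i by (simp add: add.commute m_comm)
  then have "path_prod (\<lambda>k. a (p i (K + k))) (period i) = cycle_prod i"
    by (subst (asm) right_cancel) (use i in simp_all)
  then show ?thesis using i by (simp add: path_prod_mult cycle_prod_def[symmetric])
qed

lemma path_prod_double:
  "i \<in> S0 \<Longrightarrow> path_prod (\<lambda>k. a (p i k) \<otimes> a (p i (K + k))) K = path_prod (\<lambda>k. a (p i k)) (K + K)"
  by (simp add: path_prod_mult path_prod_add)

text \<open>Going \<open>K\<close> steps along the recursion multiplies the value at \<open>i\<close> by a path product, which the second
  condition prescribes to be \<open>e i\<close>; this forces \<open>cycle_prod i = \<one>\<close>. Conversely, by \<open>tw\<close> the second
  condition passes from one point of the cycle to the next. It is applied with \<open>e = \<one>\<close> to half turns and
  with \<open>e = a\<close> to square roots of the cycle.\<close>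

lemma card_twisted_lifts:
  assumes i: "i \<in> S0" and e: "\<And>j. j \<in> cyc i \<Longrightarrow> e j \<in> carrier A"
    and tw: "\<And>j. j \<in> cyc i \<Longrightarrow> a (p j (K + K)) \<otimes> e j = e (\<pi> j) \<otimes> a j"
    and base: "path_prod (\<lambda>k. a (p i k)) (K + K) = cycle_prod i \<otimes> e i"
  shows "card {x \<in> cyc i \<rightarrow>\<^sub>E carrier A. \<forall>j\<in>cyc i. x (\<pi> j) = a j \<otimes> a (p j K) \<otimes> x j \<and> x (p j K) = e j \<otimes> x j}
    = (if cycle_prod i = \<one> then card (carrier A) else 0)" (is "card ?X = _")
proof -
  define h where "h j = a j \<otimes> a (p j K)" for j
  have hp: "h (p i k) = a (p i k) \<otimes> a (p i (K + k))" for k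
    by (simp add: h_def p_add[symmetric] add.commute)
  have hc: "h (p i k) \<in> carrier A" for k using i by (simp add: hp)
  have ac: "a j \<in> carrier A" "a (p j l) \<in> carrier A" if j: "j \<in> cyc i" for j l
    using j i unfolding cyc_def by (auto simp: p_add[symmetric])
  have pc: "p j l \<in> cyc i" if "j \<in> cyc i" for j l using that unfolding cyc_def by (auto simp: p_add[symmetric])
  have val: "x (p i K) = cycle_prod i \<otimes> e i \<otimes> x i" if "x \<in> cyc i \<rightarrow>\<^sub>E carrier A" "\<forall>j\<in>cyc i. x (\<pi> j) = h j \<otimes> x j" for x
    using lift_values[where h = h and i = i, OF hc, of x K] that base path_prod_double[OF i, of K] by (auto simp: hp)
  show ?thesis
  proof (cases "cycle_prod i = \<one>")
    case False
    have "False" if x: "x \<in> ?X" for x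
    proof -
      have xi: "x i \<in> carrier A" using x by auto
      have "cycle_prod i \<otimes> (e i \<otimes> x i) = e i \<otimes> x i" using val[of x] x e[of i] xi i by (auto simp: h_def m_assoc)
      then have "cycle_prod i = \<one>" using e[of i] xi i by (subst (asm) r_cancel_one) simp_all
      with False show False by simp
    qed
    then have "?X = {}" by blast
    then show ?thesis using False by (metis card.empty)
  next
    case True
    have closing: "path_prod (\<lambda>l. h (p i l)) (period i) = \<one>" using path_prod_square[OF i, of K] True by (simp add: hp)
    have "x \<in> ?X" if x: "x \<in> cyc i \<rightarrow>\<^sub>E carrier A" "\<forall>j\<in>cyc i. x (\<pi> j) = h j \<otimes> x j" for x
    proof -
      have xc: "x j \<in> carrier A" if "j \<in> cyc i" for j using x(1) that by auto
      have "x (p (p i k) K) = e (p i k) \<otimes> x (p i k)" for k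
      proof (induction k)
        case 0
        then show ?case using val[OF x] True e[of i] xc[of i] by simp
      next
        case (Suc k)
        let ?j = "p i k"
        have j: "?j \<in> cyc i" and jK: "p ?j K \<in> cyc i" and sj: "\<pi> ?j \<in> cyc i" by (auto simp: pc pi_cyc)
        have "x (p (p i (Suc k)) K) = h (p ?j K) \<otimes> (e ?j \<otimes> x ?j)"
          using x(2) jK Suc by (simp add: p_Suc p_pi)
        also have "h (p ?j K) = a (p ?j K) \<otimes> a (p ?j (K + K))" by (simp add: h_def p_add)
        also have "a (p ?j K) \<otimes> a (p ?j (K + K)) \<otimes> (e ?j \<otimes> x ?j) = a (p ?j K) \<otimes> (a (p ?j (K + K)) \<otimes> e ?j) \<otimes> x ?j"
          using ac[OF j] e[OF j] xc[OF j] by (simp add: m_assoc)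
        also have "\<dots> = e (\<pi> ?j) \<otimes> (h ?j \<otimes> x ?j)"
          unfolding tw[OF j] h_def using ac[OF j] e[OF sj] xc[OF j] by (simp add: m_ac)
        also have "h ?j \<otimes> x ?j = x (p i (Suc k))" using x(2) j by (simp add: p_Suc)
        finally show ?case by (simp add: p_Suc)
      qed
      then have "x (p j K) = e j \<otimes> x j" if "j \<in> cyc i" for j using that unfolding cyc_def by blast
      with x show ?thesis by (auto simp: h_def)
    qed
    then have "?X = {x \<in> cyc i \<rightarrow>\<^sub>E carrier A. \<forall>j\<in>cyc i. x (\<pi> j) = h j \<otimes> x j}"
      by (auto simp: h_def)
    then have "bij_betw (\<lambda>x. x i) ?X (carrier A)" using bij_betw_lift[where h = h, OF hc closing] by simp
    then show ?thesis using True by (simp add: bij_betw_same_card)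
  qed
qed

end


section \<open>Signed fixed points and square roots\<close>

text \<open>Elements of the wreath product are encoded pointwise, the point \<open>i\<close> carrying its coefficient
  \<open>fst (z i)\<close> and its image \<open>snd (z i)\<close>. Such functions can be restricted to sets of points and glued.\<close>

definition solutions :: "'a set \<Rightarrow> ((nat \<Rightarrow> 'a \<times> nat) \<Rightarrow> nat \<Rightarrow> bool) \<Rightarrow> nat set \<Rightarrow> (nat \<Rightarrow> 'a \<times> nat) set" where
  "solutions C Q S = {z \<in> S \<rightarrow>\<^sub>E C \<times> S. \<forall>i\<in>S. Q z i}"

lemma finite_solutions: "finite C \<Longrightarrow> finite S \<Longrightarrow> finite (solutions C Q S)"
  unfolding solutions_def by (rule finite_subset[of _ "S \<rightarrow>\<^sub>E C \<times> S"]) (auto intro!: finite_PiE)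

text \<open>Solutions mapping \<open>i0\<close> to \<open>j\<close> preserve \<open>U\<close>, so they are the pairs of a solution on \<open>U\<close> and one on
  the complement.\<close>

lemma sum_solutions_split:
  fixes w :: "nat \<Rightarrow> 'a \<times> nat \<Rightarrow> complex"
  assumes fin: "finite S" "finite C" and U: "U \<subseteq> S" "i0 \<in> U"
    and local: "\<And>V z z' i. V \<in> {U, S - U} \<Longrightarrow> (\<And>k. k \<in> V \<Longrightarrow> z k = z' k) \<Longrightarrow> i \<in> V \<Longrightarrow> snd (z i) \<in> V \<Longrightarrow> Q z i = Q z' i"
    and stable: "\<And>z i. z \<in> solutions C Q S \<Longrightarrow> snd (z i0) = j \<Longrightarrow> i \<in> S \<Longrightarrow> snd (z i) \<in> U \<longleftrightarrow> i \<in> U"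
  shows "(\<Sum>z | z \<in> solutions C Q S \<and> snd (z i0) = j. \<Prod>i\<in>S. w i (z i)) =
    (\<Sum>z | z \<in> solutions C Q U \<and> snd (z i0) = j. \<Prod>i\<in>U. w i (z i)) *
    (\<Sum>z\<in>solutions C Q (S - U). \<Prod>i\<in>S - U. w i (z i))"
proof -
  let ?M = "\<lambda>(f, g) i. if i \<in> U then f i else g i :: 'a \<times> nat"
  let ?R = "\<lambda>z. (restrict z U, restrict z (S - U))"
  let ?X = "{z. z \<in> solutions C Q U \<and> snd (z i0) = j}" and ?Y = "solutions C Q (S - U)"
    and ?Z = "{z. z \<in> solutions C Q S \<and> snd (z i0) = j}"
  have M: "?M (f, g) \<in> ?Z" if f: "f \<in> ?X" and g: "g \<in> ?Y" for f g
  proof -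
    let ?z = "\<lambda>i. if i \<in> U then f i else g i"
    have fU: "f i \<in> C \<times> U" if "i \<in> U" for i using f that unfolding solutions_def by auto
    have gU: "g i \<in> C \<times> (S - U)" if "i \<in> S - U" for i using g that unfolding solutions_def by auto
    have gx: "g \<in> extensional (S - U)" using g unfolding solutions_def by (auto simp: PiE_def)
    have "?z \<in> S \<rightarrow>\<^sub>E C \<times> S"
    proof (rule PiE_I)
      fix i assume "i \<in> S" then show "?z i \<in> C \<times> S"
        using fU[of i] gU[of i] U(1) by (cases "i \<in> U") auto
    next
      fix i assume "i \<notin> S" then show "?z i = undefined"
        using U(1) gx by (auto simp: extensional_def)
    qed
    moreover have "Q ?z i" if i: "i \<in> S" for i
    proof (cases "i \<in> U")
      case True
      have "Q f i = Q ?z i" by (rule local[of U]) (use True fU[OF True] in auto)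
      then show ?thesis using f True unfolding solutions_def by auto
    next
      case False
      have "Q g i = Q ?z i" by (rule local[of "S - U"]) (use False i gU[of i] in auto)
      then show ?thesis using g False i unfolding solutions_def by auto
    qed
    ultimately show ?thesis using f U(2) unfolding solutions_def by auto
  qed
  have R: "?R z \<in> ?X \<times> ?Y" if z: "z \<in> ?Z" for z
  proof -
    have zS: "z i \<in> C \<times> S" "Q z i" if "i \<in> S" for i using z that unfolding solutions_def by auto
    have st: "snd (z i) \<in> U \<longleftrightarrow> i \<in> U" if "i \<in> S" for i using stable[of z i] z that by auto
    have zU: "z i \<in> C \<times> U" if "i \<in> U" for i
      using zS(1)[of i] st[of i] that U(1) by (auto simp: mem_Times_iff)
    have zSU: "z i \<in> C \<times> (S - U)" if "i \<in> S - U" for i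
      using zS(1)[of i] st[of i] that by (auto simp: mem_Times_iff)
    have "Q (restrict z U) i" if i: "i \<in> U" for i
    proof -
      have "Q z i = Q (restrict z U) i" by (rule local[of U]) (use i zU[OF i] in auto)
      then show ?thesis using zS(2)[of i] i U(1) by auto
    qed
    moreover have "Q (restrict z (S - U)) i" if i: "i \<in> S - U" for i
    proof -
      have "Q z i = Q (restrict z (S - U)) i" by (rule local[of "S - U"]) (use i zSU[OF i] in auto)
      then show ?thesis using zS(2)[of i] i by auto
    qed
    ultimately show ?thesis using zU zSU z U(2) unfolding solutions_def by auto
  qed
  have "(\<Sum>z\<in>?Z. \<Prod>i\<in>S. w i (z i)) =
      (\<Sum>fg\<in>?X \<times> ?Y. (\<Prod>i\<in>U. w i (fst fg i)) * (\<Prod>i\<in>S - U. w i (snd fg i)))"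
  proof (rule sum.reindex_bij_witness[where i = ?M and j = ?R])
    fix z assume z: "z \<in> ?Z"
    show "?R z \<in> ?X \<times> ?Y" by (rule R[OF z])
    have ext: "z \<in> extensional S" using z unfolding solutions_def by (auto simp: PiE_def)
    show "?M (?R z) = z"
    proof
      fix i show "?M (?R z) i = z i"
        using ext U(1) by (cases "i \<in> S") (auto simp: extensional_def)
    qed
    show "(\<Prod>i\<in>U. w i (fst (?R z) i)) * (\<Prod>i\<in>S - U. w i (snd (?R z) i)) = (\<Prod>i\<in>S. w i (z i))"
      using prod.subset_diff[OF U(1) fin(1), of "\<lambda>i. w i (z i)"] by (simp add: mult.commute)
  next
    fix fg assume fg: "fg \<in> ?X \<times> ?Y"
    then obtain f g where e: "fg = (f, g)" "f \<in> ?X" "g \<in> ?Y" by blast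
    show "?M fg \<in> ?Z" using M[OF e(2,3)] unfolding e(1) .
    have fx: "f \<in> extensional U" and gx: "g \<in> extensional (S - U)"
      using e unfolding solutions_def by (auto simp: PiE_def)
    have "restrict (?M fg) U = f"
      using fx unfolding e(1) by (auto simp: restrict_def extensional_def)
    moreover have "restrict (?M fg) (S - U) = g"
      using gx unfolding e(1) by (auto simp: restrict_def extensional_def fun_eq_iff)
    ultimately show "?R (?M fg) = fg" using e(1) by simp
  qed
  also have "\<dots> = (\<Sum>f\<in>?X. \<Prod>i\<in>U. w i (f i)) * (\<Sum>g\<in>?Y. \<Prod>i\<in>S - U. w i (g i))"
    by (simp add: sum_product sum.cartesian_product split_def)
  finally show ?thesis by simp
qed

context monomial_element
begin

text \<open>The first line says that \<open>z\<close> is a symmetric matrix, the second that congruence by \<open>(a, \<pi>)\<close> fixes it.\<close>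

definition fixed_eq :: "(nat \<Rightarrow> 'a \<times> nat) \<Rightarrow> nat \<Rightarrow> bool" where
  "fixed_eq z i \<longleftrightarrow> snd (z (snd (z i))) = i \<and> fst (z (snd (z i))) = fst (z i) \<and>
     snd (z (\<pi> i)) = \<pi> (snd (z i)) \<and> fst (z (\<pi> i)) = a i \<otimes> a (snd (z i)) \<otimes> fst (z i)"

text \<open>The equation \<open>u \<otimes> \<tau> u = (a, \<pi>)\<close> at the point \<open>i\<close>, with the inverse coefficient moved to the right.\<close>

definition root_eq :: "(nat \<Rightarrow> 'a \<times> nat) \<Rightarrow> nat \<Rightarrow> bool" where
  "root_eq z i \<longleftrightarrow> snd (z (snd (z i))) = \<pi> i \<and> fst (z (snd (z i))) = a i \<otimes> fst (z i)"

text \<open>The sign of a fixed symmetric matrix as a product over points. The sign of an exchanged pair is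
  charged to its smaller point.\<close>

definition wt :: "nat \<Rightarrow> 'a \<times> nat \<Rightarrow> complex" where
  "wt i y = (if snd y = i then sgA (a i) (fst y) else if i < snd y \<and> \<pi> (snd y) < \<pi> i then - 1 else 1)"

abbreviation "fixed_sols \<equiv> solutions (carrier A) fixed_eq"
abbreviation "root_sols \<equiv> solutions (carrier A) root_eq"

definition pi_stable :: "nat set \<Rightarrow> bool" where "pi_stable S \<longleftrightarrow> S \<subseteq> S0 \<and> (\<forall>i\<in>S. \<pi> i \<in> S)"

lemma stable_pi: assumes "pi_stable S" shows "\<pi> i \<in> S \<longleftrightarrow> i \<in> S"
proof
  assume i: "\<pi> i \<in> S"
  have "cyc (\<pi> i) \<subseteq> S" using assms i unfolding pi_stable_def by (intro cyc_subset) auto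
  moreover have "i \<in> cyc (\<pi> i)" using pi_cyc[of i "\<pi> i"] by simp
  ultimately show "i \<in> S" by blast
qed (use assms in \<open>auto simp: pi_stable_def\<close>)

lemma stable_cyc: "i \<in> S0 \<Longrightarrow> pi_stable (cyc i)"
  unfolding pi_stable_def using cyc_subset[of S0 i] permutes_in_image[OF perm] by (auto simp: pi_cyc)

lemma stable_Un: "pi_stable S \<Longrightarrow> pi_stable T \<Longrightarrow> pi_stable (S \<union> T)" by (auto simp: pi_stable_def)
lemma stable_Diff: "pi_stable S \<Longrightarrow> pi_stable T \<Longrightarrow> pi_stable (S - T)" using stable_pi[of T] by (auto simp: pi_stable_def)
lemma stable_finite: "pi_stable S \<Longrightarrow> finite S" using finite_S0 finite_subset by (auto simp: pi_stable_def)

lemma solsD: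
  assumes "z \<in> solutions (carrier A) Q S" "i \<in> S"
  shows "fst (z i) \<in> carrier A" "snd (z i) \<in> S" "Q z i"
  using assms unfolding solutions_def by (auto simp: PiE_iff mem_Times_iff)

lemma fixed_sols_p:
  assumes z: "z \<in> fixed_sols S" and S: "pi_stable S" "i \<in> S"
  shows "snd (z (p i k)) = p (snd (z i)) k"
proof (induction k)
  case (Suc k)
  have "p i k \<in> S" using cyc_subset[of S i] S p_in_cyc[of i k] by (auto simp: pi_stable_def)
  then show ?case using solsD(3)[OF z] Suc by (simp add: p_Suc fixed_eq_def)
qed simp

lemma root_sols_p:
  assumes z: "z \<in> root_sols S" and S: "pi_stable S" "i \<in> S"
  shows "snd (z (p i k)) = p (snd (z i)) k"
proof (induction k)
  case (Suc k)
  have i: "p i k \<in> S" using cyc_subset[of S i] S p_in_cyc[of i k] by (auto simp: pi_stable_def)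
  have "snd (z (\<pi> (p i k))) = \<pi> (snd (z (p i k)))"
    using solsD[OF z i] solsD[OF z solsD(2)[OF z i]] by (simp add: root_eq_def)
  then show ?case using Suc by (simp add: p_Suc)
qed simp

text \<open>The permutation of a solution commutes with \<open>\<pi>\<close>, so it permutes the cycles; being an involution, it can
  only fix the cycle of \<open>i0\<close> or exchange it with another one.\<close>

lemma fixed_stable:
  assumes z: "z \<in> fixed_sols S" and S: "pi_stable S" "i0 \<in> S" and U: "U = cyc i0 \<union> cyc (snd (z i0))" and i: "i \<in> S"
  shows "snd (z i) \<in> U \<longleftrightarrow> i \<in> U"
proof -
  have j: "snd (z i0) \<in> S" "snd (z (snd (z i0))) = i0"
    using solsD[OF z S(2)] by (auto simp: fixed_eq_def)
  have fwd: "snd (z k) \<in> U" if k: "k \<in> U" for k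
  proof -
    obtain l where "k = p i0 l \<or> k = p (snd (z i0)) l" using k unfolding U cyc_def by blast
    then show ?thesis using fixed_sols_p[OF z S, of l] fixed_sols_p[OF z S(1) j(1), of l] j(2) unfolding U by auto
  qed
  show ?thesis using fwd[of i] fwd[of "snd (z i)"] solsD(3)[OF z i] by (auto simp: fixed_eq_def)
qed

text \<open>The square of the permutation of a solution is \<open>\<pi>\<close>, which preserves every cycle.\<close>

lemma root_stable:
  assumes z: "z \<in> root_sols S" and S: "pi_stable S" "i0 \<in> S" and U: "U = cyc i0 \<union> cyc (snd (z i0))" and i: "i \<in> S"
  shows "snd (z i) \<in> U \<longleftrightarrow> i \<in> U"
proof -
  have j: "snd (z i0) \<in> S" "snd (z (snd (z i0))) = \<pi> i0"
    using solsD[OF z S(2)] by (auto simp: root_eq_def)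
  have fwd: "snd (z k) \<in> U" if k: "k \<in> U" for k
  proof -
    obtain l where "k = p i0 l \<or> k = p (snd (z i0)) l" using k unfolding U cyc_def by blast
    then show ?thesis using root_sols_p[OF z S, of l] root_sols_p[OF z S(1) j(1), of l] j(2) unfolding U
      by (auto simp: p_pi pi_cyc)
  qed
  show ?thesis using fwd[of i] fwd[of "snd (z i)"] solsD(3)[OF z i] by (auto simp: root_eq_def U pi_cyc)
qed

lemma fixed_eq_local:
  assumes "pi_stable V" "\<And>k. k \<in> V \<Longrightarrow> z k = z' k" "i \<in> V" "snd (z i) \<in> V" shows "fixed_eq z i = fixed_eq z' i"
  using assms stable_pi[OF assms(1)] unfolding fixed_eq_def by (metis (no_types, lifting))

lemma root_eq_local:
  assumes "\<And>k. k \<in> V \<Longrightarrow> z k = z' k" "i \<in> V" "snd (z i) \<in> V" shows "root_eq z i = root_eq z' i"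
  using assms unfolding root_eq_def by (metis (no_types, lifting))

definition "orbit_pair i j = cyc i \<union> cyc j"

lemma fixed_split:
  assumes S: "pi_stable S" "i \<in> S" "j \<in> S"
  shows "(\<Sum>z | z \<in> fixed_sols S \<and> snd (z i) = j. \<Prod>k\<in>S. wt k (z k)) =
    (\<Sum>z | z \<in> fixed_sols (orbit_pair i j) \<and> snd (z i) = j. \<Prod>k\<in>orbit_pair i j. wt k (z k)) *
    (\<Sum>z\<in>fixed_sols (S - orbit_pair i j). \<Prod>k\<in>S - orbit_pair i j. wt k (z k))"
proof (rule sum_solutions_split)
  have sub: "i \<in> S0" "j \<in> S0" using S by (auto simp: pi_stable_def)
  have U: "pi_stable (orbit_pair i j)" unfolding orbit_pair_def by (intro stable_Un stable_cyc sub)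
  show "orbit_pair i j \<subseteq> S" unfolding orbit_pair_def using S cyc_subset[of S] by (auto simp: pi_stable_def)
  show "fixed_eq z k = fixed_eq z' k" if "V \<in> {orbit_pair i j, S - orbit_pair i j}" "\<And>k. k \<in> V \<Longrightarrow> z k = z' k" "k \<in> V" "snd (z k) \<in> V"
    for V z z' k using fixed_eq_local[of V z z' k] that U stable_Diff[OF S(1) U] by blast
  show "snd (z k) \<in> orbit_pair i j \<longleftrightarrow> k \<in> orbit_pair i j" if "z \<in> fixed_sols S" "snd (z i) = j" "k \<in> S" for z k
    using fixed_stable[OF that(1) S(1,2) _ that(3)] that(2) by (simp add: orbit_pair_def)
qed (use stable_finite[OF S(1)] finite_A in \<open>auto simp: orbit_pair_def\<close>)

lemma root_split:
  assumes S: "pi_stable S" "i \<in> S" "j \<in> S"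
  shows "of_nat (card {z. z \<in> root_sols S \<and> snd (z i) = j}) =
    (of_nat (card {z. z \<in> root_sols (orbit_pair i j) \<and> snd (z i) = j}) *
    of_nat (card (root_sols (S - orbit_pair i j))) :: complex)"
proof -
  have sub: "i \<in> S0" "j \<in> S0" using S by (auto simp: pi_stable_def)
  have "(\<Sum>z | z \<in> root_sols S \<and> snd (z i) = j. \<Prod>k\<in>S. (\<lambda>_ _. 1 :: complex) k (z k)) =
    (\<Sum>z | z \<in> root_sols (orbit_pair i j) \<and> snd (z i) = j. \<Prod>k\<in>orbit_pair i j. (\<lambda>_ _. 1) k (z k)) *
    (\<Sum>z\<in>root_sols (S - orbit_pair i j). \<Prod>k\<in>S - orbit_pair i j. (\<lambda>_ _. 1) k (z k))"
  proof (rule sum_solutions_split)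
    show "orbit_pair i j \<subseteq> S" unfolding orbit_pair_def using S cyc_subset[of S] by (auto simp: pi_stable_def)
    show "root_eq z k = root_eq z' k" if "V \<in> {orbit_pair i j, S - orbit_pair i j}" "\<And>k. k \<in> V \<Longrightarrow> z k = z' k" "k \<in> V" "snd (z k) \<in> V"
      for V z z' k by (rule root_eq_local[of V z z' k, OF that(2-4)])
    show "snd (z k) \<in> orbit_pair i j \<longleftrightarrow> k \<in> orbit_pair i j" if "z \<in> root_sols S" "snd (z i) = j" "k \<in> S" for z k
      using root_stable[OF that(1) S(1,2) _ that(3)] that(2) by (simp add: orbit_pair_def)
  qed (use stable_finite[OF S(1)] finite_A in \<open>auto simp: orbit_pair_def\<close>)
  then show ?thesis by simp
qed

lemma cyc_elim:
  assumes "j \<in> cyc i" obtains k where "k < period i" "j = p i k"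
  using assms bij_betw_cyc[of i] unfolding bij_betw_def by auto

lemma p_shift_in_cyc: "j \<in> cyc i \<Longrightarrow> p j l \<in> cyc i"
  unfolding cyc_def by (auto simp: p_add[symmetric])

lemma cyc_sub_S0: "i \<in> S0 \<Longrightarrow> cyc i \<subseteq> S0"
  using stable_cyc[of i] by (simp add: pi_stable_def)

lemma a_cyc: "i \<in> S0 \<Longrightarrow> j \<in> cyc i \<Longrightarrow> a j \<in> carrier A"
  using cyc_sub_S0 a_closed by blast

lemma prod_cyc: "(\<Prod>j\<in>cyc i. f j) = (\<Prod>k<period i. f (p i k))" for f :: "nat \<Rightarrow> complex"
  by (rule prod.reindex_bij_betw[OF bij_betw_cyc, symmetric])

text \<open>A solution preserving a single cycle acts on it as a power of \<open>\<pi>\<close>, say with exponent \<open>K\<close>; only its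
  coefficients \<open>x\<close> remain free.\<close>

lemma shifted_sols:
  assumes "bij_betw (\<lambda>x. \<lambda>j\<in>cyc i. (x j, p j K)) X Z"
  shows "(\<Sum>z\<in>Z. \<Prod>j\<in>cyc i. wt j (z j)) = (\<Sum>x\<in>X. \<Prod>j\<in>cyc i. wt j (x j, p j K))"
proof -
  have "(\<Sum>z\<in>Z. \<Prod>j\<in>cyc i. wt j (z j)) = (\<Sum>x\<in>X. \<Prod>j\<in>cyc i. wt j ((\<lambda>j\<in>cyc i. (x j, p j K)) j))"
    by (rule sum.reindex_bij_betw[OF assms, symmetric])
  then show ?thesis by simp
qed

lemma bij_betw_shifted_sols:
  assumes i: "i \<in> S0" and Q: "\<And>z j. z \<in> solutions (carrier A) Q (cyc i) \<Longrightarrow> snd (z i) = p i K \<Longrightarrow>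
      j \<in> cyc i \<Longrightarrow> snd (z j) = p j K"
    and eq: "\<And>x j. x \<in> cyc i \<rightarrow>\<^sub>E carrier A \<Longrightarrow> j \<in> cyc i \<Longrightarrow> Q (\<lambda>j\<in>cyc i. (x j, p j K)) j \<longleftrightarrow> E x j"
  shows "bij_betw (\<lambda>x. \<lambda>j\<in>cyc i. (x j, p j K)) {x \<in> cyc i \<rightarrow>\<^sub>E carrier A. \<forall>j\<in>cyc i. E x j}
    {z \<in> solutions (carrier A) Q (cyc i). snd (z i) = p i K}"
proof (rule bij_betw_byWitness[where f' = "\<lambda>z. \<lambda>j\<in>cyc i. fst (z j)"])
  let ?F = "\<lambda>x. \<lambda>j\<in>cyc i. (x j, p j K)" and ?G = "\<lambda>z. \<lambda>j\<in>cyc i. fst (z j)"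
  let ?X = "{x \<in> cyc i \<rightarrow>\<^sub>E carrier A. \<forall>j\<in>cyc i. E x j}"
    and ?Z = "{z \<in> solutions (carrier A) Q (cyc i). snd (z i) = p i K}"
  show "\<forall>x\<in>?X. ?G (?F x) = x"
    by (auto simp: PiE_def extensional_def restrict_def fun_eq_iff)
  have FG: "?F (?G z) = z" if z: "z \<in> ?Z" for z
  proof
    fix j show "?F (?G z) j = z j"
    proof (cases "j \<in> cyc i")
      case True
      then show ?thesis using Q[of z j] z by (auto simp: prod_eq_iff)
    next
      case False
      then show ?thesis using z by (auto simp: solutions_def PiE_def extensional_def)
    qed
  qed
  then show "\<forall>z\<in>?Z. ?F (?G z) = z" by blast
  show "?F ` ?X \<subseteq> ?Z"
  proof (intro image_subsetI)
    fix x assume x: "x \<in> ?X"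
    then have "\<forall>j\<in>cyc i. Q (?F x) j" using eq[of x] by blast
    then show "?F x \<in> ?Z" using x unfolding solutions_def by (auto simp: p_shift_in_cyc)
  qed
  show "?G ` ?Z \<subseteq> ?X"
  proof (intro image_subsetI)
    fix z assume z: "z \<in> ?Z"
    have G: "?G z \<in> cyc i \<rightarrow>\<^sub>E carrier A" using z unfolding solutions_def by (auto simp: PiE_iff mem_Times_iff)
    have "E (?G z) j" if j: "j \<in> cyc i" for j
    proof -
      have "Q (?F (?G z)) j" unfolding FG[OF z] using z j unfolding solutions_def by blast
      then show ?thesis using eq[OF G j] by blast
    qed
    with G show "?G z \<in> ?X" by blast
  qed
qed

lemma fixed_shift:
  assumes i: "i \<in> S0" and z: "z \<in> fixed_sols (cyc i)" "snd (z i) = p i K" and j: "j \<in> cyc i"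
  shows "snd (z j) = p j K"
proof -
  obtain l where l: "j = p i l" using j unfolding cyc_def by blast
  have "snd (z j) = p (p i K) l" using fixed_sols_p[OF z(1) stable_cyc[OF i], of i l] z(2) l by simp
  then show ?thesis unfolding l p_add[symmetric] by (simp add: add.commute)
qed

lemma root_shift:
  assumes i: "i \<in> S0" and z: "z \<in> root_sols (cyc i)" "snd (z i) = p i K" and j: "j \<in> cyc i"
  shows "snd (z j) = p j K"
proof -
  obtain l where l: "j = p i l" using j unfolding cyc_def by blast
  have "snd (z j) = p (p i K) l" using root_sols_p[OF z(1) stable_cyc[OF i], of i l] z(2) l by simp
  then show ?thesis unfolding l p_add[symmetric] by (simp add: add.commute)
qed

lemma p_periodic: "j \<in> cyc i \<Longrightarrow> p j (period i) = j"
  unfolding cyc_def by (auto simp: p_add[symmetric] p_eq_iff)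

text \<open>Contribution of the involution that fixes the cycle pointwise. By the cocycle rule the signs along the
  cycle multiply to the sign of \<open>cycle_prod i\<close> at the coefficient of \<open>i\<close>, and that coefficient is arbitrary
  if \<open>cycle_prod i\<close> has square \<open>\<one>\<close>; otherwise there is no solution.\<close>

lemma fixed_cycle_identity:
  assumes i: "i \<in> S0"
  shows "(\<Sum>z | z \<in> fixed_sols (cyc i) \<and> snd (z i) = i. \<Prod>j\<in>cyc i. wt j (z j)) =
    (if cycle_prod i = \<one> then of_nat (card (carrier A)) else 0)"
proof -
  let ?X = "{x \<in> cyc i \<rightarrow>\<^sub>E carrier A. \<forall>j\<in>cyc i. x (\<pi> j) = (a j \<otimes> a j) \<otimes> x j}"
  have "bij_betw (\<lambda>x. \<lambda>j\<in>cyc i. (x j, p j 0)) ?X {z \<in> fixed_sols (cyc i). snd (z i) = p i 0}"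
    using fixed_shift[OF i, of _ 0]
    by (intro bij_betw_shifted_sols[where Q = fixed_eq, OF i]) (auto simp: fixed_eq_def pi_cyc)
  from shifted_sols[OF this]
  have "(\<Sum>z | z \<in> fixed_sols (cyc i) \<and> snd (z i) = i. \<Prod>j\<in>cyc i. wt j (z j)) =
      (\<Sum>x\<in>?X. \<Prod>j\<in>cyc i. sgA (a j) (x j))" by (simp add: wt_def)
  also have "\<dots> = (\<Sum>x\<in>?X. sgA (cycle_prod i) (x i))"
  proof (rule sum.cong[OF refl])
    fix x assume x: "x \<in> ?X"
    have xp: "x (p i l) = path_prod (\<lambda>l. a (p i l) \<otimes> a (p i l)) l \<otimes> x i" for l
      by (rule lift_values[where h = "\<lambda>j. a j \<otimes> a j"]) (use x i in auto)
    have xi: "x i \<in> carrier A" using x by auto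
    have "(\<Prod>l<m. sgA (a (p i l)) (x (p i l))) = sgA (path_prod (\<lambda>l. a (p i l)) m) (x i)" for m
    proof (induction m)
      case 0
      have "sgA (\<one> \<otimes> \<one>) (x i) = sgA \<one> (\<one> \<otimes> \<one> \<otimes> x i) * sgA \<one> (x i)"
        by (rule sign_cocycle) (use xi in auto)
      then have "sgA \<one> (x i) = sgA \<one> (x i) * sgA \<one> (x i)" using xi by simp
      then show ?case using sign_pm1[of \<one> "x i"] xi by auto
    next
      case (Suc m)
      have "x (p i m) = path_prod (\<lambda>l. a (p i l)) m \<otimes> path_prod (\<lambda>l. a (p i l)) m \<otimes> x i"
        unfolding xp by (subst path_prod_mult) (use i in auto)
      then show ?case using i xi by (simp add: Suc path_prod_Suc sign_cocycle)
    qed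
    then show "(\<Prod>j\<in>cyc i. sgA (a j) (x j)) = sgA (cycle_prod i) (x i)" by (simp add: prod_cyc cycle_prod_def)
  qed
  also have "\<dots> = (if cycle_prod i = \<one> then of_nat (card (carrier A)) else 0)"
  proof (cases "cycle_prod i \<otimes> cycle_prod i = \<one>")
    case False
    have "?X = {}"
    proof (rule ccontr)
      assume "?X \<noteq> {}"
      then obtain x where x: "x \<in> ?X" by blast
      have "x (p i (period i)) = path_prod (\<lambda>l. a (p i l) \<otimes> a (p i l)) (period i) \<otimes> x i"
        by (rule lift_values[where h = "\<lambda>j. a j \<otimes> a j"]) (use x i in auto)
      moreover have "path_prod (\<lambda>l. a (p i l) \<otimes> a (p i l)) (period i) = cycle_prod i \<otimes> cycle_prod i" using path_prod_square[OF i, of 0] by simp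
      moreover have "x i \<in> carrier A" using x by auto
      ultimately have "cycle_prod i \<otimes> cycle_prod i = \<one>" using period_props[of i] i by simp
      with False show False by simp
    qed
    moreover have "cycle_prod i \<noteq> \<one>" using False by auto
    ultimately show ?thesis by (simp only: sum.empty if_False)
  next
    case True
    have "bij_betw (\<lambda>x. x i) ?X (carrier A)"
      by (rule bij_betw_lift[where h = "\<lambda>j. a j \<otimes> a j"]) (use path_prod_square[OF i, of 0] True i in auto)
    then have "(\<Sum>x\<in>?X. sgA (cycle_prod i) (x i)) = (\<Sum>x\<in>carrier A. sgA (cycle_prod i) x)"
      by (rule sum.reindex_bij_betw)
    also have "\<dots> = (if cycle_prod i = \<one> then of_nat (card (carrier A)) else 0)"
      by (rule sign_sum) (use i True in auto)
    finally show ?thesis .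
  qed
  finally show ?thesis .
qed

text \<open>The two weights of an exchanged pair together compare the order of the pair with the order of its image
  under \<open>\<pi>\<close>. Such factors telescope along a cycle.\<close>

lemma wt_pair:
  assumes "i \<noteq> j"
  shows "wt i (x, j) * wt j (y, i) = (if i < j then 1 else - 1) * (if \<pi> i < \<pi> j then 1 else - 1)"
  using assms pi_inj[of i j] by (auto simp: wt_def)

lemma prod_lessThan_add:
  "(\<Prod>l<m + n. f l) = (\<Prod>l<m. f l) * (\<Prod>l<n. f (l + m))" for f :: "nat \<Rightarrow> complex"
  by (induction n) (simp_all add: mult.assoc add.commute)

text \<open>After half the cycle the two points of a pair have changed places, so the orders compared by
  \<open>wt_pair\<close> have changed an odd number of times and the sign is \<open>- 1\<close>.\<close>

lemma fixed_cycle_half_turn: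
  assumes i: "i \<in> S0" and K: "period i = K + K"
  shows "(\<Sum>z | z \<in> fixed_sols (cyc i) \<and> snd (z i) = p i K. \<Prod>j\<in>cyc i. wt j (z j)) =
    - (if cycle_prod i = \<one> then of_nat (card (carrier A)) else 0)"
proof -
  let ?X = "{x \<in> cyc i \<rightarrow>\<^sub>E carrier A. \<forall>j\<in>cyc i. x (\<pi> j) = a j \<otimes> a (p j K) \<otimes> x j \<and> x (p j K) = \<one> \<otimes> x j}"
  have K0: "K > 0" using period_props[of i] K by simp
  have KK: "p j (K + K) = j" if "j \<in> cyc i" for j using p_periodic[OF that] K by simp
  have "bij_betw (\<lambda>x. \<lambda>j\<in>cyc i. (x j, p j K)) ?X {z \<in> fixed_sols (cyc i). snd (z i) = p i K}"
  proof (rule bij_betw_shifted_sols[where Q = fixed_eq, OF i])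
    show "snd (z j) = p j K" if "z \<in> fixed_sols (cyc i)" "snd (z i) = p i K" "j \<in> cyc i" for z j
      by (rule fixed_shift[OF i that])
  next
    fix x j assume x: "x \<in> cyc i \<rightarrow>\<^sub>E carrier A" and j: "j \<in> cyc i"
    have "p (p j K) K = j" using KK[OF j] by (simp add: p_add)
    then show "fixed_eq (\<lambda>j\<in>cyc i. (x j, p j K)) j \<longleftrightarrow> x (\<pi> j) = a j \<otimes> a (p j K) \<otimes> x j \<and> x (p j K) = \<one> \<otimes> x j"
      using j x PiE_mem[OF x j] by (auto simp: fixed_eq_def pi_cyc p_shift_in_cyc p_pi)
  qed
  from shifted_sols[OF this]
  have "(\<Sum>z | z \<in> fixed_sols (cyc i) \<and> snd (z i) = p i K. \<Prod>j\<in>cyc i. wt j (z j)) =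
      (\<Sum>x\<in>?X. \<Prod>j\<in>cyc i. wt j (x j, p j K))" by simp
  also have "\<dots> = (\<Sum>x\<in>?X. - 1)"
  proof (rule sum.cong[OF refl])
    fix x assume x: "x \<in> ?X"
    let ?o = "\<lambda>l. if p i l < p i (l + K) then 1 else - 1 :: complex"
    have ne: "p i l \<noteq> p i (l + K)" for l
      using K0 K by (metis KK add_diff_cancel_left' p_add p_inj p_periodic period_minimal less_add_same_cancel1 p_0 self_in_cyc add.commute)
    have "(\<Prod>j\<in>cyc i. wt j (x j, p j K)) = (\<Prod>l<K + K. wt (p i l) (x (p i l), p i (l + K)))"
      by (simp add: prod_cyc K p_add)
    also have "\<dots> = (\<Prod>l<K. wt (p i l) (x (p i l), p i (l + K))) * (\<Prod>l<K. wt (p i (l + K)) (x (p i (l + K)), p i (l + K + K)))"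
      by (rule prod_lessThan_add)
    also have "\<dots> = (\<Prod>l<K. wt (p i l) (x (p i l), p i (l + K)) * wt (p i (l + K)) (x (p i (l + K)), p i l))"
      using KK by (simp add: prod.distrib p_add)
    also have "\<dots> = (\<Prod>l<K. ?o l * ?o (Suc l))"
      by (intro prod.cong refl) (simp add: wt_pair[OF ne] p_Suc)
    also have "\<dots> = ?o 0 * ?o K"
    proof -
      have "(\<Prod>l<m. ?o l * ?o (Suc l)) = ?o 0 * ?o m" for m by (induction m) auto
      then show ?thesis .
    qed
    also have "\<dots> = - 1"
      using ne[of 0] K by (auto simp: p_periodic[of i i, unfolded K])
    finally show "(\<Prod>j\<in>cyc i. wt j (x j, p j K)) = - 1" .
  qed
  also have "\<dots> = - of_nat (card ?X)" by simp
  also have "card ?X = (if cycle_prod i = \<one> then card (carrier A) else 0)"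
  proof (rule card_twisted_lifts[OF i])
    have "path_prod (\<lambda>k. a (p i k)) (K + K) = cycle_prod i" by (simp add: cycle_prod_def K)
    then show "path_prod (\<lambda>k. a (p i k)) (K + K) = cycle_prod i \<otimes> \<one>" using i by simp
  qed (use KK a_cyc[OF i] in auto)
  finally show ?thesis by auto
qed

text \<open>A square root of a cycle of odd length \<open>m\<close> is its power with exponent \<open>(m + 1) / 2\<close>.\<close>

lemma root_cycle_card:
  assumes i: "i \<in> S0" and K: "Suc (period i) = K + K"
  shows "card {z \<in> root_sols (cyc i). snd (z i) = p i K} = (if cycle_prod i = \<one> then card (carrier A) else 0)"
proof -
  let ?X = "{x \<in> cyc i \<rightarrow>\<^sub>E carrier A. \<forall>j\<in>cyc i. x (\<pi> j) = a j \<otimes> a (p j K) \<otimes> x j \<and> x (p j K) = a j \<otimes> x j}"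
  let ?Y = "{x \<in> cyc i \<rightarrow>\<^sub>E carrier A. \<forall>j\<in>cyc i. x (p j K) = a j \<otimes> x j}"
  have KK: "p j (K + K) = \<pi> j" if "j \<in> cyc i" for j using p_periodic[OF that] unfolding K[symmetric] by (simp add: p_Suc)
  have "bij_betw (\<lambda>x. \<lambda>j\<in>cyc i. (x j, p j K)) ?Y {z \<in> root_sols (cyc i). snd (z i) = p i K}"
  proof (rule bij_betw_shifted_sols[where Q = root_eq, OF i])
    show "snd (z j) = p j K" if "z \<in> root_sols (cyc i)" "snd (z i) = p i K" "j \<in> cyc i" for z j
      by (rule root_shift[OF i that])
  next
    fix x j assume x: "x \<in> cyc i \<rightarrow>\<^sub>E carrier A" and j: "j \<in> cyc i"
    have "p (p j K) K = \<pi> j" using KK[OF j] by (simp add: p_add)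
    then show "root_eq (\<lambda>j\<in>cyc i. (x j, p j K)) j \<longleftrightarrow> x (p j K) = a j \<otimes> x j"
      using j x by (auto simp: root_eq_def p_shift_in_cyc)
  qed
  then have "card {z \<in> root_sols (cyc i). snd (z i) = p i K} = card ?Y" by (simp add: bij_betw_same_card)
  also have "?Y = ?X"
  proof -
    have "x (\<pi> j) = a j \<otimes> a (p j K) \<otimes> x j" if x: "x \<in> ?Y" and j: "j \<in> cyc i" for x j
    proof -
      have step: "x (p k K) = a k \<otimes> x k" if "k \<in> cyc i" for k using x that by blast
      have "x (\<pi> j) = a (p j K) \<otimes> (a j \<otimes> x j)"
        using step[OF p_shift_in_cyc[OF j, of K]] step[OF j] KK[OF j] unfolding p_add by simp
      moreover have "x j \<in> carrier A" using x j by auto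
      ultimately show ?thesis using a_cyc[OF i] j p_shift_in_cyc[OF j, of K] by (simp add: m_ac)
    qed
    then show ?thesis by blast
  qed
  also have "card ?X = (if cycle_prod i = \<one> then card (carrier A) else 0)"
  proof (rule card_twisted_lifts[OF i])
    have "path_prod (\<lambda>k. a (p i k)) (Suc (period i)) = a i \<otimes> cycle_prod i"
      using i period_props[of i] by (subst path_prod_Suc) (simp_all add: cycle_prod_def)
    then show "path_prod (\<lambda>k. a (p i k)) (K + K) = cycle_prod i \<otimes> a i"
      using i a_closed[OF i] by (simp add: K m_comm)
  qed (use KK a_cyc[OF i] in \<open>auto simp: pi_cyc\<close>)
  finally show ?thesis .
qed

text \<open>Only involutions of the cycle that commute with it count, that is, the identity and the half turn; the
  identity is matched with the square roots if the length is odd, and cancels with the half turn if it is even.\<close>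

lemma cycle_identity:
  assumes i: "i \<in> S0"
  shows "(\<Sum>z\<in>fixed_sols (cyc i). \<Prod>j\<in>cyc i. wt j (z j)) = of_nat (card (root_sols (cyc i)))"
proof -
  let ?Z = "fixed_sols (cyc i)" and ?w = "\<lambda>z. \<Prod>j\<in>cyc i. wt j (z j)"
  have finZ: "finite ?Z" "finite (root_sols (cyc i))" by (intro finite_solutions finite_A finite_cyc)+
  have m: "period i > 0" using period_props by blast
  have fixedK: "K = 0 \<or> K + K = period i" if z: "z \<in> ?Z" and K: "K < period i" "snd (z i) = p i K" for z K
  proof -
    have "p i (K + K) = i"
      using solsD(3)[OF z self_in_cyc] fixed_shift[OF i z K(2), of "p i K"] K by (simp add: fixed_eq_def p_add)
    then have "(K + K) mod period i = 0" using p_eq_iff[of i "K + K" 0] by simp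
    then obtain t where t: "K + K = period i * t" by auto
    then have "t < 2" using K(1) m by (metis add_less_mono mult_2_right mult_less_cancel1 mult_numeral_1_right not_less_iff_gr_or_eq)
    then show ?thesis using t by (cases t) auto
  qed
  have rootK: "K + K = period i + 1 \<or> (period i = 1)" if z: "z \<in> root_sols (cyc i)" and K: "K < period i" "snd (z i) = p i K" for z K
  proof -
    have "p i (K + K) = p i 1"
      using solsD(3)[OF z self_in_cyc] root_shift[OF i z K(2), of "p i K"] K by (simp add: root_eq_def p_add p_Suc)
    then have "(K + K) mod period i = 1 mod period i" using p_eq_iff by blast
    then have eq: "(K + K) mod period i = 1" if "period i \<noteq> 1" using that m by (simp add: mod_less)
    show ?thesis
    proof (cases "K + K < period i")
      case True
      then show ?thesis using eq by (metis mod_less odd_one odd_add)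
    next
      case False
      then have "(K + K) mod period i = K + K - period i" using K(1) by (simp add: le_mod_geq)
      then show ?thesis using eq False by linarith
    qed
  qed
  have snd_ex: "\<exists>K<period i. snd (z i) = p i K" if "z \<in> solutions (carrier A) Q (cyc i)" for z Q
    using solsD(2)[OF that self_in_cyc] by (metis cyc_elim)
  show ?thesis
  proof (cases "even (period i)")
    case True
    then obtain K where K: "period i = K + K" by (metis evenE mult_2)
    have Kpos: "0 < K" "K < period i" using K m by auto
    have "?Z = {z. z \<in> ?Z \<and> snd (z i) = i} \<union> {z. z \<in> ?Z \<and> snd (z i) = p i K}"
    proof -
      have "snd (z i) = i \<or> snd (z i) = p i K" if z: "z \<in> ?Z" for z
      proof -
        obtain k where k: "k < period i" "snd (z i) = p i k" using snd_ex[OF z] by blast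
        then have "k = 0 \<or> k = K" using fixedK[OF z k] K by auto
        then show ?thesis using k by auto
      qed
      then show ?thesis by blast
    qed
    moreover have "{z. z \<in> ?Z \<and> snd (z i) = i} \<inter> {z. z \<in> ?Z \<and> snd (z i) = p i K} = {}"
      using period_minimal[OF Kpos] by auto
    ultimately have "sum ?w ?Z = (\<Sum>z | z \<in> ?Z \<and> snd (z i) = i. ?w z) + (\<Sum>z | z \<in> ?Z \<and> snd (z i) = p i K. ?w z)"
      using finZ by (metis (no_types, lifting) finite_Un sum.union_disjoint)
    also have "\<dots> = 0" by (simp add: fixed_cycle_identity[OF i] fixed_cycle_half_turn[OF i K])
    finally have "sum ?w ?Z = 0" .
    moreover have "root_sols (cyc i) = {}"
    proof -
      have False if z: "z \<in> root_sols (cyc i)" for z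
      proof -
        obtain k where "k < period i" "snd (z i) = p i k" using snd_ex[OF z] by blast
        from rootK[OF z this] True show False by presburger
      qed
      then show ?thesis by blast
    qed
    ultimately show ?thesis by simp
  next
    case False
    then obtain K where K: "Suc (period i) = K + K" by (metis even_Suc evenE mult_2)
    have "?Z = {z. z \<in> ?Z \<and> snd (z i) = i}"
    proof -
      have "snd (z i) = i" if z: "z \<in> ?Z" for z
      proof -
        obtain k where k: "k < period i" "snd (z i) = p i k" using snd_ex[OF z] by blast
        then have "k = 0" using fixedK[OF z k] False by presburger
        then show ?thesis using k by auto
      qed
      then show ?thesis by blast
    qed
    then have "sum ?w ?Z = (if cycle_prod i = \<one> then of_nat (card (carrier A)) else 0)"
      using fixed_cycle_identity[OF i] by simp
    moreover have "root_sols (cyc i) = {z \<in> root_sols (cyc i). snd (z i) = p i K}"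
    proof -
      have "snd (z i) = p i K" if z: "z \<in> root_sols (cyc i)" for z
      proof -
        obtain k where k: "k < period i" "snd (z i) = p i k" using snd_ex[OF z] by blast
        have "p i k = p i K"
          using rootK[OF z k] K k(1) by (auto simp: p_eq_iff)
        then show ?thesis using k by simp
      qed
      then show ?thesis by blast
    qed
    ultimately show ?thesis using root_cycle_card[OF i K] by simp
  qed
qed

text \<open>If an involution exchanges two cycles, its square-root counterpart is the involution on the
  first cycle and the involution followed by \<open>\<pi>\<close> on the second. The sign is \<open>1\<close> because by \<open>wt_pair\<close> every
  order comparison along the first cycle occurs twice.\<close>

lemma swapped_cycles_identity:
  assumes ij: "i \<in> S0" "j \<in> S0" and j: "j \<notin> cyc i"
  shows "(\<Sum>z | z \<in> fixed_sols (orbit_pair i j) \<and> snd (z i) = j. \<Prod>k\<in>orbit_pair i j. wt k (z k)) =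
    of_nat (card {z. z \<in> root_sols (orbit_pair i j) \<and> snd (z i) = j})"
proof -
  define U where "U = orbit_pair i j"
  let ?c = "cyc i" and ?d = "cyc j"
  have U: "U = ?c \<union> ?d" and disj: "?c \<inter> ?d = {}"
    using cyc_disjoint[OF j] by (auto simp: U_def orbit_pair_def)
  have stU: "pi_stable U" unfolding U by (intro stable_Un stable_cyc ij)
  have piU: "\<pi> k \<in> U \<longleftrightarrow> k \<in> U" for k by (rule stable_pi[OF stU])
  have iU: "i \<in> U" and jU: "j \<in> U" by (auto simp: U)
  have aU: "a k \<in> carrier A" if "k \<in> U" for k using that stU a_closed by (auto simp: pi_stable_def)
  let ?Z = "{z. z \<in> fixed_sols U \<and> snd (z i) = j}" and ?Y = "{z. z \<in> root_sols U \<and> snd (z i) = j}"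
  \<comment> \<open>\<open>?F\<close> multiplies by \<open>(a, \<pi>)\<close> on the second cycle; \<open>?G\<close> undoes this, \<open>?q z k\<close> being the preimage of
    \<open>snd (z k)\<close> under \<open>\<pi>\<close>.\<close>
  let ?F = "\<lambda>z. \<lambda>k\<in>U. if k \<in> ?c then z k else (a (snd (z k)) \<otimes> fst (z k), \<pi> (snd (z k)))"
  let ?q = "\<lambda>z k. inv_into UNIV \<pi> (snd (z k))"
  let ?G = "\<lambda>z. \<lambda>k\<in>U. if k \<in> ?c then z k else (fst (z (?q z k)), ?q z k)"
  have pi_q: "\<pi> (inv_into UNIV \<pi> k) = k" "inv_into UNIV \<pi> (\<pi> k) = k" for k
    using permutes_inverses[OF perm] by auto
  have Zcd: "snd (z k) \<in> ?d" if z: "z \<in> ?Z" and k: "k \<in> ?c" for z k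
  proof -
    obtain l where "k = p i l" using k unfolding cyc_def by blast
    then show ?thesis using fixed_sols_p[of z U i l] z stU iU by simp
  qed
  have Zdc: "snd (z k) \<in> ?c" if z: "z \<in> ?Z" and k: "k \<in> ?d" for z k
  proof -
    obtain l where l: "k = p j l" using k unfolding cyc_def by blast
    have "snd (z j) = i" using solsD(3)[of z fixed_eq U i] z iU by (auto simp: fixed_eq_def)
    then show ?thesis using fixed_sols_p[of z U j l] z stU jU l by simp
  qed
  have Ycd: "snd (z k) \<in> ?d" if z: "z \<in> ?Y" and k: "k \<in> ?c" for z k
  proof -
    obtain l where "k = p i l" using k unfolding cyc_def by blast
    then show ?thesis using root_sols_p[of z U i l] z stU iU by simp
  qed
  have Ydc: "snd (z k) \<in> ?c" if z: "z \<in> ?Y" and k: "k \<in> ?d" for z k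
  proof -
    obtain l where l: "k = p j l" using k unfolding cyc_def by blast
    have "snd (z j) = \<pi> i" using solsD(3)[of z root_eq U i] z iU by (auto simp: root_eq_def)
    then show ?thesis using root_sols_p[of z U j l] z stU jU l by (simp add: p_pi pi_cyc)
  qed
  have notc: "k \<notin> ?c" if "k \<in> ?d" for k using disj that by blast
  have zZ: "fst (z k) \<in> carrier A" "snd (z k) \<in> U" "snd (z (snd (z k))) = k" "fst (z (snd (z k))) = fst (z k)"
    "snd (z (\<pi> k)) = \<pi> (snd (z k))" "fst (z (\<pi> k)) = a k \<otimes> a (snd (z k)) \<otimes> fst (z k)"
    if "z \<in> ?Z" "k \<in> U" for z k
    using solsD[of z fixed_eq U k] that by (auto simp: fixed_eq_def)
  have zY: "fst (z k) \<in> carrier A" "snd (z k) \<in> U" "snd (z (snd (z k))) = \<pi> k" "fst (z (snd (z k))) = a k \<otimes> fst (z k)"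
    if "z \<in> ?Y" "k \<in> U" for z k
    using solsD[of z root_eq U k] that by (auto simp: root_eq_def)
  have zYpi: "snd (z (\<pi> k)) = \<pi> (snd (z k))" if z: "z \<in> ?Y" and k: "k \<in> U" for z k
    using zY(3)[OF z zY(2)[OF z k]] zY(3)[OF z k] by simp
  have qc: "?q z k \<in> ?c" "snd (z (?q z k)) = k" if z: "z \<in> ?Y" and k: "k \<in> ?d" for z k
  proof -
    show c: "?q z k \<in> ?c" using Ydc[OF z k] pi_cyc[of "?q z k" i] by (simp add: pi_q)
    have "\<pi> (snd (z (?q z k))) = \<pi> k" using zYpi[OF z, of "?q z k"] c zY(3)[OF z, of k] k by (simp add: U pi_q)
    then show "snd (z (?q z k)) = k" by (simp add: pi_inj)
  qed
  have FZ: "?F z \<in> ?Y" if z: "z \<in> ?Z" for z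
  proof -
    have "?F z \<in> U \<rightarrow>\<^sub>E carrier A \<times> U"
      using zZ[OF z] piU aU by (auto simp: mem_Times_iff)
    moreover have "root_eq (?F z) k" if k: "k \<in> U" for k
    proof (cases "k \<in> ?c")
      case True
      have d: "snd (z k) \<in> ?d" by (rule Zcd[OF z True])
      then show ?thesis using True k notc[OF d] zZ[OF z k] by (simp add: root_eq_def U)
    next
      case False
      then have kd: "k \<in> ?d" using k U by simp
      have c: "\<pi> (snd (z k)) \<in> ?c" using Zdc[OF z kd] by (simp add: pi_cyc)
      have s: "snd (z k) \<in> U" using zZ[OF z k] by simp
      have "fst (z (\<pi> (snd (z k)))) = a (snd (z k)) \<otimes> a k \<otimes> fst (z k)"
        using zZ(6)[OF z s] zZ(3,4)[OF z k] by simp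
      also have "\<dots> = a k \<otimes> (a (snd (z k)) \<otimes> fst (z k))"
        using aU[OF k] aU[OF s] zZ(1)[OF z k] by (simp add: m_ac)
      finally show ?thesis using False k c zZ(5)[OF z s] zZ(3)[OF z k] by (simp add: root_eq_def U)
    qed
    ultimately show ?thesis using z iU unfolding solutions_def by simp
  qed
  have GY: "?G z \<in> ?Z" if z: "z \<in> ?Y" for z
  proof -
    have "?G z \<in> U \<rightarrow>\<^sub>E carrier A \<times> U"
    proof (rule PiE_I)
      fix k assume k: "k \<in> U"
      show "?G z k \<in> carrier A \<times> U"
      proof (cases "k \<in> ?c")
        case False
        then have "k \<in> ?d" using k U by simp
        then have "?q z k \<in> U" using qc(1)[OF z] U by simp
        then show ?thesis using False k zY(1)[OF z] by simp
      qed (use k zY[OF z k] in \<open>simp add: mem_Times_iff\<close>)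
    qed simp
    moreover have "fixed_eq (?G z) k" if k: "k \<in> U" for k
    proof (cases "k \<in> ?c")
      case True
      have d: "snd (z k) \<in> ?d" by (rule Ycd[OF z True])
      have s: "snd (z k) \<in> U" using d U by simp
      have q: "?q z (snd (z k)) = k" using zY(3)[OF z k] by (simp add: pi_q)
      have pk: "\<pi> k \<in> ?c" "\<pi> k \<in> U" using True by (auto simp: pi_cyc U)
      have "fst (z (\<pi> k)) = a (snd (z k)) \<otimes> (a k \<otimes> fst (z k))"
        using zY(3,4)[OF z s] zY(3,4)[OF z k] by simp
      also have "\<dots> = a k \<otimes> a (snd (z k)) \<otimes> fst (z k)"
        using aU[OF k] aU[OF s] zY(1)[OF z k] by (simp add: m_ac)
      finally show ?thesis using True k notc[OF d] s q pk zYpi[OF z k] by (simp add: fixed_eq_def)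
    next
      case False
      then have kd: "k \<in> ?d" using k U by simp
      note q = qc[OF z kd]
      have qU: "?q z k \<in> U" using q U by simp
      have pk: "\<pi> k \<notin> ?c" "\<pi> k \<in> U" using False k by (auto simp: pi_cyc piU)
      have qpi: "?q z (\<pi> k) = \<pi> (?q z k)" using zYpi[OF z k] by (simp add: pi_q)
      have "fst (z (\<pi> (?q z k))) = a k \<otimes> fst (z k)" using zY(4)[OF z k] by (simp add: pi_q)
      moreover have "fst (z k) = a (?q z k) \<otimes> fst (z (?q z k))" using zY(4)[OF z qU] q(2) by simp
      ultimately have "fst (z (\<pi> (?q z k))) = a k \<otimes> a (?q z k) \<otimes> fst (z (?q z k))"
        using aU[OF k] aU[OF qU] zY(1)[OF z qU] by (simp add: m_assoc)
      then show ?thesis using False k q qU pk qpi by (simp add: fixed_eq_def)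
    qed
    ultimately show ?thesis using z iU unfolding solutions_def by simp
  qed
  have bij: "bij_betw ?F ?Z ?Y"
  proof (rule bij_betw_byWitness[where f' = ?G])
    show "\<forall>z\<in>?Z. ?G (?F z) = z"
    proof
      fix z assume z: "z \<in> ?Z"
      show "?G (?F z) = z"
      proof
        fix k
        consider "k \<notin> U" | "k \<in> ?c" | "k \<in> ?d" using U by blast
        then show "?G (?F z) k = z k"
        proof cases
          case 1
          then show ?thesis using z by (auto simp: solutions_def PiE_def extensional_def)
        next
          case 2
          then show ?thesis by (simp add: U)
        next
          case 3
          have k: "k \<in> U" using 3 U by simp
          have c: "snd (z k) \<in> ?c" "snd (z k) \<in> U" using Zdc[OF z 3] U by auto
          have "?q (?F z) k = snd (z k)" using k notc[OF 3] by (simp add: pi_q)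
          then show ?thesis using k notc[OF 3] c zZ(4)[OF z k] by (simp add: prod_eq_iff)
        qed
      qed
    qed
    show "\<forall>z\<in>?Y. ?F (?G z) = z"
    proof
      fix z assume z: "z \<in> ?Y"
      show "?F (?G z) = z"
      proof
        fix k
        consider "k \<notin> U" | "k \<in> ?c" | "k \<in> ?d" using U by blast
        then show "?F (?G z) k = z k"
        proof cases
          case 1
          then show ?thesis using z by (auto simp: solutions_def PiE_def extensional_def)
        next
          case 2
          then show ?thesis by (simp add: U)
        next
          case 3
          have k: "k \<in> U" using 3 U by simp
          note q = qc[OF z 3]
          have qU: "?q z k \<in> U" using q U by simp
          have "fst (z k) = a (?q z k) \<otimes> fst (z (?q z k))" using zY(4)[OF z qU] q(2) by simp
          then show ?thesis using k notc[OF 3] by (simp add: prod_eq_iff pi_q)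
        qed
      qed
    qed
  qed (use FZ GY in blast)+
  have "(\<Prod>k\<in>U. wt k (z k)) = 1" if z: "z \<in> ?Z" for z
  proof -
    let ?t = "\<lambda>k. snd (z k)"
    let ?o = "\<lambda>k. if k < ?t k then 1 else - 1 :: complex"
    have bt: "bij_betw ?t ?c ?d"
      by (rule bij_betw_byWitness[where f' = ?t]) (use zZ(3)[OF z] Zcd[OF z] Zdc[OF z] U in auto)
    have bp: "bij_betw \<pi> ?c ?c"
    proof (rule bij_betw_byWitness[where f' = "inv_into UNIV \<pi>"])
      show "inv_into UNIV \<pi> ` ?c \<subseteq> ?c"
        using pi_cyc by (metis image_subsetI pi_q(1))
    qed (auto simp: pi_q pi_cyc)
    have "(\<Prod>k\<in>U. wt k (z k)) = (\<Prod>k\<in>?c. wt k (z k)) * (\<Prod>k\<in>?d. wt k (z k))"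
      unfolding U by (rule prod.union_disjoint[OF finite_cyc finite_cyc disj])
    also have "(\<Prod>k\<in>?d. wt k (z k)) = (\<Prod>k\<in>?c. wt (?t k) (z (?t k)))"
      by (rule prod.reindex_bij_betw[OF bt, symmetric])
    also have "(\<Prod>k\<in>?c. wt k (z k)) * (\<Prod>k\<in>?c. wt (?t k) (z (?t k))) = (\<Prod>k\<in>?c. ?o k * ?o (\<pi> k))"
      unfolding prod.distrib[symmetric]
    proof (rule prod.cong[OF refl])
      fix k assume k: "k \<in> ?c"
      then have kU: "k \<in> U" using U by simp
      have ne: "k \<noteq> ?t k" using Zcd[OF z k] k disj by auto
      have "wt k (z k) * wt (?t k) (z (?t k)) = wt k (fst (z k), ?t k) * wt (?t k) (fst (z k), k)"
        using zZ(3,4)[OF z kU] by (metis prod.collapse)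
      also have "\<dots> = ?o k * ?o (\<pi> k)" unfolding wt_pair[OF ne] using zZ(5)[OF z kU] by simp
      finally show "wt k (z k) * wt (?t k) (z (?t k)) = ?o k * ?o (\<pi> k)" .
    qed
    also have "\<dots> = (\<Prod>k\<in>?c. ?o k) * (\<Prod>k\<in>?c. ?o (\<pi> k))" by (rule prod.distrib)
    also have "(\<Prod>k\<in>?c. ?o (\<pi> k)) = (\<Prod>k\<in>?c. ?o k)" by (rule prod.reindex_bij_betw[OF bp])
    also have "(\<Prod>k\<in>?c. ?o k) * (\<Prod>k\<in>?c. ?o k) = (\<Prod>k\<in>?c. ?o k * ?o k)" by (rule prod.distrib[symmetric])
    also have "\<dots> = 1" by (rule prod.neutral) auto
    finally show ?thesis .
  qed
  then have "(\<Sum>z\<in>?Z. \<Prod>k\<in>U. wt k (z k)) = of_nat (card ?Z)" by simp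
  also have "card ?Z = card ?Y" by (rule bij_betw_same_card[OF bij])
  finally show ?thesis unfolding U_def .
qed

text \<open>A point \<open>i\<close> of \<open>S\<close> and its image \<open>j\<close> determine one or two cycles, which are split off. If \<open>j\<close> lies on
  another cycle, the two sides agree for each such \<open>j\<close>; on the cycle of \<open>i\<close> they agree only after
  summation over \<open>j\<close>.\<close>

theorem signed_fixed_points_eq_roots:
  assumes "pi_stable S"
  shows "(\<Sum>z\<in>fixed_sols S. \<Prod>k\<in>S. wt k (z k)) = of_nat (card (root_sols S))"
  using assms
proof (induction "card S" arbitrary: S rule: less_induct)
  case less
  note S = less.prems
  have finS: "finite S" by (rule stable_finite[OF S])
  show ?case
  proof (cases "S = {}")
    case True
    then show ?thesis by (simp add: solutions_def)
  next
    case False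
    then obtain i where i: "i \<in> S" by blast
    then have i0: "i \<in> S0" using S by (auto simp: pi_stable_def)
    let ?w = "\<lambda>T z. \<Prod>k\<in>T. wt k (z k)"
    have fins: "finite (fixed_sols T)" "finite (root_sols T)" if "finite T" for T
      using that finite_A by (auto intro: finite_solutions)
    have cS: "cyc i \<subseteq> S" using S i by (intro cyc_subset) (auto simp: pi_stable_def)
    have IH: "sum (?w (S - orbit_pair i j)) (fixed_sols (S - orbit_pair i j)) = of_nat (card (root_sols (S - orbit_pair i j)))"
      if j: "j \<in> S" for j
    proof (rule less.hyps)
      have "i \<in> S \<inter> orbit_pair i j" using i by (simp add: orbit_pair_def)
      then show "card (S - orbit_pair i j) < card S" using finS by (intro psubset_card_mono) auto
      show "pi_stable (S - orbit_pair i j)" unfolding orbit_pair_def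
        using S i0 j by (intro stable_Diff stable_Un stable_cyc) (auto simp: pi_stable_def)
    qed
    have group: "sum h (solutions (carrier A) Q T) = (\<Sum>j\<in>T. \<Sum>z | z \<in> solutions (carrier A) Q T \<and> snd (z i) = j. h z)"
      if "finite T" "i \<in> T" for h :: "_ \<Rightarrow> complex" and Q T
      using that finite_A
      by (intro sum.group[symmetric]) (auto intro: finite_solutions dest: solsD(2))
    have card_group: "of_nat (card (root_sols T)) = (\<Sum>j\<in>T. of_nat (card {z. z \<in> root_sols T \<and> snd (z i) = j}) :: complex)"
      if "finite T" "i \<in> T" for T using group[OF that, of "\<lambda>_. 1" root_eq] by simp
    have pair_c: "orbit_pair i j = cyc i" if "j \<in> cyc i" for j
    proof -
      have "cyc j \<subseteq> cyc i" using that by (intro cyc_subset) (auto simp: pi_cyc)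
      then show ?thesis by (auto simp: orbit_pair_def)
    qed
    have "sum (?w S) (fixed_sols S) = (\<Sum>j\<in>S. \<Sum>z | z \<in> fixed_sols S \<and> snd (z i) = j. ?w S z)"
      by (rule group[OF finS i])
    also have "\<dots> = (\<Sum>j\<in>cyc i. \<Sum>z | z \<in> fixed_sols S \<and> snd (z i) = j. ?w S z) +
        (\<Sum>j\<in>S - cyc i. \<Sum>z | z \<in> fixed_sols S \<and> snd (z i) = j. ?w S z)"
      by (subst sum.subset_diff[OF cS finS]) (simp add: add.commute)
    also have "(\<Sum>j\<in>cyc i. \<Sum>z | z \<in> fixed_sols S \<and> snd (z i) = j. ?w S z) =
        (\<Sum>j\<in>cyc i. of_nat (card {z. z \<in> root_sols S \<and> snd (z i) = j}))"
    proof -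
      have "(\<Sum>j\<in>cyc i. \<Sum>z | z \<in> fixed_sols S \<and> snd (z i) = j. ?w S z) =
          (\<Sum>j\<in>cyc i. (\<Sum>z | z \<in> fixed_sols (cyc i) \<and> snd (z i) = j. ?w (cyc i) z) * of_nat (card (root_sols (S - cyc i))))"
      proof (rule sum.cong[OF refl])
        fix j assume j: "j \<in> cyc i"
        then have jS: "j \<in> S" using cS by blast
        show "(\<Sum>z | z \<in> fixed_sols S \<and> snd (z i) = j. ?w S z) = (\<Sum>z | z \<in> fixed_sols (cyc i) \<and> snd (z i) = j. ?w (cyc i) z) * of_nat (card (root_sols (S - cyc i)))"
          using fixed_split[OF S i jS] IH[OF jS] unfolding pair_c[OF j] by simp
      qed
      also have "\<dots> = sum (?w (cyc i)) (fixed_sols (cyc i)) * of_nat (card (root_sols (S - cyc i)))"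
        by (simp add: sum_distrib_right group[OF finite_cyc self_in_cyc])
      also have "\<dots> = (\<Sum>j\<in>cyc i. of_nat (card {z. z \<in> root_sols (cyc i) \<and> snd (z i) = j}) * of_nat (card (root_sols (S - cyc i))))"
        unfolding cycle_identity[OF i0] by (subst card_group) (simp_all add: sum_distrib_right)
      also have "\<dots> = (\<Sum>j\<in>cyc i. of_nat (card {z. z \<in> root_sols S \<and> snd (z i) = j}))"
      proof (rule sum.cong[OF refl])
        fix j assume j: "j \<in> cyc i"
        then have jS: "j \<in> S" using cS by blast
        show "of_nat (card {z. z \<in> root_sols (cyc i) \<and> snd (z i) = j}) * of_nat (card (root_sols (S - cyc i))) =
          (of_nat (card {z. z \<in> root_sols S \<and> snd (z i) = j}) :: complex)"
          using root_split[OF S i jS] unfolding pair_c[OF j] by simp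
      qed
      finally show ?thesis .
    qed
    also have "(\<Sum>j\<in>S - cyc i. \<Sum>z | z \<in> fixed_sols S \<and> snd (z i) = j. ?w S z) =
        (\<Sum>j\<in>S - cyc i. of_nat (card {z. z \<in> root_sols S \<and> snd (z i) = j}))"
    proof (rule sum.cong[OF refl])
      fix j assume j: "j \<in> S - cyc i"
      then have jS: "j \<in> S" "j \<in> S0" "j \<notin> cyc i" using S by (auto simp: pi_stable_def)
      show "(\<Sum>z | z \<in> fixed_sols S \<and> snd (z i) = j. ?w S z) = of_nat (card {z. z \<in> root_sols S \<and> snd (z i) = j})"
        using fixed_split[OF S i jS(1)] root_split[OF S i jS(1)] IH[OF jS(1)] swapped_cycles_identity[OF i0 jS(2,3)] by simp
    qed
    also have "(\<Sum>j\<in>cyc i. of_nat (card {z. z \<in> root_sols S \<and> snd (z i) = j})) +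
        (\<Sum>j\<in>S - cyc i. of_nat (card {z. z \<in> root_sols S \<and> snd (z i) = j})) =
        (\<Sum>j\<in>S. of_nat (card {z. z \<in> root_sols S \<and> snd (z i) = j}) :: complex)"
      by (subst sum.subset_diff[OF cS finS]) (simp add: add.commute)
    also have "\<dots> = of_nat (card (root_sols S))" by (rule card_group[OF finS i, symmetric])
    finally show ?thesis .
  qed
qed

end


section \<open>Reversal of cycles\<close>

context monomial_element
begin

lemma path_prod_cong:
  assumes "\<And>k. k < m \<Longrightarrow> f k = g k" "\<And>k. g k \<in> carrier A" shows "path_prod f m = path_prod g m"
  unfolding path_prod_def by (rule finprod_cong') (use assms in auto)

lemma path_prod_rev:
  assumes f: "\<And>k. f k \<in> carrier A" shows "path_prod (\<lambda>k. f (m - Suc k)) m = path_prod f m"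
proof -
  have inj: "inj_on (\<lambda>k. m - Suc k) {..<m}" by (auto simp: inj_on_def)
  have img: "(\<lambda>k. m - Suc k) ` {..<m} = {..<m}"
  proof (intro equalityI subsetI)
    fix k assume "k \<in> {..<m}"
    then show "k \<in> (\<lambda>k. m - Suc k) ` {..<m}" by (intro image_eqI[of _ _ "m - Suc k"]) auto
  qed auto
  show ?thesis unfolding path_prod_def
    using finprod_reindex[OF _ inj, of f] f by (simp add: img Pi_def)
qed

lemma path_prod_inv:
  assumes f: "\<And>k. f k \<in> carrier A" shows "path_prod f m \<otimes> path_prod (\<lambda>k. inv (f k)) m = \<one>"
proof -
  have "path_prod f m \<otimes> path_prod (\<lambda>k. inv (f k)) m = path_prod (\<lambda>k. \<one>) m"
    using f by (simp add: path_prod_mult[symmetric])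
  then show ?thesis by (simp add: path_prod_def)
qed

text \<open>The reflection \<open>\<zeta>\<close> of the cycle in \<open>i\<close> reverses its direction. The coefficients \<open>y\<close> solve a recursion
  whose multipliers have product \<open>\<one>\<close>, since \<open>A\<close> is commutative.\<close>

lemma cycle_reversal:
  assumes i: "i \<in> S0"
  shows "\<exists>\<zeta> y. (\<forall>j\<in>cyc i. \<zeta> j \<in> cyc i \<and> \<zeta> (\<zeta> j) = j \<and> \<pi> (\<zeta> (\<pi> j)) = \<zeta> j \<and> y j \<in> carrier A \<and>
    y (\<pi> j) = a (\<zeta> (\<pi> j)) \<otimes> inv (a j) \<otimes> y j)"
proof -
  let ?m = "period i"
  let ?q = "the_inv_into {..<?m} (p i)"
  note bij = bij_betw_cyc[of i]
  have q: "?q (p i k) = k" if "k < ?m" for k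
    using that bij by (intro the_inv_into_f_f) (auto simp: bij_betw_def)
  define \<zeta> where "\<zeta> j = p i (?m - ?q j)" for j
  have pm: "p i ?m = i" "?m > 0" using period_props by auto
  have \<zeta>p: "\<zeta> (p i k) = p i (?m - k)" if "k < ?m" for k using q[OF that] by (simp add: \<zeta>_def)
  have \<zeta>i: "\<zeta> i = i" using \<zeta>p[of 0] pm by simp
  have \<zeta>c: "\<zeta> j \<in> cyc i" for j by (simp add: \<zeta>_def)
  have \<zeta>\<pi>: "\<zeta> (\<pi> (p i k)) = p i (?m - Suc k)" if k: "k < ?m" for k
  proof (cases "Suc k < ?m")
    case True
    then show ?thesis using \<zeta>p[OF True] by (simp add: p_Suc)
  next
    case False
    then have "Suc k = ?m" using k by simp
    then have "\<pi> (p i k) = i" using pm by (metis p_Suc)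
    then show ?thesis using \<zeta>i \<open>Suc k = ?m\<close> by simp
  qed
  have 1: "\<zeta> (\<zeta> j) = j" "\<pi> (\<zeta> (\<pi> j)) = \<zeta> j" if j: "j \<in> cyc i" for j
  proof -
    obtain k where k: "k < ?m" "j = p i k" using j by (rule cyc_elim)
    show "\<zeta> (\<zeta> j) = j" using \<zeta>p[of k] \<zeta>p[of "?m - k"] k \<zeta>i pm by (cases "k = 0") auto
    have "\<pi> (\<zeta> (\<pi> j)) = p i (Suc (?m - Suc k))" using \<zeta>\<pi>[OF k(1)] k by (simp add: p_Suc)
    also have "Suc (?m - Suc k) = ?m - k" using k by simp
    finally show "\<pi> (\<zeta> (\<pi> j)) = \<zeta> j" using \<zeta>p[OF k(1)] k(2) by simp
  qed
  define h where "h j = a (\<zeta> (\<pi> j)) \<otimes> inv (a j)" for j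
  have h: "h (p i k) \<in> carrier A" for k unfolding h_def using i a_cyc[OF i \<zeta>c] by simp
  have "path_prod (\<lambda>l. h (p i l)) ?m = path_prod (\<lambda>k. a (p i (?m - Suc k)) \<otimes> inv (a (p i k))) ?m"
    by (rule path_prod_cong) (use i in \<open>simp_all add: h_def \<zeta>\<pi>\<close>)
  also have "\<dots> = path_prod (\<lambda>k. a (p i (?m - Suc k))) ?m \<otimes> path_prod (\<lambda>k. inv (a (p i k))) ?m"
    by (rule path_prod_mult) (use i in auto)
  also have "path_prod (\<lambda>k. a (p i (?m - Suc k))) ?m = path_prod (\<lambda>k. a (p i k)) ?m"
    by (rule path_prod_rev) (use i in auto)
  also have "path_prod (\<lambda>k. a (p i k)) ?m \<otimes> path_prod (\<lambda>k. inv (a (p i k))) ?m = \<one>"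
    by (rule path_prod_inv) (use i in auto)
  finally have closing: "path_prod (\<lambda>l. h (p i l)) ?m = \<one>" .
  obtain y where y: "y \<in> cyc i \<rightarrow>\<^sub>E carrier A" "\<forall>j\<in>cyc i. y (\<pi> j) = h j \<otimes> y j"
    using lift_exists[where h = h, OF h one_closed closing] by blast
  have "\<forall>j\<in>cyc i. \<zeta> j \<in> cyc i \<and> \<zeta> (\<zeta> j) = j \<and> \<pi> (\<zeta> (\<pi> j)) = \<zeta> j \<and> y j \<in> carrier A \<and>
    y (\<pi> j) = a (\<zeta> (\<pi> j)) \<otimes> inv (a j) \<otimes> y j"
    using y \<zeta>c 1 by (auto simp: h_def)
  then show ?thesis by blast
qed

text \<open>Together \<open>\<zeta>\<close> and \<open>y\<close> form a monomial element \<open>s\<close> with \<open>\<tau> g \<otimes> s \<otimes> g = s\<close>.\<close>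

lemma reversal:
  assumes "pi_stable S"
  shows "\<exists>\<zeta> y. (\<forall>j\<in>S. \<zeta> j \<in> S \<and> \<zeta> (\<zeta> j) = j \<and> \<pi> (\<zeta> (\<pi> j)) = \<zeta> j \<and> y j \<in> carrier A \<and>
    y (\<pi> j) = a (\<zeta> (\<pi> j)) \<otimes> inv (a j) \<otimes> y j)"
  using assms
proof (induction "card S" arbitrary: S rule: less_induct)
  case less
  note S = less.prems
  have finS: "finite S" by (rule stable_finite[OF S])
  show ?case
  proof (cases "S = {}")
    case False
    then obtain i where i: "i \<in> S" by blast
    then have i0: "i \<in> S0" using S by (auto simp: pi_stable_def)
    have cS: "cyc i \<subseteq> S" using S i by (intro cyc_subset) (auto simp: pi_stable_def)
    have stc: "pi_stable (S - cyc i)" by (intro stable_Diff S stable_cyc i0)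
    have "S - cyc i \<subset> S" using i self_in_cyc[of i] by blast
    then have "card (S - cyc i) < card S" using finS by (intro psubset_card_mono) auto
    from less.hyps[OF this stc] obtain \<zeta>1 y1 where 1: "\<And>j. j \<in> S - cyc i \<Longrightarrow> \<zeta>1 j \<in> S - cyc i \<and> \<zeta>1 (\<zeta>1 j) = j \<and> \<pi> (\<zeta>1 (\<pi> j)) = \<zeta>1 j \<and>
        y1 j \<in> carrier A \<and> y1 (\<pi> j) = a (\<zeta>1 (\<pi> j)) \<otimes> inv (a j) \<otimes> y1 j" by (elim exE) (rule that, erule bspec)
    from cycle_reversal[OF i0] obtain \<zeta>2 y2 where 2: "\<And>j. j \<in> cyc i \<Longrightarrow> \<zeta>2 j \<in> cyc i \<and> \<zeta>2 (\<zeta>2 j) = j \<and> \<pi> (\<zeta>2 (\<pi> j)) = \<zeta>2 j \<and>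
        y2 j \<in> carrier A \<and> y2 (\<pi> j) = a (\<zeta>2 (\<pi> j)) \<otimes> inv (a j) \<otimes> y2 j" by (elim exE) (rule that, erule bspec)
    let ?\<zeta> = "\<lambda>j. if j \<in> cyc i then \<zeta>2 j else \<zeta>1 j" and ?y = "\<lambda>j. if j \<in> cyc i then y2 j else y1 j"
    have "?\<zeta> j \<in> S \<and> ?\<zeta> (?\<zeta> j) = j \<and> \<pi> (?\<zeta> (\<pi> j)) = ?\<zeta> j \<and> ?y j \<in> carrier A \<and>
      ?y (\<pi> j) = a (?\<zeta> (\<pi> j)) \<otimes> inv (a j) \<otimes> ?y j" if j: "j \<in> S" for j
      using 1[of j] 2[of j] cS j by (cases "j \<in> cyc i") (auto simp: pi_cyc)
    then show ?thesis by (intro exI[of _ ?\<zeta>] exI[of _ ?y] ballI)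
  qed simp
qed

end

section \<open>The wreath product\<close>

context involutive_automorphism
begin

lemma conjugate_if_fixed:
  assumes c: "t \<in> carrier G" "s \<in> carrier G" "g \<in> carrier G" and eq: "t \<otimes> s \<otimes> g = s"
  shows "s \<otimes> g \<otimes> inv s = inv t"
proof -
  have "s \<otimes> g = inv t \<otimes> (t \<otimes> s \<otimes> g)" using c by (simp add: m_assoc[symmetric])
  then show ?thesis using c by (simp add: eq m_assoc)
qed

definition twisted_invs :: "'a set" where "twisted_invs = {\<omega> \<in> carrier G. \<omega> \<otimes> \<tau> \<omega> = \<one>}"
definition act :: "'a \<Rightarrow> 'a \<Rightarrow> 'a" where "act g \<omega> = g \<otimes> \<omega> \<otimes> inv (\<tau> g)"

lemma act_closed: "g \<in> carrier G \<Longrightarrow> \<omega> \<in> twisted_invs \<Longrightarrow> act g \<omega> \<in> twisted_invs"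
proof -
  assume g: "g \<in> carrier G" and w: "\<omega> \<in> twisted_invs"
  then have wG: "\<omega> \<in> carrier G" and ww: "\<omega> \<otimes> \<tau> \<omega> = \<one>" by (auto simp: twisted_invs_def)
  have "inv (\<tau> g) \<otimes> (\<tau> g \<otimes> (\<tau> \<omega> \<otimes> inv g)) = \<tau> \<omega> \<otimes> inv g"
    using g wG by (simp add: m_assoc[symmetric])
  then have "act g \<omega> \<otimes> \<tau> (act g \<omega>) = g \<otimes> \<omega> \<otimes> (inv (\<tau> g) \<otimes> \<tau> g) \<otimes> \<tau> \<omega> \<otimes> inv g"
    using g wG by (simp add: act_def m_assoc)
  also have "\<dots> = g \<otimes> (\<omega> \<otimes> \<tau> \<omega>) \<otimes> inv g" using g wG by (simp add: m_assoc)
  also have "\<dots> = \<one>" using g ww by simp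
  finally show ?thesis using g wG by (simp add: twisted_invs_def act_def)
qed

lemma act_mult: "g \<in> carrier G \<Longrightarrow> h \<in> carrier G \<Longrightarrow> \<omega> \<in> twisted_invs \<Longrightarrow> act (g \<otimes> h) \<omega> = act g (act h \<omega>)"
  by (simp add: act_def twisted_invs_def inv_mult_group m_assoc)

lemma act_one: "\<omega> \<in> twisted_invs \<Longrightarrow> act \<one> \<omega> = \<omega>"
  by (simp add: act_def twisted_invs_def)

text \<open>A form without inverses in the wreath product, where inverses are cumbersome to write out.\<close>

lemma act_tau: "g \<in> carrier G \<Longrightarrow> \<omega> \<in> twisted_invs \<Longrightarrow> act g \<omega> \<otimes> \<tau> g = g \<otimes> \<omega>"
  by (simp add: act_def twisted_invs_def m_assoc)

lemma act_fixed_iff: "g \<in> carrier G \<Longrightarrow> \<omega> \<in> twisted_invs \<Longrightarrow> act g \<omega> = \<omega> \<longleftrightarrow> g \<otimes> \<omega> = \<omega> \<otimes> \<tau> g"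
  using act_tau[of g \<omega>] right_cancel[of "\<tau> g" "act g \<omega>" \<omega>] act_closed[of g \<omega>] by (auto simp: twisted_invs_def)

end

locale wreath_model = abelian_sign A sgA for A :: "('a, 'b) monoid_scheme" (structure) and sgA +
  fixes n :: nat
begin

abbreviation "W \<equiv> wreath A n"

lemma W_carrier: "carrier W = ({1..n} \<rightarrow>\<^sub>E carrier A) \<times> {\<pi>. \<pi> permutes {1..n}}"
  by (simp add: wreath_def Let_def sym_group_def)

lemma W_mult:
  assumes "\<sigma> permutes {1..n}"
  shows "(a, \<pi>) \<otimes>\<^bsub>W\<^esub> (b, \<sigma>) = (\<lambda>i\<in>{1..n}. a (\<sigma> i) \<otimes> b i, \<pi> \<circ> \<sigma>)"
  using permutes_bij[OF assms] by (auto simp: wreath_def Let_def sym_group_def perm_act_def inv_inv_eq fun_eq_iff)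

lemma W_one: "\<one>\<^bsub>W\<^esub> = (\<lambda>i\<in>{1..n}. \<one>, id)"
  by (simp add: wreath_def Let_def sym_group_def)

lemma tau_eq: "a \<in> {1..n} \<rightarrow>\<^sub>E carrier A \<Longrightarrow> tau A n (a, \<pi>) = (\<lambda>i\<in>{1..n}. inv (a i), \<pi>)"
  by (simp add: tau_def inv_product_group is_group)

lemma group_W: "group W"
proof (rule groupI)
  fix x y assume xy: "x \<in> carrier W" "y \<in> carrier W"
  obtain a \<pi> b \<sigma> where e: "x = (a, \<pi>)" "y = (b, \<sigma>)" by fastforce
  show "x \<otimes>\<^bsub>W\<^esub> y \<in> carrier W"
    using xy permutes_in_image[of \<sigma> "{1..n}"] by (auto simp: e W_carrier W_mult permutes_compose PiE_iff)
next
  show "\<one>\<^bsub>W\<^esub> \<in> carrier W" by (auto simp: W_carrier W_one permutes_id)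
next
  fix x y z assume xyz: "x \<in> carrier W" "y \<in> carrier W" "z \<in> carrier W"
  obtain a \<pi> b \<sigma> c \<theta> where e: "x = (a, \<pi>)" "y = (b, \<sigma>)" "z = (c, \<theta>)" by (metis prod.exhaust)
  have s: "\<sigma> permutes {1..n}" "\<theta> permutes {1..n}" "(\<sigma> \<circ> \<theta>) permutes {1..n}"
    using xyz by (auto simp: e W_carrier permutes_compose)
  show "x \<otimes>\<^bsub>W\<^esub> y \<otimes>\<^bsub>W\<^esub> z = x \<otimes>\<^bsub>W\<^esub> (y \<otimes>\<^bsub>W\<^esub> z)"
    using xyz permutes_in_image[OF s(1)] permutes_in_image[OF s(2)] unfolding e W_mult[OF s(1)] W_mult[OF s(2)] W_mult[OF s(3)]
    by (auto simp: fun_eq_iff W_carrier PiE_iff m_assoc)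
next
  fix x assume x: "x \<in> carrier W"
  obtain a \<pi> where e: "x = (a, \<pi>)" by fastforce
  have s: "\<pi> permutes {1..n}" and a: "a \<in> {1..n} \<rightarrow>\<^sub>E carrier A" using x by (auto simp: e W_carrier)
  show "\<one>\<^bsub>W\<^esub> \<otimes>\<^bsub>W\<^esub> x = x"
    unfolding e W_one W_mult[OF s] using a permutes_in_image[OF s]
    by (auto simp: fun_eq_iff PiE_iff extensional_def)
  let ?\<rho> = "inv_into UNIV \<pi>"
  let ?y = "(\<lambda>i\<in>{1..n}. inv (a (?\<rho> i)), ?\<rho>)"
  have "?\<rho> permutes {1..n}" by (rule permutes_inv[OF s])
  then have "?y \<in> carrier W" using a permutes_in_image[OF \<open>?\<rho> permutes {1..n}\<close>] by (auto simp: W_carrier PiE_iff)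
  moreover have "?y \<otimes>\<^bsub>W\<^esub> x = \<one>\<^bsub>W\<^esub>"
    unfolding e W_one W_mult[OF s] using a permutes_in_image[OF s] permutes_inverses[OF s] permutes_inv_o[OF s]
    by (auto simp: fun_eq_iff PiE_iff)
  ultimately show "\<exists>y\<in>carrier W. y \<otimes>\<^bsub>W\<^esub> x = \<one>\<^bsub>W\<^esub>" by blast
qed

lemma finite_W: "finite (carrier W)"
  by (auto simp: W_carrier intro!: finite_PiE finite_A finite_permutations)

sublocale W: involutive_automorphism W "tau A n"
proof (intro involutive_automorphism.intro finite_group.intro)
  show "group W" by (rule group_W)
  show "finite_group_axioms W" by unfold_locales (rule finite_W)
  have hom: "tau A n \<in> hom W W"
  proof (rule homI)
    fix x assume x: "x \<in> carrier W"
    then show "tau A n x \<in> carrier W" by (cases x) (auto simp: W_carrier tau_eq PiE_iff)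
    fix y assume y: "y \<in> carrier W"
    obtain a \<pi> b \<sigma> where e: "x = (a, \<pi>)" "y = (b, \<sigma>)" by fastforce
    have s: "\<sigma> permutes {1..n}" and ab: "a \<in> {1..n} \<rightarrow>\<^sub>E carrier A" "b \<in> {1..n} \<rightarrow>\<^sub>E carrier A"
      using x y by (auto simp: e W_carrier)
    have "(\<lambda>i\<in>{1..n}. a (\<sigma> i) \<otimes> b i) \<in> {1..n} \<rightarrow>\<^sub>E carrier A" using ab permutes_in_image[OF s] by (auto simp: PiE_iff)
    then show "tau A n (x \<otimes>\<^bsub>W\<^esub> y) = tau A n x \<otimes>\<^bsub>W\<^esub> tau A n y"
      unfolding e W_mult[OF s] tau_eq[OF ab(1)] tau_eq[OF ab(2)] W_mult[OF s]
      using ab permutes_in_image[OF s] by (auto simp: tau_eq fun_eq_iff PiE_iff inv_mult)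
  qed
  show "involutive_automorphism_axioms W (tau A n)"
  proof
    show "tau A n \<in> hom W W" by (rule hom)
    fix g assume g: "g \<in> carrier W"
    obtain a \<pi> where e: "g = (a, \<pi>)" by fastforce
    have a: "a \<in> {1..n} \<rightarrow>\<^sub>E carrier A" using g by (auto simp: e W_carrier)
    have "(\<lambda>i\<in>{1..n}. inv (a i)) \<in> {1..n} \<rightarrow>\<^sub>E carrier A" using a by (auto simp: PiE_iff)
    from tau_eq[OF this] show "tau A n (tau A n g) = g"
      unfolding e tau_eq[OF a] using a by (auto simp: fun_eq_iff PiE_iff extensional_def)
  qed
qed

lemma twisted_involutions_eq: "twisted_involutions A n = W.twisted_invs"
  by (simp add: twisted_involutions_def W.twisted_invs_def)

lemma twisted_involution_iff:
  "(x, \<theta>) \<in> twisted_involutions A n \<longleftrightarrow> x \<in> {1..n} \<rightarrow>\<^sub>E carrier A \<and> \<theta> permutes {1..n} \<and>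
     (\<forall>i\<in>{1..n}. \<theta> (\<theta> i) = i \<and> x (\<theta> i) = x i)"
proof (cases "x \<in> {1..n} \<rightarrow>\<^sub>E carrier A \<and> \<theta> permutes {1..n}")
  case True
  then have x: "x \<in> {1..n} \<rightarrow>\<^sub>E carrier A" and s: "\<theta> permutes {1..n}" by auto
  have xc: "x i \<in> carrier A" "x (\<theta> i) \<in> carrier A" if "i \<in> {1..n}" for i
    using x that permutes_in_image[OF s, of i] by auto
  have "(x, \<theta>) \<otimes>\<^bsub>W\<^esub> tau A n (x, \<theta>) = \<one>\<^bsub>W\<^esub> \<longleftrightarrow> (\<forall>i\<in>{1..n}. x (\<theta> i) \<otimes> inv (x i) = \<one>) \<and> \<theta> \<circ> \<theta> = id"
    unfolding tau_eq[OF x] W_mult[OF s] W_one by (auto simp: fun_eq_iff)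
  also have "(\<forall>i\<in>{1..n}. x (\<theta> i) \<otimes> inv (x i) = \<one>) \<longleftrightarrow> (\<forall>i\<in>{1..n}. x (\<theta> i) = x i)"
    using xc by (metis inv_closed inv_equality inv_inv r_inv)
  also have "\<theta> \<circ> \<theta> = id \<longleftrightarrow> (\<forall>i\<in>{1..n}. \<theta> (\<theta> i) = i)"
    using permutes_not_in[OF s] by (auto simp: fun_eq_iff)
  finally show ?thesis using True by (auto simp: twisted_involutions_def W_carrier)
qed (auto simp: twisted_involutions_def W_carrier)

lemma monomial: "(a, \<pi>) \<in> carrier W \<Longrightarrow> monomial_element A sgA {1..n} a \<pi>"
  by unfold_locales (auto simp: W_carrier)

lemma conjugate_to_inverse_twist:
  assumes g: "g \<in> carrier W"
  shows "\<exists>s\<in>carrier W. s \<otimes>\<^bsub>W\<^esub> g \<otimes>\<^bsub>W\<^esub> inv\<^bsub>W\<^esub> s = inv\<^bsub>W\<^esub> (tau A n g)"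
proof -
  obtain a \<pi> where e: "g = (a, \<pi>)" by fastforce
  interpret M: monomial_element A sgA "{1..n}" a \<pi> using monomial g e by simp
  have a: "a \<in> {1..n} \<rightarrow>\<^sub>E carrier A" and s: "\<pi> permutes {1..n}" using g by (auto simp: e W_carrier)
  have "M.pi_stable {1..n}" unfolding M.pi_stable_def using permutes_in_image[OF s] by auto
  from M.reversal[OF this] obtain \<zeta> y where z: "\<And>j. j \<in> {1..n} \<Longrightarrow> \<zeta> j \<in> {1..n} \<and> \<zeta> (\<zeta> j) = j \<and> \<pi> (\<zeta> (\<pi> j)) = \<zeta> j \<and> y j \<in> carrier A \<and>
    y (\<pi> j) = a (\<zeta> (\<pi> j)) \<otimes> inv (a j) \<otimes> y j" by (elim exE) (rule that, erule bspec)
  define \<zeta>' where "\<zeta>' j = (if j \<in> {1..n} then \<zeta> j else j)" for j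
  define y' where "y' = (\<lambda>j\<in>{1..n}. y j)"
  have zp: "\<zeta>' permutes {1..n}"
  proof (rule bij_imp_permutes)
    show "bij_betw \<zeta>' {1..n} {1..n}"
      by (rule bij_betw_byWitness[where f' = \<zeta>]) (use z in \<open>auto simp: \<zeta>'_def\<close>)
  qed (auto simp: \<zeta>'_def)
  let ?s = "(y', \<zeta>')"
  have sW: "?s \<in> carrier W" using zp z by (auto simp: W_carrier y'_def)
  have sp: "\<pi> j \<in> {1..n} \<longleftrightarrow> j \<in> {1..n}" for j by (rule permutes_in_image[OF s])
  have yeq: "y j = inv (a (\<zeta> (\<pi> j))) \<otimes> y (\<pi> j) \<otimes> a j" if j: "j \<in> {1..n}" for j
  proof -
    have c: "a j \<in> carrier A" "y j \<in> carrier A" "a (\<zeta> (\<pi> j)) \<in> carrier A"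
      using z[of j] z[of "\<pi> j"] sp[of j] j a by auto
    have "inv (a (\<zeta> (\<pi> j))) \<otimes> y (\<pi> j) \<otimes> a j = (inv (a (\<zeta> (\<pi> j))) \<otimes> a (\<zeta> (\<pi> j))) \<otimes> (inv (a j) \<otimes> a j) \<otimes> y j"
      using c z[OF j] by (simp only: m_ac inv_closed m_closed)
    then show ?thesis using c by simp
  qed
  have "tau A n g \<otimes>\<^bsub>W\<^esub> ?s \<otimes>\<^bsub>W\<^esub> g = ?s"
  proof -
    have "tau A n g \<otimes>\<^bsub>W\<^esub> ?s = (\<lambda>i\<in>{1..n}. inv (a (\<zeta> i)) \<otimes> y i, \<pi> \<circ> \<zeta>')"
      unfolding e tau_eq[OF a] W_mult[OF zp] using z by (auto simp: fun_eq_iff \<zeta>'_def y'_def)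
    then have "tau A n g \<otimes>\<^bsub>W\<^esub> ?s \<otimes>\<^bsub>W\<^esub> g = (\<lambda>i\<in>{1..n}. (inv (a (\<zeta> (\<pi> i))) \<otimes> y (\<pi> i)) \<otimes> a i, \<pi> \<circ> \<zeta>' \<circ> \<pi>)"
      unfolding e by (simp add: W_mult[OF s] fun_eq_iff sp del: atLeastAtMost_iff One_nat_def)
    also have "\<dots> = ?s"
    proof (intro prod_eqI)
      show "fst (\<lambda>i\<in>{1..n}. (inv (a (\<zeta> (\<pi> i))) \<otimes> y (\<pi> i)) \<otimes> a i, \<pi> \<circ> \<zeta>' \<circ> \<pi>) = fst ?s"
        using yeq by (auto simp: fun_eq_iff y'_def)
      show "snd (\<lambda>i\<in>{1..n}. (inv (a (\<zeta> (\<pi> i))) \<otimes> y (\<pi> i)) \<otimes> a i, \<pi> \<circ> \<zeta>' \<circ> \<pi>) = snd ?s"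
      proof -
        have "\<pi> (\<zeta>' (\<pi> j)) = \<zeta>' j" for j
          using z[of j] sp[of j] permutes_not_in[OF s, of j] by (auto simp: \<zeta>'_def simp del: atLeastAtMost_iff)
        then show ?thesis by (simp add: fun_eq_iff)
      qed
    qed
    finally show ?thesis .
  qed
  then have "?s \<otimes>\<^bsub>W\<^esub> g \<otimes>\<^bsub>W\<^esub> inv\<^bsub>W\<^esub> ?s = inv\<^bsub>W\<^esub> (tau A n g)"
    using sW g by (intro W.conjugate_if_fixed) auto
  then show ?thesis using sW by blast
qed

end


lemma prod_minus_one_if:
  "finite X \<Longrightarrow> (\<Prod>i\<in>X. if Q i then - 1 else 1 :: complex) = (- 1) ^ card {i \<in> X. Q i}"
  by (subst prod.inter_filter[symmetric]) simp_all

context wreath_model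
begin

text \<open>As a product over the smaller points of the pairs, the sign can be reindexed under conjugation.\<close>

definition pair_sign :: "(nat \<Rightarrow> nat) \<Rightarrow> (nat \<Rightarrow> nat) \<Rightarrow> complex" where
  "pair_sign \<pi> \<theta> = (\<Prod>i | i \<in> {1..n} \<and> i < \<theta> i. if \<pi> (\<theta> i) < \<pi> i then - 1 else 1)"

lemma sign_S_eq:
  assumes \<theta>: "\<theta> permutes {1..n}" "\<forall>i\<in>{1..n}. \<theta> (\<theta> i) = i"
  shows "sign_S n \<pi> \<theta> = pair_sign \<pi> \<theta>"
proof -
  let ?X = "{i \<in> {i. i \<in> {1..n} \<and> i < \<theta> i}. \<pi> (\<theta> i) < \<pi> i}"
  have "bij_betw (\<lambda>i. (i, \<theta> i)) ?X (Inv n \<pi> \<inter> Pair n \<theta>)"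
  proof (rule bij_betw_byWitness[where f' = fst])
    show "(\<lambda>i. (i, \<theta> i)) ` ?X \<subseteq> Inv n \<pi> \<inter> Pair n \<theta>"
      using \<theta> permutes_in_image[OF \<theta>(1)] by (auto simp: Inv_def Pair_def)
  qed (auto simp: Inv_def Pair_def)
  then have "card (Inv n \<pi> \<inter> Pair n \<theta>) = card ?X" by (simp add: bij_betw_same_card)
  then show ?thesis
    unfolding sign_S_def pair_sign_def by (subst prod_minus_one_if) auto
qed

lemma sign_G_eq_prod_wt:
  assumes g: "(a, \<pi>) \<in> carrier W" and \<omega>: "(x, \<theta>) \<in> twisted_involutions A n"
  shows "sign_G n sgA (a, \<pi>) (x, \<theta>) = (\<Prod>i\<in>{1..n}. monomial_element.wt sgA a \<pi> i (x i, \<theta> i))"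
proof -
  interpret M: monomial_element A sgA "{1..n}" a \<pi> using monomial[OF g] .
  have \<theta>: "\<theta> permutes {1..n}" "\<forall>i\<in>{1..n}. \<theta> (\<theta> i) = i"
    using \<omega> by (auto simp: twisted_involution_iff)
  have "(\<Prod>i\<in>{1..n}. M.wt i (x i, \<theta> i)) =
      (\<Prod>i\<in>{1..n}. if \<theta> i = i then sgA (a i) (x i) else if i < \<theta> i \<and> \<pi> (\<theta> i) < \<pi> i then - 1 else 1)"
    by (intro prod.cong refl) (simp add: M.wt_def)
  also have "\<dots> = (\<Prod>i\<in>{1..n}. (if \<theta> i = i then sgA (a i) (x i) else 1) *
      (if i < \<theta> i then if \<pi> (\<theta> i) < \<pi> i then - 1 else 1 else 1))"
    by (intro prod.cong) auto
  also have "\<dots> = (\<Prod>i\<in>Fix n \<theta>. sgA (a i) (x i)) * pair_sign \<pi> \<theta>"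
    unfolding prod.distrib Fix_def pair_sign_def by (simp only: prod.inter_filter[OF finite_atLeastAtMost])
  finally show ?thesis by (simp add: sign_G_def sign_S_eq[OF \<theta>])
qed

text \<open>The permutation \<open>\<sigma>\<close> maps the pairs of \<open>\<theta>\<close> to those of its conjugate \<open>\<theta>'\<close>, but may change the order of
  the two points of a pair. This change is what \<open>pair_sign \<sigma> \<theta>\<close> records.\<close>

lemma pair_sign_cocycle:
  assumes \<pi>: "\<pi> permutes {1..n}" and \<sigma>: "\<sigma> permutes {1..n}"
    and \<theta>: "\<theta> permutes {1..n}" "\<forall>i\<in>{1..n}. \<theta> (\<theta> i) = i"
    and \<theta>': "\<theta>' permutes {1..n}" "\<And>i. \<theta>' (\<sigma> i) = \<sigma> (\<theta> i)"
  shows "pair_sign (\<pi> \<circ> \<sigma>) \<theta> = pair_sign \<pi> \<theta>' * pair_sign \<sigma> \<theta>"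
proof -
  let ?M = "\<lambda>\<theta>. {i. i \<in> {1..n} \<and> i < \<theta> i}"
  \<comment> \<open>The smaller point of the image of the pair of \<open>i\<close>.\<close>
  let ?r = "\<lambda>i. min (\<sigma> i) (\<sigma> (\<theta> i))"
  let ?s = "inv_into UNIV \<sigma>"
  let ?r' = "\<lambda>k. min (?s k) (?s (\<theta>' k))"
  have inj: "\<sigma> i = \<sigma> j \<longleftrightarrow> i = j" "\<pi> i = \<pi> j \<longleftrightarrow> i = j" for i j
    using permutes_inj[OF \<sigma>] permutes_inj[OF \<pi>] by (auto dest: injD)
  have s: "?s (\<sigma> i) = i" "\<sigma> (?s i) = i" for i using permutes_inverses[OF \<sigma>] by auto
  have \<theta>'s: "?s (\<theta>' k) = \<theta> (?s k)" for k using \<theta>'(2)[of "?s k"] by (metis s)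
  have \<theta>'\<theta>': "\<theta>' (\<theta>' k) = k" if "k \<in> {1..n}" for k
  proof -
    have "?s k \<in> {1..n}" using that permutes_in_image[OF permutes_inv[OF \<sigma>]] by simp
    then have "\<theta>' (\<theta>' (\<sigma> (?s k))) = \<sigma> (?s k)" unfolding \<theta>'(2) using \<theta>(2) by simp
    then show ?thesis by (simp add: s)
  qed
  have bij: "bij_betw ?r (?M \<theta>) (?M \<theta>')"
  proof (rule bij_betw_byWitness[where f' = ?r'])
    show "\<forall>i\<in>?M \<theta>. ?r' (?r i) = i"
      using \<theta>(2) by (auto simp: min_def \<theta>'(2) s)
    show "\<forall>k\<in>?M \<theta>'. ?r (?r' k) = k"
      using \<theta>'\<theta>' by (auto simp: min_def \<theta>'s \<theta>'(2)[symmetric] s)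
    show "?r ` ?M \<theta> \<subseteq> ?M \<theta>'"
    proof (intro image_subsetI)
      fix i assume i: "i \<in> ?M \<theta>"
      then have ne: "\<sigma> i \<noteq> \<sigma> (\<theta> i)" by (auto simp: inj)
      have "\<sigma> i \<in> {1..n}" "\<sigma> (\<theta> i) \<in> {1..n}"
        using i permutes_in_image[OF \<sigma>] permutes_in_image[OF \<theta>(1)] by auto
      then show "?r i \<in> ?M \<theta>'"
        using ne i bspec[OF \<theta>(2), of i] by (cases "\<sigma> i < \<sigma> (\<theta> i)") (auto simp: min_def \<theta>'(2))
    qed
    show "?r' ` ?M \<theta>' \<subseteq> ?M \<theta>"
    proof (intro image_subsetI)
      fix k assume k: "k \<in> ?M \<theta>'"
      have sk: "?s k \<in> {1..n}" "?s (\<theta>' k) \<in> {1..n}"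
        using k permutes_in_image[OF permutes_inv[OF \<sigma>]] permutes_in_image[OF \<theta>'(1)] by auto
      have "?s k \<noteq> ?s (\<theta>' k)" using k by (metis (mono_tags, lifting) mem_Collect_eq less_irrefl s(2))
      then show "?r' k \<in> ?M \<theta>" using sk bspec[OF \<theta>(2) sk(1)]
        by (cases "?s k < ?s (\<theta>' k)") (auto simp: min_def \<theta>'s)
    qed
  qed
  have "pair_sign \<pi> \<theta>' = (\<Prod>i\<in>?M \<theta>. if \<pi> (\<theta>' (?r i)) < \<pi> (?r i) then - 1 else 1)"
    unfolding pair_sign_def by (rule prod.reindex_bij_betw[OF bij, symmetric])
  then have "pair_sign \<pi> \<theta>' * pair_sign \<sigma> \<theta> =
      (\<Prod>i\<in>?M \<theta>. (if \<pi> (\<theta>' (?r i)) < \<pi> (?r i) then - 1 else 1) * (if \<sigma> (\<theta> i) < \<sigma> i then - 1 else 1))"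
    unfolding pair_sign_def by (simp add: prod.distrib)
  also have "\<dots> = pair_sign (\<pi> \<circ> \<sigma>) \<theta>"
    unfolding pair_sign_def
  proof (rule prod.cong[OF refl])
    fix i assume i: "i \<in> ?M \<theta>"
    have ne: "\<sigma> i \<noteq> \<sigma> (\<theta> i)" "\<pi> (\<sigma> i) \<noteq> \<pi> (\<sigma> (\<theta> i))" using i by (auto simp: inj)
    show "(if \<pi> (\<theta>' (?r i)) < \<pi> (?r i) then - 1 else 1) * (if \<sigma> (\<theta> i) < \<sigma> i then - 1 else 1) =
        (if (\<pi> \<circ> \<sigma>) (\<theta> i) < (\<pi> \<circ> \<sigma>) i then - 1 else 1 :: complex)"
      using ne i bspec[OF \<theta>(2), of i] by (cases "\<sigma> i < \<sigma> (\<theta> i)") (auto simp: min_def \<theta>'(2))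
  qed
  finally show ?thesis by simp
qed

lemma act_components:
  assumes g: "(b, \<sigma>) \<in> carrier W" and \<omega>: "(x, \<theta>) \<in> twisted_involutions A n"
    and act: "W.act (b, \<sigma>) (x, \<theta>) = (x', \<theta>')"
  shows "\<And>i. \<theta>' (\<sigma> i) = \<sigma> (\<theta> i)" "\<And>i. i \<in> {1..n} \<Longrightarrow> x' (\<sigma> i) = b i \<otimes> b (\<theta> i) \<otimes> x i"
proof -
  have w': "(x', \<theta>') \<in> twisted_involutions A n"
    using W.act_closed[OF g, of "(x, \<theta>)"] \<omega> act by (simp add: twisted_involutions_eq)
  have b: "b \<in> {1..n} \<rightarrow>\<^sub>E carrier A" and \<sigma>: "\<sigma> permutes {1..n}" using g by (auto simp: W_carrier)
  have x: "x \<in> {1..n} \<rightarrow>\<^sub>E carrier A" and \<theta>: "\<theta> permutes {1..n}" using \<omega> by (auto simp: twisted_involution_iff)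
  have x': "x' \<in> {1..n} \<rightarrow>\<^sub>E carrier A" using w' by (auto simp: twisted_involution_iff)
  have "(x', \<theta>') \<otimes>\<^bsub>W\<^esub> tau A n (b, \<sigma>) = (b, \<sigma>) \<otimes>\<^bsub>W\<^esub> (x, \<theta>)"
    using W.act_tau[OF g, of "(x, \<theta>)"] \<omega> act by (simp add: twisted_involutions_eq)
  then have eq: "(\<lambda>i\<in>{1..n}. x' (\<sigma> i) \<otimes> (\<lambda>i\<in>{1..n}. inv (b i)) i) = (\<lambda>i\<in>{1..n}. b (\<theta> i) \<otimes> x i)" "\<theta>' \<circ> \<sigma> = \<sigma> \<circ> \<theta>"
    unfolding tau_eq[OF b] W_mult[OF \<sigma>] W_mult[OF \<theta>] by (simp_all only: prod.inject)
  show "\<theta>' (\<sigma> i) = \<sigma> (\<theta> i)" for i using eq(2) by (auto simp: fun_eq_iff)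
  show "x' (\<sigma> i) = b i \<otimes> b (\<theta> i) \<otimes> x i" if i: "i \<in> {1..n}" for i
  proof -
    have "\<sigma> i \<in> {1..n}" "\<theta> i \<in> {1..n}" using i permutes_in_image[OF \<sigma>] permutes_in_image[OF \<theta>] by auto
    then have c: "x' (\<sigma> i) \<in> carrier A" "b i \<in> carrier A" "b (\<theta> i) \<in> carrier A" "x i \<in> carrier A" using x' b x i by auto
    have "x' (\<sigma> i) \<otimes> inv (b i) = b (\<theta> i) \<otimes> x i" using fun_cong[OF eq(1), of i] i by simp
    then have "x' (\<sigma> i) \<otimes> inv (b i) \<otimes> b i = b (\<theta> i) \<otimes> x i \<otimes> b i" by simp
    then show ?thesis using c by (simp add: m_assoc) (simp add: m_ac)
  qed
qed

lemma sign_G_cocycle: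
  assumes g: "g \<in> carrier W" and h: "h \<in> carrier W" and \<omega>: "\<omega> \<in> twisted_involutions A n"
  shows "sign_G n sgA (g \<otimes>\<^bsub>W\<^esub> h) \<omega> = sign_G n sgA g (W.act h \<omega>) * sign_G n sgA h \<omega>"
proof -
  obtain a \<pi> b \<sigma> x \<theta> x' \<theta>' where e: "g = (a, \<pi>)" "h = (b, \<sigma>)" "\<omega> = (x, \<theta>)" "W.act h \<omega> = (x', \<theta>')"
    by (metis prod.exhaust)
  have w': "(x', \<theta>') \<in> twisted_involutions A n"
    using W.act_closed[OF h, of \<omega>] \<omega> e(4) by (simp add: twisted_involutions_eq)
  have \<pi>: "\<pi> permutes {1..n}" and \<sigma>: "\<sigma> permutes {1..n}" and ac: "\<And>i. i \<in> {1..n} \<Longrightarrow> a i \<in> carrier A"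
    and bc: "\<And>i. i \<in> {1..n} \<Longrightarrow> b i \<in> carrier A"
    using g h by (auto simp: e W_carrier)
  have \<theta>: "\<theta> permutes {1..n}" "\<forall>i\<in>{1..n}. \<theta> (\<theta> i) = i" and xc: "\<And>i. i \<in> {1..n} \<Longrightarrow> x i \<in> carrier A"
    using \<omega> by (auto simp: e twisted_involution_iff)
  have \<theta>': "\<theta>' permutes {1..n}" "\<forall>i\<in>{1..n}. \<theta>' (\<theta>' i) = i"
    using w' by (auto simp: twisted_involution_iff)
  note ac' = act_components[OF h[unfolded e] \<omega>[unfolded e] e(4)[unfolded e]]
  have inj: "\<sigma> i = \<sigma> j \<longleftrightarrow> i = j" for i j using permutes_inj[OF \<sigma>] by (auto dest: injD)
  have bijF: "bij_betw \<sigma> (Fix n \<theta>) (Fix n \<theta>')"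
  proof (rule bij_betw_byWitness[where f' = "inv_into UNIV \<sigma>"])
    show "\<sigma> ` Fix n \<theta> \<subseteq> Fix n \<theta>'" using permutes_in_image[OF \<sigma>] ac'(1) by (auto simp: Fix_def)
    show "inv_into UNIV \<sigma> ` Fix n \<theta>' \<subseteq> Fix n \<theta>"
    proof (intro image_subsetI)
      fix k assume k: "k \<in> Fix n \<theta>'"
      let ?i = "inv_into UNIV \<sigma> k"
      have "\<sigma> ?i = k" using permutes_inverses[OF \<sigma>] by simp
      then have "\<sigma> (\<theta> ?i) = \<sigma> ?i" using ac'(1)[of ?i] k by (simp add: Fix_def)
      moreover have "?i \<in> {1..n}" using k permutes_in_image[OF permutes_inv[OF \<sigma>]] by (simp add: Fix_def)
      ultimately show "?i \<in> Fix n \<theta>" by (simp add: inj Fix_def)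
    qed
  qed (use permutes_inverses[OF \<sigma>] in auto)
  have "(\<Prod>i\<in>Fix n \<theta>'. sgA (a i) (x' i)) = (\<Prod>i\<in>Fix n \<theta>. sgA (a (\<sigma> i)) (x' (\<sigma> i)))"
    by (rule prod.reindex_bij_betw[OF bijF, symmetric])
  then have "(\<Prod>i\<in>Fix n \<theta>'. sgA (a i) (x' i)) * (\<Prod>i\<in>Fix n \<theta>. sgA (b i) (x i)) =
      (\<Prod>i\<in>Fix n \<theta>. sgA (a (\<sigma> i)) (x' (\<sigma> i)) * sgA (b i) (x i))"
    by (simp add: prod.distrib)
  also have "\<dots> = (\<Prod>i\<in>Fix n \<theta>. sgA (a (\<sigma> i) \<otimes> b i) (x i))"
  proof (rule prod.cong[OF refl])
    fix i assume "i \<in> Fix n \<theta>"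
    then have i: "i \<in> {1..n}" "\<theta> i = i" by (auto simp: Fix_def)
    have "\<sigma> i \<in> {1..n}" using i permutes_in_image[OF \<sigma>] by simp
    then show "sgA (a (\<sigma> i)) (x' (\<sigma> i)) * sgA (b i) (x i) = sgA (a (\<sigma> i) \<otimes> b i) (x i)"
      using ac'(2)[OF i(1)] i ac[of "\<sigma> i"] bc[OF i(1)] xc[OF i(1)] sign_cocycle[of "a (\<sigma> i)" "b i" "x i"] by simp
  qed
  also have "\<dots> = (\<Prod>i\<in>Fix n \<theta>. sgA (fst (g \<otimes>\<^bsub>W\<^esub> h) i) (x i))"
    unfolding e W_mult[OF \<sigma>] by (intro prod.cong) (auto simp: Fix_def)
  finally have A: "(\<Prod>i\<in>Fix n \<theta>. sgA (fst (g \<otimes>\<^bsub>W\<^esub> h) i) (x i)) =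
    (\<Prod>i\<in>Fix n \<theta>'. sgA (a i) (x' i)) * (\<Prod>i\<in>Fix n \<theta>. sgA (b i) (x i))" by simp
  have S: "sign_S n (snd (g \<otimes>\<^bsub>W\<^esub> h)) \<theta> = sign_S n \<pi> \<theta>' * sign_S n \<sigma> \<theta>"
    unfolding sign_S_eq[OF \<theta>] sign_S_eq[OF \<theta>'] e W_mult[OF \<sigma>] snd_conv
    by (rule pair_sign_cocycle[OF \<pi> \<sigma> \<theta> \<theta>'(1) ac'(1)])
  have eq: "sign_G n sgA (g \<otimes>\<^bsub>W\<^esub> h) \<omega> = sign_S n (snd (g \<otimes>\<^bsub>W\<^esub> h)) \<theta> * (\<Prod>i\<in>Fix n \<theta>. sgA (fst (g \<otimes>\<^bsub>W\<^esub> h) i) (x i))"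
    by (simp add: sign_G_def e(3))
  show ?thesis unfolding eq A S unfolding e(4) unfolding e by (simp add: sign_G_def)
qed

lemma sign_G_pm1:
  assumes g: "g \<in> carrier W" and \<omega>: "\<omega> \<in> twisted_involutions A n"
  shows "sign_G n sgA g \<omega> = 1 \<or> sign_G n sgA g \<omega> = - 1"
proof -
  have prod: "(\<Prod>i\<in>F. f i) = 1 \<or> (\<Prod>i\<in>F. f i) = - 1" if "\<And>i. i \<in> F \<Longrightarrow> f i = 1 \<or> f i = - 1" for F :: "nat set" and f :: "nat \<Rightarrow> complex"
    using that
  proof (induction F rule: infinite_finite_induct)
    case (insert x F)
    have "prod f F = 1 \<or> prod f F = - 1" by (rule insert.IH) (use insert.prems in auto)
    then show ?case using insert.prems[of x] insert.hyps by auto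
  qed auto
  have "(\<Prod>i\<in>Fix n (snd \<omega>). sgA (fst g i) (fst \<omega> i)) = 1 \<or> (\<Prod>i\<in>Fix n (snd \<omega>). sgA (fst g i) (fst \<omega> i)) = - 1"
  proof (rule prod)
    fix i assume "i \<in> Fix n (snd \<omega>)"
    then have "i \<in> {1..n}" by (simp add: Fix_def)
    then show "sgA (fst g i) (fst \<omega> i) = 1 \<or> sgA (fst g i) (fst \<omega> i) = - 1"
      using g \<omega> by (intro sign_pm1) (auto simp: W_carrier twisted_involutions_def)
  qed
  moreover have "sign_S n (snd g) (snd \<omega>) = 1 \<or> sign_S n (snd g) (snd \<omega>) = - 1"
    by (simp add: sign_S_def minus_one_power_iff)
  ultimately show ?thesis by (auto simp: sign_G_def)
qed

lemma sign_G_one: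
  assumes \<omega>: "\<omega> \<in> twisted_involutions A n" shows "sign_G n sgA \<one>\<^bsub>W\<^esub> \<omega> = 1"
proof -
  have "sign_G n sgA \<one>\<^bsub>W\<^esub> \<omega> = sign_G n sgA \<one>\<^bsub>W\<^esub> \<omega> * sign_G n sgA \<one>\<^bsub>W\<^esub> \<omega>"
    using sign_G_cocycle[OF W.one_closed W.one_closed \<omega>] \<omega> by (simp add: W.act_one twisted_involutions_eq)
  then show ?thesis using sign_G_pm1[OF W.one_closed \<omega>] by auto
qed

text \<open>The left-hand side will be the trace of \<open>\<rho> g\<close>. Encoding elements pointwise turns both sides into those
  of \<open>signed_fixed_points_eq_roots\<close>.\<close>

theorem signed_fixed_points:
  assumes g: "g \<in> carrier W"
  shows "(\<Sum>\<omega> | \<omega> \<in> twisted_involutions A n \<and> W.act g \<omega> = \<omega>. sign_G n sgA g \<omega>) =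
    of_nat (card {u \<in> carrier W. u \<otimes>\<^bsub>W\<^esub> tau A n u = g})"
proof -
  obtain a \<pi> where e: "g = (a, \<pi>)" by fastforce
  interpret M: monomial_element A sgA "{1..n}" a \<pi> using monomial g e by simp
  have a: "a \<in> {1..n} \<rightarrow>\<^sub>E carrier A" and \<pi>: "\<pi> permutes {1..n}" using g by (auto simp: e W_carrier)
  have st: "M.pi_stable {1..n}" unfolding M.pi_stable_def using permutes_in_image[OF \<pi>] by auto
  \<comment> \<open>Outside the points, coefficients are undefined but permutations are the identity, so the inverse
    \<open>?G\<close> of the encoding \<open>?F\<close> treats the two components differently.\<close>
  let ?F = "\<lambda>\<omega>. \<lambda>i\<in>{1..n}. (fst \<omega> i, snd \<omega> i)"
  let ?G = "\<lambda>z. (\<lambda>i\<in>{1..n}. fst (z i), \<lambda>i. if i \<in> {1..n} then snd (z i) else i)"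
  have GF: "?G (?F \<omega>) = \<omega>" if "\<omega> \<in> carrier W" for \<omega> :: "(nat \<Rightarrow> 'a) \<times> (nat \<Rightarrow> nat)"
    using that permutes_not_in[of "snd \<omega>" "{1..n}"]
    by (auto simp: W_carrier prod_eq_iff fun_eq_iff PiE_iff extensional_def)
  have FG: "?F (?G z) = z" if "z \<in> {1..n} \<rightarrow>\<^sub>E X" for z X
    using that by (auto simp: fun_eq_iff PiE_iff extensional_def)
  have perm: "(\<lambda>i. if i \<in> {1..n} then f i else i) permutes {1..n}"
    if "\<And>i. i \<in> {1..n} \<Longrightarrow> f i \<in> {1..n}" "inj_on f {1..n}" for f :: "nat \<Rightarrow> nat"
  proof (rule bij_imp_permutes)
    have inj: "inj_on (\<lambda>i. if i \<in> {1..n} then f i else i) {1..n}"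
      by (rule inj_on_cong[THEN iffD1, OF _ that(2)]) simp
    have sub: "(\<lambda>i. if i \<in> {1..n} then f i else i) ` {1..n} \<subseteq> {1..n}"
    proof (rule image_subsetI)
      fix i assume "i \<in> {1..n}"
      then show "(if i \<in> {1..n} then f i else i) \<in> {1..n}" using that(1)[of i] by simp
    qed
    show "bij_betw (\<lambda>i. if i \<in> {1..n} then f i else i) {1..n} {1..n}"
      unfolding bij_betw_def by (intro conjI inj endo_inj_surj[OF finite_atLeastAtMost sub inj])
  qed (rule if_not_P)
  have actiff: "W.act g (x, \<theta>) = (x, \<theta>) \<longleftrightarrow> \<pi> \<circ> \<theta> = \<theta> \<circ> \<pi> \<and> (\<forall>i\<in>{1..n}. x (\<pi> i) = a i \<otimes> a (\<theta> i) \<otimes> x i)"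
    if w: "(x, \<theta>) \<in> twisted_involutions A n" for x \<theta>
  proof -
    have x: "x \<in> {1..n} \<rightarrow>\<^sub>E carrier A" and \<theta>: "\<theta> permutes {1..n}" using w by (auto simp: twisted_involution_iff)
    have "W.act g (x, \<theta>) = (x, \<theta>) \<longleftrightarrow> g \<otimes>\<^bsub>W\<^esub> (x, \<theta>) = (x, \<theta>) \<otimes>\<^bsub>W\<^esub> tau A n g"
      by (rule W.act_fixed_iff[OF g]) (use w in \<open>simp add: twisted_involutions_eq\<close>)
    also have "\<dots> \<longleftrightarrow> (\<forall>i\<in>{1..n}. a (\<theta> i) \<otimes> x i = x (\<pi> i) \<otimes> inv (a i)) \<and> \<pi> \<circ> \<theta> = \<theta> \<circ> \<pi>"
      unfolding e tau_eq[OF a] W_mult[OF \<theta>] W_mult[OF \<pi>] by (auto simp: fun_eq_iff)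
    also have "(\<forall>i\<in>{1..n}. a (\<theta> i) \<otimes> x i = x (\<pi> i) \<otimes> inv (a i)) \<longleftrightarrow> (\<forall>i\<in>{1..n}. x (\<pi> i) = a i \<otimes> a (\<theta> i) \<otimes> x i)"
    proof (intro ball_cong refl)
      fix i assume i: "i \<in> {1..n}"
      have "\<theta> i \<in> {1..n}" "\<pi> i \<in> {1..n}" using i permutes_in_image[OF \<theta>] permutes_in_image[OF \<pi>] by auto
      then have c: "a i \<in> carrier A" "a (\<theta> i) \<in> carrier A" "x i \<in> carrier A" "x (\<pi> i) \<in> carrier A" using a x i by auto
      have "a (\<theta> i) \<otimes> x i = x (\<pi> i) \<otimes> inv (a i) \<longleftrightarrow> a (\<theta> i) \<otimes> x i \<otimes> a i = x (\<pi> i) \<otimes> inv (a i) \<otimes> a i"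
        using c by simp
      also have "\<dots> \<longleftrightarrow> x (\<pi> i) = a i \<otimes> a (\<theta> i) \<otimes> x i"
        using c by (auto simp: m_assoc) (simp_all add: m_ac)
      finally show "a (\<theta> i) \<otimes> x i = x (\<pi> i) \<otimes> inv (a i) \<longleftrightarrow> x (\<pi> i) = a i \<otimes> a (\<theta> i) \<otimes> x i" .
    qed
    finally show ?thesis by blast
  qed
  have "bij_betw ?F {\<omega>. \<omega> \<in> twisted_involutions A n \<and> W.act g \<omega> = \<omega>} (M.fixed_sols {1..n})"
  proof (rule bij_betw_byWitness[where f' = ?G])
    show "\<forall>\<omega>\<in>{\<omega>. \<omega> \<in> twisted_involutions A n \<and> W.act g \<omega> = \<omega>}. ?G (?F \<omega>) = \<omega>"
      using GF by (auto simp: twisted_involutions_def)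
    show "\<forall>z\<in>M.fixed_sols {1..n}. ?F (?G z) = z" using FG by (auto simp: solutions_def)
    show "?F ` {\<omega>. \<omega> \<in> twisted_involutions A n \<and> W.act g \<omega> = \<omega>} \<subseteq> M.fixed_sols {1..n}"
    proof (intro image_subsetI)
      fix \<omega> assume w: "\<omega> \<in> {\<omega>. \<omega> \<in> twisted_involutions A n \<and> W.act g \<omega> = \<omega>}"
      obtain x \<theta> where e2: "\<omega> = (x, \<theta>)" by fastforce
      have w1: "(x, \<theta>) \<in> twisted_involutions A n" and w2: "W.act g (x, \<theta>) = (x, \<theta>)" using w e2 by auto
      have x: "x \<in> {1..n} \<rightarrow>\<^sub>E carrier A" and \<theta>: "\<theta> permutes {1..n}" "\<And>i. i \<in> {1..n} \<Longrightarrow> \<theta> (\<theta> i) = i \<and> x (\<theta> i) = x i"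
        using w1 by (auto simp: twisted_involution_iff)
      have eqs: "\<pi> \<circ> \<theta> = \<theta> \<circ> \<pi>" "\<forall>i\<in>{1..n}. x (\<pi> i) = a i \<otimes> a (\<theta> i) \<otimes> x i" using actiff[OF w1] w2 by auto
      have "M.fixed_eq (?F \<omega>) i" if i: "i \<in> {1..n}" for i
        using i \<theta>(2)[OF i] eqs permutes_in_image[OF \<theta>(1), of i] permutes_in_image[OF \<pi>, of i]
        by (simp add: M.fixed_eq_def e2 fun_eq_iff del: atLeastAtMost_iff One_nat_def)
      then show "?F \<omega> \<in> M.fixed_sols {1..n}"
        using x permutes_in_image[OF \<theta>(1)] unfolding solutions_def by (auto simp: e2)
    qed
    show "?G ` M.fixed_sols {1..n} \<subseteq> {\<omega>. \<omega> \<in> twisted_involutions A n \<and> W.act g \<omega> = \<omega>}"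
    proof (intro image_subsetI)
      fix z assume z: "z \<in> M.fixed_sols {1..n}"
      have zi: "fst (z i) \<in> carrier A" "snd (z i) \<in> {1..n}" "snd (z (snd (z i))) = i" "fst (z (snd (z i))) = fst (z i)"
         "snd (z (\<pi> i)) = \<pi> (snd (z i))" "fst (z (\<pi> i)) = a i \<otimes> a (snd (z i)) \<otimes> fst (z i)" if "i \<in> {1..n}" for i
        using M.solsD[OF z that] by (auto simp: M.fixed_eq_def)
      let ?x = "\<lambda>i\<in>{1..n}. fst (z i)" and ?\<theta> = "\<lambda>i. if i \<in> {1..n} then snd (z i) else i"
      have p: "?\<theta> permutes {1..n}"
      proof (rule perm)
        show "inj_on (\<lambda>i. snd (z i)) {1..n}" by (rule inj_onI) (metis zi(3))
      qed (use zi in auto)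
      have w: "(?x, ?\<theta>) \<in> twisted_involutions A n"
        unfolding twisted_involution_iff using p zi by auto
      have "W.act g (?x, ?\<theta>) = (?x, ?\<theta>)"
        unfolding actiff[OF w] using zi permutes_in_image[OF \<pi>] permutes_not_in[OF \<pi>] by (auto simp: fun_eq_iff)
      with w show "?G z \<in> {\<omega>. \<omega> \<in> twisted_involutions A n \<and> W.act g \<omega> = \<omega>}" by blast
    qed
  qed
  then have "(\<Sum>z\<in>M.fixed_sols {1..n}. \<Prod>k\<in>{1..n}. M.wt k (z k)) =
      (\<Sum>\<omega> | \<omega> \<in> twisted_involutions A n \<and> W.act g \<omega> = \<omega>. \<Prod>k\<in>{1..n}. M.wt k (?F \<omega> k))"
    by (rule sum.reindex_bij_betw[symmetric])
  also have "\<dots> = (\<Sum>\<omega> | \<omega> \<in> twisted_involutions A n \<and> W.act g \<omega> = \<omega>. sign_G n sgA g \<omega>)"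
  proof (rule sum.cong[OF refl])
    fix \<omega> assume w: "\<omega> \<in> {\<omega>. \<omega> \<in> twisted_involutions A n \<and> W.act g \<omega> = \<omega>}"
    obtain x \<theta> where e2: "\<omega> = (x, \<theta>)" by fastforce
    show "(\<Prod>k\<in>{1..n}. M.wt k (?F \<omega> k)) = sign_G n sgA g \<omega>"
      using sign_G_eq_prod_wt[of a \<pi> x \<theta>] g w by (simp add: e e2)
  qed
  finally have 1: "(\<Sum>\<omega> | \<omega> \<in> twisted_involutions A n \<and> W.act g \<omega> = \<omega>. sign_G n sgA g \<omega>) = of_nat (card (M.root_sols {1..n}))"
    using M.signed_fixed_points_eq_roots[OF st] by simp
  have rootiff: "(b, \<sigma>) \<otimes>\<^bsub>W\<^esub> tau A n (b, \<sigma>) = g \<longleftrightarrow> \<sigma> \<circ> \<sigma> = \<pi> \<and> (\<forall>i\<in>{1..n}. b (\<sigma> i) = a i \<otimes> b i)"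
    if u: "(b, \<sigma>) \<in> carrier W" for b \<sigma>
  proof -
    have b: "b \<in> {1..n} \<rightarrow>\<^sub>E carrier A" and \<sigma>: "\<sigma> permutes {1..n}" using u by (auto simp: W_carrier)
    have "(b, \<sigma>) \<otimes>\<^bsub>W\<^esub> tau A n (b, \<sigma>) = g \<longleftrightarrow> (\<forall>i\<in>{1..n}. b (\<sigma> i) \<otimes> inv (b i) = a i) \<and> \<sigma> \<circ> \<sigma> = \<pi>"
      unfolding e tau_eq[OF b] W_mult[OF \<sigma>] using a by (auto simp: fun_eq_iff PiE_iff extensional_def)
    also have "(\<forall>i\<in>{1..n}. b (\<sigma> i) \<otimes> inv (b i) = a i) \<longleftrightarrow> (\<forall>i\<in>{1..n}. b (\<sigma> i) = a i \<otimes> b i)"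
    proof (intro ball_cong refl)
      fix i assume i: "i \<in> {1..n}"
      have "\<sigma> i \<in> {1..n}" using i permutes_in_image[OF \<sigma>] by auto
      then have c: "a i \<in> carrier A" "b i \<in> carrier A" "b (\<sigma> i) \<in> carrier A" using a b i by auto
      have "b (\<sigma> i) \<otimes> inv (b i) = a i \<longleftrightarrow> b (\<sigma> i) \<otimes> inv (b i) \<otimes> b i = a i \<otimes> b i" using c by simp
      then show "b (\<sigma> i) \<otimes> inv (b i) = a i \<longleftrightarrow> b (\<sigma> i) = a i \<otimes> b i" using c by (simp add: m_assoc)
    qed
    finally show ?thesis by blast
  qed
  have "bij_betw ?F {u \<in> carrier W. u \<otimes>\<^bsub>W\<^esub> tau A n u = g} (M.root_sols {1..n})"
  proof (rule bij_betw_byWitness[where f' = ?G])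
    show "\<forall>\<omega>\<in>{u \<in> carrier W. u \<otimes>\<^bsub>W\<^esub> tau A n u = g}. ?G (?F \<omega>) = \<omega>"
      using GF by auto
    show "\<forall>z\<in>M.root_sols {1..n}. ?F (?G z) = z" using FG by (auto simp: solutions_def)
    show "?F ` {u \<in> carrier W. u \<otimes>\<^bsub>W\<^esub> tau A n u = g} \<subseteq> M.root_sols {1..n}"
    proof (intro image_subsetI)
      fix u assume u: "u \<in> {u \<in> carrier W. u \<otimes>\<^bsub>W\<^esub> tau A n u = g}"
      obtain b \<sigma> where e2: "u = (b, \<sigma>)" by fastforce
      have b: "b \<in> {1..n} \<rightarrow>\<^sub>E carrier A" and \<sigma>: "\<sigma> permutes {1..n}" using u by (auto simp: e2 W_carrier)
      have eqs: "\<sigma> \<circ> \<sigma> = \<pi>" "\<forall>i\<in>{1..n}. b (\<sigma> i) = a i \<otimes> b i" using rootiff[of b \<sigma>] u e2 by auto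
      have "M.root_eq (?F u) i" if i: "i \<in> {1..n}" for i
        using i eqs permutes_in_image[OF \<sigma>, of i] 
        by (simp add: M.root_eq_def e2 fun_eq_iff del: atLeastAtMost_iff One_nat_def)
      then show "?F u \<in> M.root_sols {1..n}"
        using b permutes_in_image[OF \<sigma>] unfolding solutions_def by (auto simp: e2)
    qed
    show "?G ` M.root_sols {1..n} \<subseteq> {u \<in> carrier W. u \<otimes>\<^bsub>W\<^esub> tau A n u = g}"
    proof (intro image_subsetI)
      fix z assume z: "z \<in> M.root_sols {1..n}"
      have zi: "fst (z i) \<in> carrier A" "snd (z i) \<in> {1..n}" "snd (z (snd (z i))) = \<pi> i" "fst (z (snd (z i))) = a i \<otimes> fst (z i)"
        if "i \<in> {1..n}" for i
        using M.solsD[OF z that] by (auto simp: M.root_eq_def)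
      let ?x = "\<lambda>i\<in>{1..n}. fst (z i)" and ?\<theta> = "\<lambda>i. if i \<in> {1..n} then snd (z i) else i"
      have p: "?\<theta> permutes {1..n}"
      proof (rule perm)
        show "inj_on (\<lambda>i. snd (z i)) {1..n}" by (rule inj_onI) (metis zi(3) M.pi_inj)
      qed (use zi in auto)
      have u: "(?x, ?\<theta>) \<in> carrier W" using p zi(1) by (simp add: W_carrier)
      have "(?x, ?\<theta>) \<otimes>\<^bsub>W\<^esub> tau A n (?x, ?\<theta>) = g"
        unfolding rootiff[OF u] using zi permutes_not_in[OF \<pi>] by (auto simp: fun_eq_iff)
      with u show "?G z \<in> {u \<in> carrier W. u \<otimes>\<^bsub>W\<^esub> tau A n u = g}" by blast
    qed
  qed
  then have "card (M.root_sols {1..n}) = card {u \<in> carrier W. u \<otimes>\<^bsub>W\<^esub> tau A n u = g}"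
    by (simp add: bij_betw_same_card)
  with 1 show ?thesis by simp
qed

end


section \<open>Sign functions from characters\<close>

locale elementary_2_group = finite_group +
  assumes square_one: "x \<in> carrier G \<Longrightarrow> x \<otimes> x = \<one>"
begin

lemma inv_self: "x \<in> carrier G \<Longrightarrow> inv x = x"
  using square_one by (simp add: inv_equality)

lemma comm: "x \<in> carrier G \<Longrightarrow> y \<in> carrier G \<Longrightarrow> x \<otimes> y = y \<otimes> x"
  using inv_mult_group[of x y] by (simp add: inv_self)

definition sign_character :: "('a \<Rightarrow> complex) \<Rightarrow> bool" where
  "sign_character \<chi> \<longleftrightarrow> (\<forall>x\<in>carrier G. \<chi> x = 1 \<or> \<chi> x = - 1) \<and>
     (\<forall>x\<in>carrier G. \<forall>y\<in>carrier G. \<chi> (x \<otimes> y) = \<chi> x * \<chi> y)"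

text \<open>All matrices of the representation commute, hence are scalar by Schur's lemma, and the first coordinate
  axis \<open>L\<close> is invariant.\<close>

lemma irreducible_degree_one:
  assumes R: "irreducible_rep G R" shows "matrix_rep G 1 R"
proof -
  obtain d where d: "d > 0" "matrix_rep G d R" using irreducible_has_matrix_rep[OF R] by metis
  note Rc = matrix_repD(1)[OF d(2)]
  have scalar: "\<exists>c. R g = c \<cdot>\<^sub>m 1\<^sub>m d" if g: "g \<in> carrier G" for g
  proof (rule schur_scalar[OF R d(2) Rc[OF g]])
    fix h assume h: "h \<in> carrier G"
    show "R h * R g = R g * R h" using comm[OF g h] matrix_repD(2)[OF d(2)] g h by metis
  qed
  define L where "L = {v \<in> carrier_vec d. \<forall>i<d. i \<noteq> 0 \<longrightarrow> v $ i = (0 :: complex)}"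
  have "L = {0\<^sub>v d} \<or> L = carrier_vec d"
  proof (rule irreducible_repE[OF R], goal_cases)
    case (1 e)
    have e: "e = d" using matrix_rep_degree_unique[OF 1(2) d(2)] .
    show ?case
    proof (rule 1(3)[unfolded e])
      fix g w assume g: "g \<in> carrier G" and w: "w \<in> L"
      obtain c where c: "R g = c \<cdot>\<^sub>m 1\<^sub>m d" using scalar[OF g] by blast
      have "R g *\<^sub>v w = c \<cdot>\<^sub>v w" unfolding c using w by (intro eq_vecI) (auto simp: L_def)
      then show "R g *\<^sub>v w \<in> L" using w by (auto simp: L_def)
    qed (auto simp: L_def)
  qed
  moreover have "unit_vec d 0 \<in> L" by (auto simp: L_def)
  moreover have "unit_vec d 0 \<noteq> (0\<^sub>v d :: complex vec)" using d(1) by simp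
  ultimately have L: "L = carrier_vec d" by auto
  have "d = 1"
  proof (rule ccontr)
    assume "d \<noteq> 1"
    then have "1 < d" using d(1) by simp
    have "unit_vec d 1 \<in> L" unfolding L by simp
    then show False using \<open>1 < d\<close> by (auto simp: L_def)
  qed
  with d(2) show ?thesis by simp
qed

lemma irr_characters_eq:
  "irr_characters G = {\<chi>. \<chi> \<in> extensional (carrier G) \<and> sign_character \<chi>}"
proof (intro equalityI subsetI)
  fix \<chi> assume "\<chi> \<in> irr_characters G"
  then obtain R where R: "irreducible_rep G R" and \<chi>: "\<chi> = (\<lambda>g\<in>carrier G. sum_list (diag_mat (R g)))"
    unfolding irr_characters_def by blast
  note R1 = irreducible_degree_one[OF R]
  note Rc = matrix_repD(1)[OF R1]
  have val: "\<chi> g = R g $$ (0, 0)" if g: "g \<in> carrier G" for g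
    using g Rc[OF g] by (simp add: \<chi> tr_eq_sum_list_diag[symmetric] tr_def)
  have mult: "\<chi> (x \<otimes> y) = \<chi> x * \<chi> y" if xy: "x \<in> carrier G" "y \<in> carrier G" for x y
    using xy index_mult_mat_sum[OF Rc[OF xy(1)] Rc[OF xy(2)], of 0 0]
    by (simp add: val matrix_repD(2)[OF R1] del: index_mult_mat(1))
  have "\<chi> \<one> = 1" using matrix_repD(3)[OF R1] by (simp add: val)
  have "\<chi> x = 1 \<or> \<chi> x = - 1" if x: "x \<in> carrier G" for x
  proof -
    have "\<chi> x * \<chi> x = 1" using mult[OF x x] square_one[OF x] \<open>\<chi> \<one> = 1\<close> by simp
    then show ?thesis by (simp add: square_eq_1_iff)
  qed
  with mult show "\<chi> \<in> {\<chi>. \<chi> \<in> extensional (carrier G) \<and> sign_character \<chi>}"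
    by (simp add: sign_character_def \<chi>)
next
  fix \<chi> assume "\<chi> \<in> {\<chi>. \<chi> \<in> extensional (carrier G) \<and> sign_character \<chi>}"
  then have ext: "\<chi> \<in> extensional (carrier G)" and pm: "\<And>x. x \<in> carrier G \<Longrightarrow> \<chi> x = 1 \<or> \<chi> x = - 1"
    and mult: "\<And>x y. x \<in> carrier G \<Longrightarrow> y \<in> carrier G \<Longrightarrow> \<chi> (x \<otimes> y) = \<chi> x * \<chi> y"
    by (auto simp: sign_character_def)
  have one: "\<chi> \<one> = 1" using mult[of \<one> \<one>] pm[of \<one>] by auto
  define R where "R g = mat 1 1 (\<lambda>_. \<chi> g)" for g
  have R1: "matrix_rep G 1 R" unfolding matrix_rep_iff
  proof (intro conjI ballI)
    fix g h assume gh: "g \<in> carrier G" "h \<in> carrier G"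
    show "R (g \<otimes> h) = R g * R h"
      by (rule eq_matI) (auto simp: R_def mult[OF gh] scalar_prod_def)
  qed (auto simp: R_def one intro!: eq_matI)
  have "irreducible_rep G R" unfolding irreducible_rep_def
  proof (intro exI[of _ 1] conjI allI impI R1)
    fix W assume "VectorSpace.subspace class_ring W (module_vec TYPE(complex) 1)"
    then have W: "W \<subseteq> carrier_vec 1" "0\<^sub>v 1 \<in> W" "\<And>c v. v \<in> W \<Longrightarrow> c \<cdot>\<^sub>v v \<in> W"
      unfolding subspace_module_vec_iff by auto
    show "W = {0\<^sub>v 1} \<or> W = carrier_vec 1"
    proof (cases "W \<subseteq> {0\<^sub>v 1}")
      case False
      then obtain w where w: "w \<in> W" "w \<noteq> 0\<^sub>v 1" by auto
      then have w1: "w \<in> carrier_vec 1" using W(1) by auto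
      have w0: "w $ 0 \<noteq> 0"
      proof
        assume "w $ 0 = 0"
        then have "w = 0\<^sub>v 1" using w1 by (intro eq_vecI) auto
        with w(2) show False by simp
      qed
      have "v \<in> W" if v: "v \<in> carrier_vec 1" for v
      proof -
        have "v = (v $ 0 / w $ 0) \<cdot>\<^sub>v w" using v w1 w0 by (intro eq_vecI) auto
        then show ?thesis using W(3)[OF w(1)] by metis
      qed
      then show ?thesis using W(1) by blast
    qed (use W(2) in auto)
  qed simp
  moreover have "\<chi> = (\<lambda>g\<in>carrier G. sum_list (diag_mat (R g)))"
    using ext by (auto simp: fun_eq_iff extensional_def R_def diag_mat_def)
  ultimately show "\<chi> \<in> irr_characters G" unfolding irr_characters_def by blast
qed

text \<open>A subgroup that is maximal among those avoiding a given element has index two, and the character is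
  \<open>1\<close> on it and \<open>- 1\<close> on the other coset.\<close>

lemma separating_character:
  assumes p: "p \<in> carrier G" "p \<noteq> \<one>"
  shows "\<exists>\<chi>. sign_character \<chi> \<and> \<chi> p = - 1"
proof -
  define Sub where "Sub K \<longleftrightarrow> K \<subseteq> carrier G \<and> \<one> \<in> K \<and> (\<forall>x\<in>K. \<forall>y\<in>K. x \<otimes> y \<in> K) \<and> p \<notin> K" for K
  have "Sub {\<one>}" using p by (auto simp: Sub_def)
  have fin: "finite {K. Sub K}"
    by (rule finite_subset[of _ "Pow (carrier G)"]) (use finite_carrier in \<open>auto simp: Sub_def\<close>)
  obtain K where K: "Sub K" and max: "\<And>L. Sub L \<Longrightarrow> card L \<le> card K"
  proof -
    have ne: "card ` {K. Sub K} \<noteq> {}" using \<open>Sub {\<one>}\<close> by blast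
    obtain K where K: "Sub K" "card K = Max (card ` {K. Sub K})"
      using Max_in[OF finite_imageI[OF fin] ne] by auto
    show thesis
    proof (rule that[OF K(1)])
      fix L assume "Sub L"
      then show "card L \<le> card K" unfolding K(2) using fin by (intro Max_ge) auto
    qed
  qed
  have Kc: "x \<in> carrier G" if "x \<in> K" for x using K that by (auto simp: Sub_def)
  have Km: "x \<otimes> y \<in> K" if "x \<in> K" "y \<in> K" for x y using K that by (auto simp: Sub_def)
  have out: "x \<otimes> p \<in> K" if x: "x \<in> carrier G" "x \<notin> K" for x
  proof -
    let ?L = "K \<union> (\<otimes>) x ` K"
    have "card K < card ?L"
    proof (rule psubset_card_mono)
      show "finite ?L" using K finite_carrier by (auto simp: Sub_def intro: finite_subset)
      have "x \<otimes> \<one> \<in> ?L" using K unfolding Sub_def by blast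
      then show "K \<subset> ?L" using x by auto
    qed
    then have "\<not> Sub ?L" using max by force
    moreover have "?L \<subseteq> carrier G" using Kc x by auto
    moreover have "\<one> \<in> ?L" using K by (simp add: Sub_def)
    moreover have "u \<otimes> v \<in> ?L" if uv: "u \<in> ?L" "v \<in> ?L" for u v
    proof -
      have 1: "x \<otimes> k \<otimes> l = x \<otimes> (k \<otimes> l)" "k \<otimes> (x \<otimes> l) = x \<otimes> (k \<otimes> l)" "x \<otimes> k \<otimes> (x \<otimes> l) = k \<otimes> l"
        if "k \<in> K" "l \<in> K" for k l
      proof -
        have c: "k \<in> carrier G" "l \<in> carrier G" using Kc that by auto
        show "x \<otimes> k \<otimes> l = x \<otimes> (k \<otimes> l)" using c x by (simp add: m_assoc)
        show "k \<otimes> (x \<otimes> l) = x \<otimes> (k \<otimes> l)" using c x by (simp add: m_assoc[symmetric] comm[of k x])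
        have "x \<otimes> k \<otimes> (x \<otimes> l) = k \<otimes> x \<otimes> (x \<otimes> l)" using c x by (simp add: comm[of x k])
        also have "\<dots> = k \<otimes> (x \<otimes> x) \<otimes> l" using c x by (simp add: m_assoc)
        finally show "x \<otimes> k \<otimes> (x \<otimes> l) = k \<otimes> l" using c square_one[OF x(1)] by simp
      qed
      from uv show ?thesis using 1 Km by (elim UnE imageE) auto
    qed
    ultimately have "p \<in> ?L" unfolding Sub_def by blast
    then obtain k where k: "k \<in> K" "p = x \<otimes> k" using K by (auto simp: Sub_def)
    have "x \<otimes> p = (x \<otimes> x) \<otimes> k" unfolding k(2) using x Kc[OF k(1)] by (simp add: m_assoc)
    then show ?thesis using k Kc[OF k(1)] square_one[OF x(1)] by simp
  qed
  define \<chi> where "\<chi> x = (if x \<in> K then 1 else - 1 :: complex)" for x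
  have "\<chi> (x \<otimes> y) = \<chi> x * \<chi> y" if xy: "x \<in> carrier G" "y \<in> carrier G" for x y
  proof -
    have mem: "x \<otimes> y \<in> K \<longleftrightarrow> (x \<in> K \<longleftrightarrow> y \<in> K)"
    proof -
      have a: "y \<in> K" if "x \<in> K" "x \<otimes> y \<in> K"
      proof -
        have "x \<otimes> (x \<otimes> y) = y" using xy square_one[OF xy(1)] by (simp add: m_assoc[symmetric])
        then show ?thesis using Km[OF that] by simp
      qed
      have b: "x \<in> K" if "y \<in> K" "x \<otimes> y \<in> K"
      proof -
        have "x \<otimes> y \<otimes> y = x" using xy square_one[OF xy(2)] by (simp add: m_assoc)
        then show ?thesis using Km[OF that(2,1)] by simp
      qed
      have c: "x \<otimes> y \<in> K" if "x \<notin> K" "y \<notin> K"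
      proof -
        have "(x \<otimes> p) \<otimes> (y \<otimes> p) = x \<otimes> (p \<otimes> p) \<otimes> y"
          using xy p by (simp add: m_assoc comm[of y p])
        then have "(x \<otimes> p) \<otimes> (y \<otimes> p) = x \<otimes> y" using xy p square_one[OF p(1)] by simp
        then show ?thesis using Km[OF out[OF xy(1) that(1)] out[OF xy(2) that(2)]] by simp
      qed
      show ?thesis using a b c Km by blast
    qed
    then show ?thesis by (auto simp: \<chi>_def)
  qed
  moreover have "\<chi> p = - 1" using K by (simp add: \<chi>_def Sub_def)
  ultimately show ?thesis unfolding sign_character_def by (intro exI[of _ \<chi>]) (auto simp: \<chi>_def)
qed

text \<open>If \<open>p \<noteq> \<one>\<close>, multiplication by a character with value \<open>- 1\<close> at \<open>p\<close> permutes the characters and negates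
  the sum.\<close>

lemma sum_irr_characters:
  assumes p: "p \<in> carrier G"
  shows "(\<Sum>\<chi>\<in>irr_characters G. \<chi> p) = (if p = \<one> then of_nat (card (irr_characters G)) else 0)"
proof (cases "p = \<one>")
  case True
  have one: "\<chi> \<one> = 1" if "\<chi> \<in> irr_characters G" for \<chi>
  proof -
    have "\<chi> \<one> = \<chi> \<one> * \<chi> \<one>" "\<chi> \<one> = 1 \<or> \<chi> \<one> = - 1"
      using that by (auto simp: irr_characters_eq sign_character_def dest!: bspec[of _ _ \<one>])
    then show ?thesis by auto
  qed
  have "(\<Sum>\<chi>\<in>irr_characters G. \<chi> \<one>) = (\<Sum>\<chi>\<in>irr_characters G. 1)"
    by (rule sum.cong[OF refl one])
  then show ?thesis using True by simp
next
  case False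
  obtain \<mu> where \<mu>: "sign_character \<mu>" "\<mu> p = - 1" using separating_character[OF p False] by blast
  let ?f = "\<lambda>\<chi>. \<lambda>x\<in>carrier G. \<mu> x * \<chi> x"
  have sq: "\<mu> x * (\<mu> x * y) = y" if "x \<in> carrier G" for x y
    using \<mu>(1) that by (auto simp: sign_character_def dest!: bspec[of _ _ x])
  have f: "?f \<chi> \<in> irr_characters G" if "\<chi> \<in> irr_characters G" for \<chi>
  proof -
    have \<chi>: "sign_character \<chi>" using that by (simp add: irr_characters_eq)
    have "sign_character (?f \<chi>)" unfolding sign_character_def
    proof (intro conjI ballI)
      fix x assume x: "x \<in> carrier G"
      have "\<mu> x = 1 \<or> \<mu> x = - 1" "\<chi> x = 1 \<or> \<chi> x = - 1" using \<mu>(1) \<chi> x by (auto simp: sign_character_def)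
      then show "?f \<chi> x = 1 \<or> ?f \<chi> x = - 1" using x by auto
      fix y assume y: "y \<in> carrier G"
      then show "?f \<chi> (x \<otimes> y) = ?f \<chi> x * ?f \<chi> y" using x \<mu>(1) \<chi> by (simp add: sign_character_def)
    qed
    then show ?thesis by (simp add: irr_characters_eq)
  qed
  have ff: "?f (?f \<chi>) = \<chi>" if "\<chi> \<in> irr_characters G" for \<chi>
  proof
    fix x show "?f (?f \<chi>) x = \<chi> x" using that sq[of x "\<chi> x"] by (cases "x \<in> carrier G") (auto simp: irr_characters_eq extensional_def)
  qed
  have "(\<Sum>\<chi>\<in>irr_characters G. \<chi> p) = (\<Sum>\<chi>\<in>irr_characters G. ?f \<chi> p)"
    by (rule sum.reindex_bij_witness[where i = ?f and j = ?f]) (use f ff in auto)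
  also have "\<dots> = - (\<Sum>\<chi>\<in>irr_characters G. \<chi> p)"
    using p \<mu>(2) by (simp add: sum_negf)
  finally show ?thesis using False by simp
qed

end

context comm_group
begin

lemma subgroup_involution_set: "subgroup (involution_set G) G"
proof (rule subgroupI)
  show "a \<otimes> b \<in> involution_set G" if "a \<in> involution_set G" "b \<in> involution_set G" for a b
  proof -
    have c: "a \<in> carrier G" "b \<in> carrier G" "a \<otimes> a = \<one>" "b \<otimes> b = \<one>" using that by (auto simp: involution_set_def)
    have "a \<otimes> b \<otimes> (a \<otimes> b) = (a \<otimes> a) \<otimes> (b \<otimes> b)" using c(1,2) by (simp add: m_ac)
    then show ?thesis using c by (simp add: involution_set_def)
  qed
  show "inv a \<in> involution_set G" if "a \<in> involution_set G" for a
    using that by (auto simp: involution_set_def inv_mult[symmetric])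
qed (auto simp: involution_set_def)

lemma subgroup_square_set: "subgroup (square_set G) G"
proof (rule subgroupI)
  show "a \<otimes> b \<in> square_set G" if ab: "a \<in> square_set G" "b \<in> square_set G" for a b
  proof -
    obtain c d where c: "c \<in> carrier G" "d \<in> carrier G" "a = c \<otimes> c" "b = d \<otimes> d" using ab by (auto simp: square_set_def)
    have "a \<otimes> b = (c \<otimes> d) \<otimes> (c \<otimes> d)" using c by (simp add: m_ac)
    then show ?thesis using c by (auto simp: square_set_def)
  qed
  show "inv a \<in> square_set G" if a: "a \<in> square_set G" for a
  proof -
    obtain c where c: "c \<in> carrier G" "a = c \<otimes> c" using a by (auto simp: square_set_def)
    then have "inv a = inv c \<otimes> inv c" by (simp add: inv_mult)
    then show ?thesis using c by (auto simp: square_set_def)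
  qed
  have "\<one> \<otimes> \<one> \<in> square_set G" unfolding square_set_def by blast
  then show "square_set G \<noteq> {}" by blast
qed (auto simp: square_set_def)

text \<open>The sign of \<open>(a, x)\<close> is the value of a character, depending on the coset of \<open>x\<close> modulo squares, at
  \<open>c \<otimes> inv (s c)\<close> for \<open>c = a \<otimes> q x\<close>. Multiplying \<open>x\<close> by a square keeps the character and replaces \<open>q x\<close> by
  \<open>q (b \<otimes> b \<otimes> x) = s (b \<otimes> q x)\<close>, and the arguments multiply up. If \<open>a\<close> is an involution, the argument is
  \<open>a\<close> itself, and in the sum over \<open>x\<close> every character occurs as often as there are squares.\<close>

theorem character_sign_axioms:
  assumes fin: "finite (carrier G)" and sg: "is_character_sign G sgA"
  shows "abelian_sign G sgA"
proof -
  define IA where "IA = involution_set G"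
  define B where "B = square_set G"
  have IA: "subgroup IA G" and B: "subgroup B G"
    by (simp_all add: IA_def B_def subgroup_involution_set subgroup_square_set)
  interpret H: elementary_2_group "G\<lparr>carrier := IA\<rparr>"
  proof (intro elementary_2_group.intro finite_group.intro)
    show "group (G\<lparr>carrier := IA\<rparr>)" by (rule subgroup.subgroup_is_group[OF IA is_group])
    show "finite_group_axioms (G\<lparr>carrier := IA\<rparr>)"
      using finite_subset[OF subgroup.subset[OF IA] fin] by unfold_locales simp
    show "elementary_2_group_axioms (G\<lparr>carrier := IA\<rparr>)"
      by unfold_locales (simp add: IA_def involution_set_def)
  qed
  obtain lam t_orb t where lam: "bij_betw lam (carrier (G Mod B)) (irr_characters (G\<lparr>carrier := IA\<rparr>))"
    and t_orb: "\<forall>X\<in>carrier (G Mod B). t_orb X \<in> X"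
    and t: "\<forall>X\<in>carrier (G Mod IA). t X \<in> X"
    and sgA: "\<forall>a\<in>carrier G. \<forall>x\<in>carrier G. sgA a x = lam (B #> x)
      (a \<otimes> t {b \<in> carrier G. t_orb (B #> x) \<otimes> (b \<otimes> b) = x} \<otimes>
        inv (t (IA #> (a \<otimes> t {b \<in> carrier G. t_orb (B #> x) \<otimes> (b \<otimes> b) = x}))))"
    using sg[unfolded is_character_sign_def Let_def, folded IA_def B_def] by (elim exE conjE) (rule that)
  define s where "s y = t (IA #> y)" for y
  define so where "so y = t_orb (B #> y)" for y
  define q where "q y = t {b \<in> carrier G. so y \<otimes> (b \<otimes> b) = y}" for y
  have sg_eq: "sgA a x = lam (B #> x) (a \<otimes> q x \<otimes> inv (s (a \<otimes> q x)))" if "a \<in> carrier G" "x \<in> carrier G" for a x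
    using sgA that by (simp add: s_def so_def q_def)
  have IAc: "IA \<subseteq> carrier G" and Bc: "B \<subseteq> carrier G" using IA B by (auto dest: subgroup.subset)
  have s: "s y \<in> IA #> y" if "y \<in> carrier G" for y
    unfolding s_def by (rule bspec[OF t]) (use that in \<open>auto simp: FactGroup_def RCOSETS_def\<close>)
  have IAcos: "z \<in> IA #> y \<longleftrightarrow> z \<in> carrier G \<and> z \<otimes> inv y \<in> IA" if "y \<in> carrier G" for y z
    using subgroup.rcos_module[OF IA is_group that] r_coset_subset_G[OF IAc that] by blast
  have sc: "s y \<in> carrier G" "y \<otimes> inv (s y) \<in> IA" if y: "y \<in> carrier G" for y
  proof -
    show c: "s y \<in> carrier G" using s[OF y] IAcos[OF y] by blast
    have "inv (s y \<otimes> inv y) \<in> IA" using s[OF y] IAcos[OF y] IA by (simp add: subgroup.m_inv_closed)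
    then show "y \<otimes> inv (s y) \<in> IA" using c y by (simp add: inv_mult m_comm)
  qed
  have s_cong: "s y = s z" if "y \<in> IA #> z" "z \<in> carrier G" for y z
    using repr_independence[OF that IA] by (simp add: s_def)
  have root_coset: "{b \<in> carrier G. so x \<otimes> (b \<otimes> b) = y} = IA #> b" if b: "b \<in> carrier G" "so x \<otimes> (b \<otimes> b) = y"
     and so: "so x \<in> carrier G" for x y b
  proof -
    have "so x \<otimes> (c \<otimes> c) = y \<longleftrightarrow> c \<otimes> inv b \<in> IA" if c: "c \<in> carrier G" for c
    proof -
      have "so x \<otimes> (c \<otimes> c) = y \<longleftrightarrow> c \<otimes> c = b \<otimes> b"
        unfolding b(2)[symmetric] using b(1) c so by (simp add: m_comm[of "so x"])
      also have "\<dots> \<longleftrightarrow> (c \<otimes> c) \<otimes> (inv b \<otimes> inv b) = (b \<otimes> b) \<otimes> (inv b \<otimes> inv b)"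
        using b(1) c by simp
      also have "(b \<otimes> b) \<otimes> (inv b \<otimes> inv b) = (b \<otimes> inv b) \<otimes> (b \<otimes> inv b)"
        using b(1) by (simp only: m_ac inv_closed m_closed)
      also have "(c \<otimes> c) \<otimes> (inv b \<otimes> inv b) = (c \<otimes> inv b) \<otimes> (c \<otimes> inv b)"
        using b(1) c by (simp only: m_ac inv_closed m_closed)
      finally show ?thesis using b(1) c by (simp add: IA_def involution_set_def)
    qed
    then show ?thesis using IAcos[OF b(1)] by blast
  qed
  have so: "so y \<in> B #> y" if "y \<in> carrier G" for y
    unfolding so_def by (rule bspec[OF t_orb]) (use that in \<open>auto simp: FactGroup_def RCOSETS_def\<close>)
  have soc: "so y \<in> carrier G" if y: "y \<in> carrier G" for y
    using so[OF y] r_coset_subset_G[OF Bc y] by blast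
  have q: "q y \<in> carrier G \<and> so y \<otimes> (q y \<otimes> q y) = y" if y: "y \<in> carrier G" for y
  proof -
    obtain u where u: "u \<in> carrier G" "so y = u \<otimes> u \<otimes> y"
      using so[OF y] by (auto simp: r_coset_def B_def square_set_def)
    have "so y \<otimes> (inv u \<otimes> inv u) = (u \<otimes> inv u) \<otimes> (u \<otimes> inv u) \<otimes> y"
      unfolding u(2) using u(1) y by (simp only: m_ac inv_closed m_closed)
    then have eq: "so y \<otimes> (inv u \<otimes> inv u) = y" using u y by simp
    note rc = root_coset[OF inv_closed[OF u(1)] eq soc[OF y]]
    have "q y \<in> {b \<in> carrier G. so y \<otimes> (b \<otimes> b) = y}"
      unfolding q_def rc by (rule bspec[OF t]) (use u in \<open>auto simp: FactGroup_def RCOSETS_def\<close>)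
    then show ?thesis by blast
  qed
  have q_eq: "q y = s b" if "b \<in> carrier G" "so y \<otimes> (b \<otimes> b) = y" "y \<in> carrier G" for y b
    unfolding q_def s_def root_coset[OF that(1,2) soc[OF that(3)]] ..
  have lamX: "lam (B #> x) \<in> irr_characters (G\<lparr>carrier := IA\<rparr>)" if "x \<in> carrier G" for x
    using lam that by (auto simp: bij_betw_def FactGroup_def RCOSETS_def)
  have lam_pm: "lam (B #> x) u = 1 \<or> lam (B #> x) u = - 1" if "x \<in> carrier G" "u \<in> IA" for x u
    using lamX[OF that(1)] that(2) by (auto simp: H.irr_characters_eq H.sign_character_def)
  have lam_mult: "lam (B #> x) (u \<otimes> v) = lam (B #> x) u * lam (B #> x) v" if "x \<in> carrier G" "u \<in> IA" "v \<in> IA" for x u v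
    using lamX[OF that(1)] that(2,3) by (auto simp: H.irr_characters_eq H.sign_character_def)
  show ?thesis
  proof
    show "finite (carrier G)" by (rule fin)
  next
    fix a x assume ax: "a \<in> carrier G" "x \<in> carrier G"
    show "sgA a x = 1 \<or> sgA a x = - 1"
      unfolding sg_eq[OF ax] by (rule lam_pm[OF ax(2) sc(2)]) (use ax q in simp)
  next
    fix a b x assume c: "a \<in> carrier G" "b \<in> carrier G" "x \<in> carrier G"
    define y where "y = b \<otimes> b \<otimes> x"
    have y: "y \<in> carrier G" using c by (simp add: y_def)
    have qx: "q x \<in> carrier G" "so x \<otimes> (q x \<otimes> q x) = x" using q[OF c(3)] by auto
    have "y \<in> B #> x" using c unfolding y_def r_coset_def B_def square_set_def by auto
    then have By: "B #> y = B #> x" using repr_independence[OF _ c(3) B] by simp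
    then have soy: "so y = so x" by (simp add: so_def)
    let ?c = "b \<otimes> q x"
    have cc: "?c \<in> carrier G" using c qx by simp
    have "so y \<otimes> (?c \<otimes> ?c) = b \<otimes> b \<otimes> (so x \<otimes> (q x \<otimes> q x))"
      unfolding soy using c qx(1) soc[OF c(3)] by (simp only: m_ac m_closed)
    then have "so y \<otimes> (?c \<otimes> ?c) = y" unfolding qx(2) y_def .
    then have qy: "q y = s ?c" by (rule q_eq[OF cc _ y])
    have ss: "s (a \<otimes> s ?c) = s (a \<otimes> b \<otimes> q x)"
    proof (rule s_cong)
      have "a \<otimes> s ?c \<otimes> inv (a \<otimes> b \<otimes> q x) = (a \<otimes> inv a) \<otimes> (s ?c \<otimes> inv ?c)"
        using c qx(1) sc(1)[OF cc] by (simp only: m_ac inv_closed m_closed inv_mult)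
      also have "\<dots> = s ?c \<otimes> inv ?c" using c qx(1) sc(1)[OF cc] by simp
      finally show "a \<otimes> s ?c \<in> IA #> (a \<otimes> b \<otimes> q x)"
        using s[OF cc] IAcos[OF cc] IAcos[of "a \<otimes> b \<otimes> q x"] c qx(1) by simp
    qed (use c qx in simp)
    let ?u = "a \<otimes> s ?c \<otimes> inv (s (a \<otimes> s ?c))" and ?v = "?c \<otimes> inv (s ?c)"
    have sabc: "s (a \<otimes> b \<otimes> q x) \<in> carrier G" by (rule sc(1)) (use c qx in simp)
    have "?u \<otimes> ?v = (s ?c \<otimes> inv (s ?c)) \<otimes> (a \<otimes> b \<otimes> q x \<otimes> inv (s (a \<otimes> b \<otimes> q x)))"
      unfolding ss using c qx(1) sc(1)[OF cc] sabc by (simp only: m_ac inv_closed m_closed)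
    also have "\<dots> = a \<otimes> b \<otimes> q x \<otimes> inv (s (a \<otimes> b \<otimes> q x))" using c qx(1) sc(1)[OF cc] sabc by simp
    finally have uv: "?u \<otimes> ?v = a \<otimes> b \<otimes> q x \<otimes> inv (s (a \<otimes> b \<otimes> q x))" .
    have "sgA (a \<otimes> b) x = lam (B #> x) (?u \<otimes> ?v)" unfolding uv using sg_eq[of "a \<otimes> b" x] c by simp
    also have "\<dots> = lam (B #> x) ?u * lam (B #> x) ?v"
      by (rule lam_mult[OF c(3) sc(2) sc(2)[OF cc]]) (use c sc(1)[OF cc] in simp)
    also have "lam (B #> x) ?v = sgA b x" using sg_eq[OF c(2,3)] by simp
    also have "lam (B #> x) ?u = sgA a y" using sg_eq[OF c(1) y] qy By by simp
    finally show "sgA (a \<otimes> b) x = sgA a (b \<otimes> b \<otimes> x) * sgA b x" by (simp add: y_def)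
  next
    fix a assume a: "a \<in> carrier G" "a \<otimes> a = \<one>"
    then have aI: "a \<in> IA" by (simp add: IA_def involution_set_def)
    have val: "sgA a x = lam (B #> x) a" if x: "x \<in> carrier G" for x
    proof -
      have qx: "q x \<in> carrier G" "so x \<otimes> (q x \<otimes> q x) = x" using q[OF x] by auto
      have "a \<otimes> q x \<in> IA #> q x" using aI by (auto simp: r_coset_def)
      then have "s (a \<otimes> q x) = s (q x)" by (rule s_cong[OF _ qx(1)])
      also have "\<dots> = q x" using q_eq[OF qx x] by simp
      finally have "a \<otimes> q x \<otimes> inv (s (a \<otimes> q x)) = a \<otimes> (q x \<otimes> inv (q x))" using a qx(1) by (simp add: m_assoc)
      then show ?thesis using sg_eq[OF a(1) x] a qx(1) by simp
    qed
    have car: "carrier (G Mod B) = rcosets B" by (simp add: FactGroup_def)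
    have finR: "finite (rcosets B)" using fin by (auto simp: RCOSETS_def)
    have "(\<Sum>x\<in>carrier G. sgA a x) = (\<Sum>x\<in>carrier G. lam (B #> x) a)" by (simp add: val)
    also have "\<dots> = (\<Sum>X\<in>rcosets B. \<Sum>x | x \<in> carrier G \<and> B #> x = X. lam (B #> x) a)"
      by (rule sum.group[symmetric]) (use fin finR rcosetsI[OF Bc] in auto)
    also have "\<dots> = (\<Sum>X\<in>rcosets B. of_nat (card B) * lam X a)"
    proof (rule sum.cong[OF refl])
      fix X assume X: "X \<in> rcosets B"
      have "{x. x \<in> carrier G \<and> B #> x = X} = X"
      proof -
        obtain y where y: "y \<in> carrier G" "X = B #> y" using X by (auto simp: RCOSETS_def)
        show ?thesis
        proof (intro equalityI subsetI)
          fix x assume "x \<in> {x. x \<in> carrier G \<and> B #> x = X}"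
          then show "x \<in> X" using rcos_self[OF _ B, of x] by auto
        next
          fix x assume "x \<in> X"
          then show "x \<in> {x. x \<in> carrier G \<and> B #> x = X}"
            using y repr_independence[OF _ y(1) B, of x] r_coset_subset_G[OF Bc y(1)] by auto
        qed
      qed
      moreover have "(\<Sum>x | x \<in> carrier G \<and> B #> x = X. lam (B #> x) a) = (\<Sum>x | x \<in> carrier G \<and> B #> x = X. lam X a)"
        by (rule sum.cong) auto
      ultimately have "(\<Sum>x | x \<in> carrier G \<and> B #> x = X. lam (B #> x) a) = (\<Sum>x\<in>X. lam X a)"
        by simp
      also have "\<dots> = of_nat (card B) * lam X a" using card_rcosets_equal[OF X Bc] by simp
      finally show "(\<Sum>x | x \<in> carrier G \<and> B #> x = X. lam (B #> x) a) = of_nat (card B) * lam X a" .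
    qed
    also have "\<dots> = of_nat (card B) * (\<Sum>X\<in>rcosets B. lam X a)" by (simp add: sum_distrib_left)
    also have "(\<Sum>X\<in>rcosets B. lam X a) = (\<Sum>\<chi>\<in>irr_characters (G\<lparr>carrier := IA\<rparr>). \<chi> a)"
      by (rule sum.reindex_bij_betw[OF lam[unfolded car], of "\<lambda>\<chi>. \<chi> a"])
    also have "\<dots> = (if a = \<one> then of_nat (card (rcosets B)) else 0)"
      using H.sum_irr_characters[of a] aI bij_betw_same_card[OF lam] by (simp add: car)
    also have "of_nat (card B) * \<dots> = (if a = \<one> then of_nat (card (carrier G)) else 0)"
      using lagrange[OF B] by (simp add: Coset.order_def mult.commute flip: of_nat_mult)
    finally show "(\<Sum>x\<in>carrier G. sgA a x) = (if a = \<one> then of_nat (card (carrier G)) else 0)" .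
  qed
qed

end


section \<open>Sign functions from cyclic decompositions\<close>

lemma mod_less_double:
  fixes z r :: int
  assumes "0 \<le> z" "z < 2 * r" shows "z mod r = (if z < r then z else z - r)"
proof (cases "z < r")
  case False
  have "z mod r = (z - r) mod r" by simp
  also have "\<dots> = z - r" using assms False by (intro mod_pos_pos_trivial) auto
  finally show ?thesis using False by simp
qed (use assms in simp)

text \<open>The only candidate for \<open>k\<close> is \<open>x div 2\<close>.\<close>

lemma sign_cyclic_eq:
  assumes "0 \<le> x" "x < int r"
  shows "sign_cyclic r a x = (if even r \<and> odd x \<and> int r div 2 \<le> (a + x div 2) mod int r then - 1 else 1)"
proof -
  have r: "0 < int r" using assms by simp
  have key: "(\<exists>k::int. 0 \<le> k \<and> k \<le> int r div 2 - 1 \<and> x = 2 * k + 1 \<and> (a + k) mod int r \<in> {int r div 2..int r - 1}) \<longleftrightarrow>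
      odd x \<and> int r div 2 \<le> (a + x div 2) mod int r" if e: "even r"
  proof
    assume "\<exists>k::int. 0 \<le> k \<and> k \<le> int r div 2 - 1 \<and> x = 2 * k + 1 \<and> (a + k) mod int r \<in> {int r div 2..int r - 1}"
    then show "odd x \<and> int r div 2 \<le> (a + x div 2) mod int r" by auto
  next
    assume o: "odd x \<and> int r div 2 \<le> (a + x div 2) mod int r"
    then have "odd x" by simp
    then have x2: "x = 2 * (x div 2) + 1" by presburger
    have "0 \<le> x div 2" using assms by simp
    moreover have "x div 2 \<le> int r div 2 - 1"
    proof -
      obtain h where "int r = 2 * h" using e by (metis evenE even_of_nat_iff)
      then show ?thesis using assms x2 by linarith
    qed
    moreover have "(a + x div 2) mod int r \<le> int r - 1" using pos_mod_bound[OF r, of "a + x div 2"] by linarith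
    ultimately show "\<exists>k::int. 0 \<le> k \<and> k \<le> int r div 2 - 1 \<and> x = 2 * k + 1 \<and> (a + k) mod int r \<in> {int r div 2..int r - 1}"
      using o by (intro exI[of _ "x div 2"] conjI x2) simp_all
  qed
  show ?thesis
  proof (cases "even r")
    case True
    show ?thesis unfolding sign_cyclic_def key[OF True] by (simp only: True simp_thms)
  next
    case False
    then show ?thesis unfolding sign_cyclic_def by (simp only: simp_thms if_False)
  qed
qed

text \<open>Let \<open>x = 2 * k + 1\<close> and \<open>r = 2 * h\<close>. Then \<open>b + b + x\<close> is \<open>2 * k' + 1\<close>, where \<open>k'\<close> is the residue
  of \<open>b + k\<close> modulo \<open>h\<close>. It differs from the residue \<open>m\<close> modulo \<open>r\<close> by \<open>h\<close> exactly if \<open>m\<close> lies in the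
  upper half, that is, if the sign of \<open>(b, x)\<close> is \<open>- 1\<close>; and a shift by \<open>h\<close> exchanges the halves.\<close>

lemma sign_cyclic_cocycle:
  assumes a: "0 \<le> a" "a < int r" and b: "0 \<le> b" "b < int r" and x: "0 \<le> x" "x < int r"
  shows "sign_cyclic r ((a + b) mod int r) x = sign_cyclic r a (((b + b) mod int r + x) mod int r) * sign_cyclic r b x"
proof (cases "even r \<and> odd x")
  case False
  have r: "0 < int r" using x by simp
  define y where "y = ((b + b) mod int r + x) mod int r"
  have y: "0 \<le> y" "y < int r" using r by (auto simp: y_def)
  have "\<not> (even r \<and> odd y)"
  proof
    assume e: "even r \<and> odd y"
    have "y = (2 * b + x) mod int r" by (simp add: y_def mod_add_left_eq)
    then have "odd (2 * b + x)" using e by (metis dvd_mod_iff even_of_nat_iff)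
    then show False using False e by simp
  qed
  then have "sign_cyclic r a y = 1" by (simp add: sign_cyclic_eq[OF y])
  moreover have "sign_cyclic r c x = 1" for c using False by (simp add: sign_cyclic_eq[OF x])
  ultimately show ?thesis unfolding y_def[symmetric] by simp
next
  case True
  obtain h k where h: "int r = 2 * h" and k: "x = 2 * k + 1" using True by (metis evenE even_of_nat_iff oddE)
  have kh: "0 \<le> k" "k < h" using x h k by linarith+
  define y where "y = ((b + b) mod int r + x) mod int r"
  define m where "m = (b + k) mod int r"
  have m: "0 \<le> m" "m < 2 * h" using kh h by (auto simp: m_def)
  define k' where "k' = (if m < h then m else m - h)"
  have k': "0 \<le> k'" "k' < h" using m by (auto simp: k'_def)
  have yk: "y = 2 * k' + 1"
  proof -
    have "y = (2 * (b + k) + 1) mod (2 * h)"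
      unfolding y_def mod_add_left_eq k h by (simp add: algebra_simps)
    also have "\<dots> = (2 * m + 1) mod (2 * h)"
      unfolding m_def h by (rule mod_add_cong) (simp_all add: mod_mult_right_eq)
    also have "\<dots> = (2 * k' + 1) mod (2 * h)"
      by (auto simp: k'_def algebra_simps mod_diff_right_eq)
    also have "\<dots> = 2 * k' + 1" using k' by (intro mod_pos_pos_trivial) auto
    finally show ?thesis .
  qed
  have y: "0 \<le> y" "y < int r" using yk k' h by auto
  have e: "even r" "even (int r)" using True by auto
  define z where "z = (a + m) mod int r"
  have abx: "((a + b) mod int r + x div 2) mod int r = z"
    by (simp add: k z_def m_def mod_add_left_eq mod_add_right_eq add.assoc)
  have bx: "(b + x div 2) mod int r = m" by (simp add: k m_def)
  have ay: "(a + y div 2) mod int r = (a + k') mod int r" by (simp add: yk)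
  define w where "w = (a + k') mod int r"
  have zr: "z = (if a + m < 2 * h then a + m else a + m - 2 * h)"
    unfolding z_def h by (rule mod_less_double) (use a m h in auto)
  have wr: "w = (if a + k' < 2 * h then a + k' else a + k' - 2 * h)"
    unfolding w_def h by (rule mod_less_double) (use a k' h in auto)
  have "a < 2 * h" using a h by simp
  then have flip: "h \<le> z \<longleftrightarrow> (h \<le> w \<longleftrightarrow> m < h)"
    using zr wr a(1) m by (simp add: k'_def split: if_splits)
  have hr: "int r div 2 = h" using h by simp
  have "sign_cyclic r ((a + b) mod int r) x = (if h \<le> z then - 1 else 1)"
    unfolding sign_cyclic_eq[OF x] abx hr using True by simp
  moreover have "sign_cyclic r b x = (if h \<le> m then - 1 else 1)"
    unfolding sign_cyclic_eq[OF x] bx hr using True by simp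
  moreover have "sign_cyclic r a y = (if h \<le> w then - 1 else 1)"
    unfolding sign_cyclic_eq[OF y] ay hr w_def[symmetric] using True yk by simp
  ultimately show ?thesis unfolding y_def[symmetric] flip by (simp add: not_less)
qed

lemma sum_alternating: "(\<Sum>x\<in>{0..<2 * int h}. if odd x then - 1 else 1 :: complex) = 0"
proof (induction h)
  case (Suc h)
  have "{0..<2 * int (Suc h)} = insert (2 * int h + 1) (insert (2 * int h) {0..<2 * int h})" by auto
  then show ?case using Suc by simp
qed simp

text \<open>Apart from \<open>0\<close> the only possible \<open>a\<close> is \<open>r / 2\<close>, which moves \<open>x div 2\<close> into the upper half for every
  \<open>x\<close>; the sign then alternates with the parity of \<open>x\<close>.\<close>

lemma sum_sign_cyclic:
  assumes r: "r > 0" and a: "0 \<le> a" "a < int r" "(a + a) mod int r = 0"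
  shows "(\<Sum>x\<in>{0..<int r}. sign_cyclic r a x) = (if a = 0 then of_nat r else 0)"
proof (cases "a = 0")
  case True
  have "sign_cyclic r a x = 1" if "x \<in> {0..<int r}" for x
  proof -
    have "(x div 2) mod int r = x div 2" using that by (intro mod_pos_pos_trivial) auto
    then show ?thesis using that True by (auto simp: sign_cyclic_eq)
  qed
  then show ?thesis using True by simp
next
  case False
  have "a + a = int r"
  proof -
    have "(a + a) mod int r = (if a + a < int r then a + a else a + a - int r)"
      by (rule mod_less_double) (use a in auto)
    then show ?thesis using a False by (auto split: if_splits)
  qed
  then obtain h where h: "a = int h" "r = 2 * h" using a by (metis nat_int_add nonneg_int_cases mult_2 of_nat_add of_nat_eq_iff)
  have "sign_cyclic r a x = (if odd x then - 1 else 1)" if x: "x \<in> {0..<int r}" for x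
  proof -
    have "0 \<le> x div 2" "x div 2 < int h" using x h by auto
    then have "(a + x div 2) mod int r = a + x div 2" using h by (intro mod_pos_pos_trivial) auto
    then show ?thesis using x h \<open>0 \<le> x div 2\<close> by (auto simp: sign_cyclic_eq)
  qed
  then have "(\<Sum>x\<in>{0..<int r}. sign_cyclic r a x) = (\<Sum>x\<in>{0..<2 * int h}. if odd x then - 1 else 1)"
    unfolding h by (intro sum.cong) auto
  then show ?thesis using False sum_alternating by simp
qed

context comm_group
begin

text \<open>All three properties pass to products of cyclic groups, the sum over \<open>x\<close> because it factors.\<close>

theorem cyclic_sign_axioms:
  assumes fin: "finite (carrier G)" and sg: "is_cyclic_sign G sgA"
  shows "abelian_sign G sgA"
proof -
  obtain k :: nat and r :: "nat \<Rightarrow> nat" and \<phi> where r: "\<forall>i\<in>{1..k}. primepow (r i)"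
    and \<phi>: "\<phi> \<in> iso G (product_group {1..k} (\<lambda>i. integer_mod_group (r i)))"
    and sg_eq: "\<forall>a\<in>carrier G. \<forall>x\<in>carrier G. sgA a x = (\<Prod>i\<in>{1..k}. sign_cyclic (r i) (\<phi> a i) (\<phi> x i))"
    using sg unfolding is_cyclic_sign_def by (elim exE conjE) (rule that)
  let ?I = "{1..k}"
  let ?Z = "\<lambda>i. {0..<int (r i)}"
  let ?P = "product_group ?I (\<lambda>i. integer_mod_group (r i))"
  have rpos: "r i > 0" if "i \<in> ?I" for i using r that primepow_gt_Suc_0[of "r i"] by fastforce
  have car: "carrier ?P = PiE ?I ?Z"
    unfolding carrier_product_group by (rule PiE_cong) (use rpos in \<open>simp add: carrier_integer_mod_group\<close>)
  have bij: "bij_betw \<phi> (carrier G) (PiE ?I ?Z)" and hom: "\<phi> \<in> hom G ?P"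
    using \<phi> unfolding iso_def car[symmetric] by auto
  have \<phi>c: "\<phi> x i \<in> ?Z i" if "x \<in> carrier G" "i \<in> ?I" for x i
    using bij_betwE[OF bij] that by (auto simp: PiE_iff)
  have \<phi>m: "\<phi> (x \<otimes> y) i = (\<phi> x i + \<phi> y i) mod int (r i)" if "x \<in> carrier G" "y \<in> carrier G" "i \<in> ?I" for x y i
    using hom_mult[OF hom that(1,2)] that(3) by simp
  have \<phi>1: "\<phi> \<one> i = 0" if "i \<in> ?I" for i
  proof -
    have "group ?P" by (rule product_group) simp
    then have "\<phi> \<one> = \<one>\<^bsub>?P\<^esub>" using hom_one[OF hom is_group] by simp
    then show ?thesis using that by simp
  qed
  show ?thesis
  proof
    show "finite (carrier G)" by (rule fin)
  next
    fix a x assume ax: "a \<in> carrier G" "x \<in> carrier G"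
    have "(\<Prod>i\<in>F. sign_cyclic (r i) (\<phi> a i) (\<phi> x i)) = 1 \<or> (\<Prod>i\<in>F. sign_cyclic (r i) (\<phi> a i) (\<phi> x i)) = - 1" for F
      by (induction F rule: infinite_finite_induct) (auto simp: sign_cyclic_def)
    then show "sgA a x = 1 \<or> sgA a x = - 1" using sg_eq ax by simp
  next
    fix a b x assume c: "a \<in> carrier G" "b \<in> carrier G" "x \<in> carrier G"
    have "(\<Prod>i\<in>?I. sign_cyclic (r i) (\<phi> (a \<otimes> b) i) (\<phi> x i)) =
        (\<Prod>i\<in>?I. sign_cyclic (r i) (\<phi> a i) (\<phi> (b \<otimes> b \<otimes> x) i) * sign_cyclic (r i) (\<phi> b i) (\<phi> x i))"
    proof (rule prod.cong[OF refl])
      fix i assume i: "i \<in> ?I"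
      show "sign_cyclic (r i) (\<phi> (a \<otimes> b) i) (\<phi> x i) =
          sign_cyclic (r i) (\<phi> a i) (\<phi> (b \<otimes> b \<otimes> x) i) * sign_cyclic (r i) (\<phi> b i) (\<phi> x i)"
        using sign_cyclic_cocycle[of "\<phi> a i" "r i" "\<phi> b i" "\<phi> x i"] \<phi>c[OF _ i] c
        by (simp add: \<phi>m[OF _ _ i] c)
    qed
    then show "sgA (a \<otimes> b) x = sgA a (b \<otimes> b \<otimes> x) * sgA b x" using sg_eq c by (simp add: prod.distrib)
  next
    fix a assume a: "a \<in> carrier G" "a \<otimes> a = \<one>"
    have aa: "(\<phi> a i + \<phi> a i) mod int (r i) = 0" if i: "i \<in> ?I" for i
      using \<phi>m[OF a(1) a(1) i] a(2) \<phi>1[OF i] by simp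
    have "(\<Sum>x\<in>carrier G. sgA a x) = (\<Sum>x\<in>carrier G. \<Prod>i\<in>?I. sign_cyclic (r i) (\<phi> a i) (\<phi> x i))"
      using sg_eq a by simp
    also have "\<dots> = (\<Sum>f\<in>PiE ?I ?Z. \<Prod>i\<in>?I. sign_cyclic (r i) (\<phi> a i) (f i))"
      by (rule sum.reindex_bij_betw[OF bij])
    also have "\<dots> = (\<Prod>i\<in>?I. \<Sum>y\<in>?Z i. sign_cyclic (r i) (\<phi> a i) y)"
      by (rule prod_sum_PiE[symmetric]) auto
    also have "\<dots> = (\<Prod>i\<in>?I. if \<phi> a i = 0 then of_nat (r i) else 0)"
      by (intro prod.cong refl sum_sign_cyclic) (use rpos \<phi>c a aa in auto)
    also have "\<dots> = (if a = \<one> then of_nat (card (carrier G)) else 0)"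
    proof (cases "a = \<one>")
      case True
      have "card (carrier G) = (\<Prod>i\<in>?I. r i)" using bij_betw_same_card[OF bij] by (simp add: card_PiE)
      then show ?thesis using True \<phi>1 by simp
    next
      case False
      have "\<exists>i\<in>?I. \<phi> a i \<noteq> 0"
      proof (rule ccontr)
        assume "\<not> (\<exists>i\<in>?I. \<phi> a i \<noteq> 0)"
        then have "\<phi> a = \<phi> \<one>" using bij_betwE[OF bij] a \<phi>1
          by (intro PiE_ext[of _ ?I ?Z]) auto
        then show False using False bij a by (auto simp: bij_betw_def dest: inj_onD)
      qed
      then show ?thesis using False by (auto simp: prod_zero_iff)
    qed
    finally show "(\<Sum>x\<in>carrier G. sgA a x) = (if a = \<one> then of_nat (card (carrier G)) else 0)" .
  qed
qed

end


section \<open>The representation\<close>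

locale wreath_model_over = wreath_model A sgA n
  for A :: "('a, 'b) monoid_scheme" (structure) and sgA and n +
  fixes K :: "complex set"
  assumes subfield_K: "subfield K class_ring"
begin

abbreviation "I \<equiv> twisted_involutions A n"
abbreviation "V \<equiv> model_space K A n"
abbreviation "F \<equiv> subfield_ring K"
abbreviation "\<rho> \<equiv> rho K A n sgA"

lemma field_F: "field F"
proof -
  have "Ring.ring (class_ring :: complex ring)"
    using class_field[where 'a = complex] unfolding Ring.field_def domain_def cring_def by blast
  then show ?thesis unfolding subfield_ring_def by (rule ring.subfield_iff(2)[OF _ subfield_K])
qed

sublocale F: field F by (rule field_F)

lemma F_simps: "carrier F = K" "x \<otimes>\<^bsub>F\<^esub> y = x * y" "x \<oplus>\<^bsub>F\<^esub> y = x + y" "\<zero>\<^bsub>F\<^esub> = 0" "\<one>\<^bsub>F\<^esub> = 1"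
  by (simp_all add: subfield_ring_def class_ring_simps)

lemma K_closed: "0 \<in> K" "1 \<in> K" "x \<in> K \<Longrightarrow> y \<in> K \<Longrightarrow> x + y \<in> K" "x \<in> K \<Longrightarrow> y \<in> K \<Longrightarrow> x * y \<in> K" "- 1 \<in> K"
proof -
  show "0 \<in> K" "1 \<in> K" using F.zero_closed F.one_closed by (simp_all add: F_simps)
  show "x \<in> K \<Longrightarrow> y \<in> K \<Longrightarrow> x + y \<in> K" "x \<in> K \<Longrightarrow> y \<in> K \<Longrightarrow> x * y \<in> K"
    using F.a_closed[of x y] F.m_closed[of x y] by (simp_all add: F_simps)
  have "\<ominus>\<^bsub>F\<^esub> \<one>\<^bsub>F\<^esub> \<in> K" using F.a_inv_closed[OF F.one_closed] by (simp add: F_simps)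
  moreover have "1 + \<ominus>\<^bsub>F\<^esub> \<one>\<^bsub>F\<^esub> = 0" using F.r_neg[OF F.one_closed] by (simp add: F_simps)
  ultimately show "- 1 \<in> K" by (metis add_eq_0_iff)
qed

lemma sign_in_K: "g \<in> carrier W \<Longrightarrow> \<omega> \<in> I \<Longrightarrow> sign_G n sgA g \<omega> \<in> K"
  using sign_G_pm1 K_closed by metis

lemma V_simps:
  "carrier V = I \<rightarrow>\<^sub>E K" "\<zero>\<^bsub>V\<^esub> = (\<lambda>\<omega>\<in>I. 0)"
  "u \<oplus>\<^bsub>V\<^esub> v = (\<lambda>\<omega>\<in>I. u \<omega> + v \<omega>)" "c \<odot>\<^bsub>V\<^esub> v = (\<lambda>\<omega>\<in>I. c * v \<omega>)"
  by (simp_all add: model_space_def F.func_space_def F_simps)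

lemma vectorspace_V: "vectorspace F V"
proof -
  have "Module.module F V" unfolding model_space_def by (rule F.func_space_is_module)
  then show ?thesis using field_F by (simp add: vectorspace_def)
qed

sublocale V: vectorspace F V by (rule vectorspace_V)

lemma finite_I: "finite I"
  by (rule finite_subset[OF _ finite_W]) (auto simp: twisted_involutions_def)

lemma finsum_V:
  assumes "finite S" "\<And>s. s \<in> S \<Longrightarrow> f s \<in> carrier V"
  shows "(\<Oplus>\<^bsub>V\<^esub> s\<in>S. f s) = (\<lambda>\<omega>\<in>I. \<Sum>s\<in>S. f s \<omega>)"
  using assms
proof (induction S rule: finite_induct)
  case empty
  then show ?case by (simp add: V_simps)
next
  case (insert x S)
  have "(\<Oplus>\<^bsub>V\<^esub> s\<in>insert x S. f s) = f x \<oplus>\<^bsub>V\<^esub> (\<Oplus>\<^bsub>V\<^esub> s\<in>S. f s)"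
    by (rule V.M.finsum_insert) (use insert in auto)
  also have "(\<Oplus>\<^bsub>V\<^esub> s\<in>S. f s) = (\<lambda>\<omega>\<in>I. \<Sum>s\<in>S. f s \<omega>)" by (rule insert.IH) (use insert.prems in auto)
  also have "f x \<oplus>\<^bsub>V\<^esub> (\<lambda>\<omega>\<in>I. \<Sum>s\<in>S. f s \<omega>) = (\<lambda>\<omega>\<in>I. f x \<omega> + (\<Sum>s\<in>S. f s \<omega>))"
    by (simp add: V_simps fun_eq_iff)
  also have "\<dots> = (\<lambda>\<omega>\<in>I. \<Sum>s\<in>insert x S. f s \<omega>)"
    using insert.hyps by simp
  finally show ?case .
qed

lemma C_basis_closed: "C_basis A n \<omega> \<in> carrier V"
  using K_closed by (auto simp: C_basis_def V_simps)

lemma act_I: "g \<in> carrier W \<Longrightarrow> \<omega> \<in> I \<Longrightarrow> W.act g \<omega> \<in> I"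
  using W.act_closed by (simp add: twisted_involutions_eq)

lemma act_inv: "g \<in> carrier W \<Longrightarrow> \<omega> \<in> I \<Longrightarrow> W.act g (W.act (inv\<^bsub>W\<^esub> g) \<omega>) = \<omega>"
  using W.act_mult[of g "inv\<^bsub>W\<^esub> g" \<omega>] by (simp add: twisted_involutions_eq W.act_one)

lemma act_inv': "g \<in> carrier W \<Longrightarrow> \<omega> \<in> I \<Longrightarrow> W.act (inv\<^bsub>W\<^esub> g) (W.act g \<omega>) = \<omega>"
  using W.act_mult[of "inv\<^bsub>W\<^esub> g" g \<omega>] by (simp add: twisted_involutions_eq W.act_one)

lemma act_eq_iff: "g \<in> carrier W \<Longrightarrow> \<omega> \<in> I \<Longrightarrow> \<omega>' \<in> I \<Longrightarrow> W.act g \<omega> = W.act g \<omega>' \<longleftrightarrow> \<omega> = \<omega>'"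
  using act_inv' by metis

lemma rho_eq:
  assumes g: "g \<in> carrier W" and v: "v \<in> carrier V"
  shows "\<rho> g v = (\<lambda>\<omega>'\<in>I. \<Sum>\<omega>\<in>I. v \<omega> * sign_G n sgA g \<omega> * (if \<omega>' = W.act g \<omega> then 1 else 0))"
proof -
  have c: "v \<omega> * sign_G n sgA g \<omega> \<in> K" if "\<omega> \<in> I" for \<omega>
    using v that K_closed(4) sign_in_K[OF g that] by (auto simp: V_simps)
  have term_eq: "(v \<omega> * sign_G n sgA g \<omega>) \<odot>\<^bsub>V\<^esub> C_basis A n (g \<otimes>\<^bsub>W\<^esub> \<omega> \<otimes>\<^bsub>W\<^esub> inv\<^bsub>W\<^esub> tau A n g) =
      (\<lambda>\<omega>'\<in>I. v \<omega> * sign_G n sgA g \<omega> * (if \<omega>' = W.act g \<omega> then 1 else 0))" for \<omega>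
    by (auto simp: V_simps C_basis_def W.act_def fun_eq_iff)
  have "\<rho> g v = (\<Oplus>\<^bsub>V\<^esub> \<omega>\<in>I. (v \<omega> * sign_G n sgA g \<omega>) \<odot>\<^bsub>V\<^esub> C_basis A n (g \<otimes>\<^bsub>W\<^esub> \<omega> \<otimes>\<^bsub>W\<^esub> inv\<^bsub>W\<^esub> tau A n g))"
    using v by (simp add: rho_def Let_def)
  also have "\<dots> = (\<lambda>\<omega>'\<in>I. \<Sum>\<omega>\<in>I. ((v \<omega> * sign_G n sgA g \<omega>) \<odot>\<^bsub>V\<^esub> C_basis A n (g \<otimes>\<^bsub>W\<^esub> \<omega> \<otimes>\<^bsub>W\<^esub> inv\<^bsub>W\<^esub> tau A n g)) \<omega>')"
    by (rule finsum_V[OF finite_I]) (use c C_basis_closed in \<open>auto simp: F_simps intro!: V.smult_closed\<close>)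
  also have "\<dots> = (\<lambda>\<omega>'\<in>I. \<Sum>\<omega>\<in>I. v \<omega> * sign_G n sgA g \<omega> * (if \<omega>' = W.act g \<omega> then 1 else 0))"
    by (intro restrict_ext sum.cong refl) (simp add: term_eq)
  finally show ?thesis .
qed

text \<open>The value at \<open>W.act g \<omega>\<close> has a single term, so functions are compared at such points (\<open>V_eqI\<close>) rather
  than at \<open>\<omega>\<close>.\<close>

lemma rho_act:
  assumes g: "g \<in> carrier W" and v: "v \<in> carrier V" and \<omega>: "\<omega> \<in> I"
  shows "\<rho> g v (W.act g \<omega>) = v \<omega> * sign_G n sgA g \<omega>"
proof -
  have "\<rho> g v (W.act g \<omega>) = (\<Sum>\<omega>'\<in>I. v \<omega>' * sign_G n sgA g \<omega>' * (if W.act g \<omega> = W.act g \<omega>' then 1 else 0))"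
    using act_I[OF g \<omega>] by (simp add: rho_eq[OF g v])
  also have "\<dots> = (\<Sum>\<omega>'\<in>I. if \<omega>' = \<omega> then v \<omega> * sign_G n sgA g \<omega> else 0)"
    by (intro sum.cong refl) (auto simp: act_eq_iff[OF g \<omega>])
  also have "\<dots> = v \<omega> * sign_G n sgA g \<omega>" using \<omega> finite_I by simp
  finally show ?thesis .
qed

lemma rho_closed:
  assumes g: "g \<in> carrier W" and v: "v \<in> carrier V" shows "\<rho> g v \<in> carrier V"
proof -
  have "\<rho> g v \<omega> \<in> K" if w: "\<omega> \<in> I" for \<omega>
  proof -
    let ?w = "W.act (inv\<^bsub>W\<^esub> g) \<omega>"
    have wI: "?w \<in> I" using g w by (simp add: act_I)
    have "\<rho> g v \<omega> = v ?w * sign_G n sgA g ?w" using rho_act[OF g v wI] act_inv[OF g w] by simp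
    moreover have "v ?w \<in> K" using v wI by (auto simp: V_simps)
    ultimately show ?thesis using sign_in_K[OF g wI] K_closed(4) by simp
  qed
  then show ?thesis using rho_eq[OF g v] by (auto simp: V_simps)
qed

lemma V_eqI:
  assumes g: "g \<in> carrier W" and "u \<in> carrier V" "v \<in> carrier V"
    and eq: "\<And>\<omega>. \<omega> \<in> I \<Longrightarrow> u (W.act g \<omega>) = v (W.act g \<omega>)"
  shows "u = v"
proof (rule PiE_ext)
  show "u \<in> I \<rightarrow>\<^sub>E K" "v \<in> I \<rightarrow>\<^sub>E K" using assms by (auto simp: V_simps)
  fix \<omega> assume w: "\<omega> \<in> I"
  then show "u \<omega> = v \<omega>" using eq[of "W.act (inv\<^bsub>W\<^esub> g) \<omega>"] g act_inv[OF g w] by (simp add: act_I)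
qed

lemma rho_mult:
  assumes g: "g \<in> carrier W" and h: "h \<in> carrier W" and v: "v \<in> carrier V"
  shows "\<rho> (g \<otimes>\<^bsub>W\<^esub> h) v = \<rho> g (\<rho> h v)"
proof (rule V_eqI[of "g \<otimes>\<^bsub>W\<^esub> h"])
  fix \<omega> assume w: "\<omega> \<in> I"
  have a: "W.act (g \<otimes>\<^bsub>W\<^esub> h) \<omega> = W.act g (W.act h \<omega>)" using W.act_mult[OF g h] w by (simp add: twisted_involutions_eq)
  have "\<rho> (g \<otimes>\<^bsub>W\<^esub> h) v (W.act (g \<otimes>\<^bsub>W\<^esub> h) \<omega>) = v \<omega> * sign_G n sgA (g \<otimes>\<^bsub>W\<^esub> h) \<omega>"
    by (rule rho_act) (use g h v w in auto)
  also have "\<dots> = \<rho> g (\<rho> h v) (W.act (g \<otimes>\<^bsub>W\<^esub> h) \<omega>)"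
    unfolding a rho_act[OF g rho_closed[OF h v] act_I[OF h w]] rho_act[OF h v w] sign_G_cocycle[OF g h w]
    by (simp add: mult_ac)
  finally show "\<rho> (g \<otimes>\<^bsub>W\<^esub> h) v (W.act (g \<otimes>\<^bsub>W\<^esub> h) \<omega>) = \<rho> g (\<rho> h v) (W.act (g \<otimes>\<^bsub>W\<^esub> h) \<omega>)" .
qed (use g h v rho_closed in auto)

lemma rho_one: "v \<in> carrier V \<Longrightarrow> \<rho> \<one>\<^bsub>W\<^esub> v = v"
proof (rule V_eqI[of "\<one>\<^bsub>W\<^esub>"])
  fix \<omega> assume v: "v \<in> carrier V" and w: "\<omega> \<in> I"
  have "W.act \<one>\<^bsub>W\<^esub> \<omega> = \<omega>" using w by (simp add: W.act_one twisted_involutions_eq)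
  then show "\<rho> \<one>\<^bsub>W\<^esub> v (W.act \<one>\<^bsub>W\<^esub> \<omega>) = v (W.act \<one>\<^bsub>W\<^esub> \<omega>)"
    using rho_act[OF W.one_closed v w] sign_G_one[OF w] by simp
qed (use rho_closed in auto)

lemma rho_module_hom: assumes g: "g \<in> carrier W" shows "\<rho> g \<in> LinearCombinations.module_hom F V V"
  unfolding LinearCombinations.module_hom_def
proof (intro CollectI conjI allI impI)
  show "\<rho> g \<in> carrier V \<rightarrow> carrier V" using rho_closed[OF g] by blast
next
  fix u v assume uv: "u \<in> carrier V \<and> v \<in> carrier V"
  show "\<rho> g (u \<oplus>\<^bsub>V\<^esub> v) = \<rho> g u \<oplus>\<^bsub>V\<^esub> \<rho> g v"
  proof (rule V_eqI[OF g])
    fix \<omega> assume w: "\<omega> \<in> I"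
    have "u \<oplus>\<^bsub>V\<^esub> v \<in> carrier V" using uv by simp
    from rho_act[OF g this w] show "\<rho> g (u \<oplus>\<^bsub>V\<^esub> v) (W.act g \<omega>) = (\<rho> g u \<oplus>\<^bsub>V\<^esub> \<rho> g v) (W.act g \<omega>)"
      using w act_I[OF g w] uv by (simp add: V_simps(3) rho_act[OF g] distrib_right)
  qed (use uv rho_closed[OF g] in auto)
next
  fix c v assume cv: "c \<in> carrier F \<and> v \<in> carrier V"
  show "\<rho> g (c \<odot>\<^bsub>V\<^esub> v) = c \<odot>\<^bsub>V\<^esub> \<rho> g v"
  proof (rule V_eqI[OF g])
    fix \<omega> assume w: "\<omega> \<in> I"
    have "c \<odot>\<^bsub>V\<^esub> v \<in> carrier V" using cv by simp
    from rho_act[OF g this w] show "\<rho> g (c \<odot>\<^bsub>V\<^esub> v) (W.act g \<omega>) = (c \<odot>\<^bsub>V\<^esub> \<rho> g v) (W.act g \<omega>)"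
      using w act_I[OF g w] cv by (simp add: V_simps(4) rho_act[OF g])
  qed (use cv rho_closed[OF g] in auto)
qed

lemma rho_Bij: assumes g: "g \<in> carrier W" shows "\<rho> g \<in> Bij (carrier V)"
proof -
  have inv: "\<rho> h (\<rho> k v) = v" if "h \<in> carrier W" "k \<in> carrier W" "h \<otimes>\<^bsub>W\<^esub> k = \<one>\<^bsub>W\<^esub>" "v \<in> carrier V" for h k v
    using rho_mult[OF that(1,2,4)] that(3,4) by (simp add: rho_one)
  have "bij_betw (\<rho> g) (carrier V) (carrier V)"
  proof (rule bij_betw_byWitness[where f' = "\<rho> (inv\<^bsub>W\<^esub> g)"])
    show "\<forall>v\<in>carrier V. \<rho> (inv\<^bsub>W\<^esub> g) (\<rho> g v) = v" "\<forall>v\<in>carrier V. \<rho> g (\<rho> (inv\<^bsub>W\<^esub> g) v) = v"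
      using g by (auto intro!: inv)
    show "\<rho> g ` carrier V \<subseteq> carrier V" "\<rho> (inv\<^bsub>W\<^esub> g) ` carrier V \<subseteq> carrier V"
      using g by (intro image_subsetI rho_closed; simp)+
  qed
  moreover have "\<rho> g \<in> extensional (carrier V)" by (simp add: rho_def Let_def)
  ultimately show ?thesis by (simp add: Bij_def)
qed

theorem representation_rho: "representation F W V \<rho>"
  unfolding representation_def
proof (intro conjI group_W vectorspace_V homI)
  fix g h assume g: "g \<in> carrier W"
  show "\<rho> g \<in> carrier (general_linear F V)" using rho_Bij[OF g] rho_module_hom[OF g] by (simp add: general_linear_def)
  assume h: "h \<in> carrier W"
  have "\<rho> (g \<otimes>\<^bsub>W\<^esub> h) = compose (carrier V) (\<rho> g) (\<rho> h)"
  proof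
    fix v show "\<rho> (g \<otimes>\<^bsub>W\<^esub> h) v = compose (carrier V) (\<rho> g) (\<rho> h) v"
    proof (cases "v \<in> carrier V")
      case True
      then show ?thesis using rho_mult[OF g h] by (simp add: compose_def)
    next
      case False
      then show ?thesis by (simp add: compose_def rho_def Let_def)
    qed
  qed
  then show "\<rho> (g \<otimes>\<^bsub>W\<^esub> h) = \<rho> g \<otimes>\<^bsub>general_linear F V\<^esub> \<rho> h"
    using rho_Bij[OF g] rho_Bij[OF h] by (simp add: general_linear_def BijGroup_def)
qed

text \<open>An enumeration of the basis, to index the rows and columns of matrices.\<close>

definition ws :: "((nat \<Rightarrow> 'a) \<times> (nat \<Rightarrow> nat)) list" where "ws = (SOME l. set l = I \<and> distinct l)"

lemma ws: "set ws = I" "distinct ws"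
proof -
  have "\<exists>l. set l = I \<and> distinct l" using finite_distinct_list[OF finite_I] .
  then have "set ws = I \<and> distinct ws" unfolding ws_def by (rule someI_ex)
  then show "set ws = I" "distinct ws" by auto
qed

abbreviation "N \<equiv> length ws"

definition rho_mat :: "(nat \<Rightarrow> 'a) \<times> (nat \<Rightarrow> nat) \<Rightarrow> complex mat" where
  "rho_mat g = mat N N (\<lambda>(i, j). if ws ! i = W.act g (ws ! j) then sign_G n sgA g (ws ! j) else 0)"

lemma ws_nth: "i < N \<Longrightarrow> ws ! i \<in> I" using ws(1) nth_mem by blast

lemma sum_ws: "(\<Sum>i<N. f (ws ! i)) = (\<Sum>\<omega>\<in>I. f \<omega>)" for f :: "_ \<Rightarrow> complex"
  by (rule sum.reindex_bij_betw) (use bij_betw_nth[OF ws(2) refl ws(1)[symmetric]] in simp)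

lemma matrix_rep_rho: "matrix_rep W N rho_mat"
  unfolding W.matrix_rep_iff
proof (intro conjI ballI)
  fix g h assume g: "g \<in> carrier W" and h: "h \<in> carrier W"
  show "rho_mat (g \<otimes>\<^bsub>W\<^esub> h) = rho_mat g * rho_mat h"
  proof (rule eq_matI)
    fix i j assume "i < dim_row (rho_mat g * rho_mat h)" "j < dim_col (rho_mat g * rho_mat h)"
    then have ij: "i < N" "j < N" by (auto simp: rho_mat_def)
    let ?w = "W.act h (ws ! j)"
    have wI: "?w \<in> I" by (rule act_I[OF h ws_nth[OF ij(2)]])
    have "(rho_mat g * rho_mat h) $$ (i, j) = (\<Sum>l<N. rho_mat g $$ (i, l) * rho_mat h $$ (l, j))"
      by (rule index_mult_mat_sum) (use ij in \<open>auto simp: rho_mat_def\<close>)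
    also have "\<dots> = (\<Sum>l<N. (\<lambda>\<omega>. (if ws ! i = W.act g \<omega> then sign_G n sgA g \<omega> else 0) * (if \<omega> = ?w then sign_G n sgA h (ws ! j) else 0)) (ws ! l))"
      using ij by (intro sum.cong) (auto simp: rho_mat_def)
    also have "\<dots> = (\<Sum>\<omega>\<in>I. (if ws ! i = W.act g \<omega> then sign_G n sgA g \<omega> else 0) * (if \<omega> = ?w then sign_G n sgA h (ws ! j) else 0))"
      by (rule sum_ws)
    also have "\<dots> = (\<Sum>\<omega>\<in>I. if \<omega> = ?w then (if ws ! i = W.act g ?w then sign_G n sgA g ?w * sign_G n sgA h (ws ! j) else 0) else 0)"
      by (intro sum.cong) auto
    also have "\<dots> = (if ws ! i = W.act g ?w then sign_G n sgA g ?w * sign_G n sgA h (ws ! j) else 0)"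
      using wI finite_I by simp
    also have "\<dots> = rho_mat (g \<otimes>\<^bsub>W\<^esub> h) $$ (i, j)"
      using ij ws_nth[OF ij(2)] W.act_mult[OF g h, of "ws ! j"] sign_G_cocycle[OF g h, of "ws ! j"]
      by (simp add: rho_mat_def twisted_involutions_eq)
    finally show "rho_mat (g \<otimes>\<^bsub>W\<^esub> h) $$ (i, j) = (rho_mat g * rho_mat h) $$ (i, j)" by simp
  qed (auto simp: rho_mat_def)
next
  show "rho_mat \<one>\<^bsub>W\<^esub> = 1\<^sub>m N"
  proof (rule eq_matI)
    fix i j assume "i < dim_row (1\<^sub>m N :: complex mat)" "j < dim_col (1\<^sub>m N :: complex mat)"
    then have ij: "i < N" "j < N" by auto
    have "W.act \<one>\<^bsub>W\<^esub> (ws ! j) = ws ! j" using ws_nth[OF ij(2)] by (simp add: W.act_one twisted_involutions_eq)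
    then show "rho_mat \<one>\<^bsub>W\<^esub> $$ (i, j) = 1\<^sub>m N $$ (i, j)"
      using ij ws_nth[OF ij(2)] by (simp add: rho_mat_def sign_G_one nth_eq_iff_index_eq[OF ws(2)])
  qed (auto simp: rho_mat_def)
qed (auto simp: rho_mat_def)

lemma tr_rho_mat:
  assumes g: "g \<in> carrier W"
  shows "tr (rho_mat g) = of_nat (card {u \<in> carrier W. u \<otimes>\<^bsub>W\<^esub> tau A n u = g})"
proof -
  have "tr (rho_mat g) = (\<Sum>i<N. (\<lambda>\<omega>. if W.act g \<omega> = \<omega> then sign_G n sgA g \<omega> else 0) (ws ! i))"
    by (auto simp: tr_def rho_mat_def intro!: sum.cong)
  also have "\<dots> = (\<Sum>\<omega>\<in>I. if W.act g \<omega> = \<omega> then sign_G n sgA g \<omega> else 0)" by (rule sum_ws)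
  also have "\<dots> = (\<Sum>\<omega> | \<omega> \<in> I \<and> W.act g \<omega> = \<omega>. sign_G n sgA g \<omega>)"
    by (rule sum.inter_filter[OF finite_I, symmetric])
  finally show ?thesis using signed_fixed_points[OF g] by simp
qed

lemma C_basis_inj: "\<omega> \<in> I \<Longrightarrow> \<omega>' \<in> I \<Longrightarrow> C_basis A n \<omega> = C_basis A n \<omega>' \<longleftrightarrow> \<omega> = \<omega>'"
  by (auto simp: C_basis_def dest: fun_cong[where x = \<omega>] split: if_splits)

lemma lincomb_C_basis:
  assumes a: "a \<in> C_basis A n ` I \<rightarrow> K" and w: "\<omega> \<in> I"
  shows "V.lincomb a (C_basis A n ` I) \<omega> = a (C_basis A n \<omega>)"
proof -
  have inj: "inj_on (C_basis A n) I" by (auto simp: inj_on_def C_basis_inj)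
  have "V.lincomb a (C_basis A n ` I) = (\<lambda>\<omega>\<in>I. \<Sum>b\<in>C_basis A n ` I. (a b \<odot>\<^bsub>V\<^esub> b) \<omega>)"
    unfolding V.lincomb_def
    by (rule finsum_V) (use finite_I a C_basis_closed in \<open>auto simp: F_simps intro!: V.smult_closed\<close>)
  then have "V.lincomb a (C_basis A n ` I) \<omega> = (\<Sum>b\<in>C_basis A n ` I. a b * b \<omega>)" using w by (simp add: V_simps)
  also have "\<dots> = (\<Sum>\<omega>'\<in>I. a (C_basis A n \<omega>') * C_basis A n \<omega>' \<omega>)" by (simp add: sum.reindex[OF inj])
  also have "\<dots> = (\<Sum>\<omega>'\<in>I. if \<omega>' = \<omega> then a (C_basis A n \<omega>) else 0)"
    using w by (intro sum.cong) (auto simp: C_basis_def)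
  also have "\<dots> = a (C_basis A n \<omega>)" using w finite_I by simp
  finally show ?thesis .
qed

lemma basis_C_basis: "V.basis (C_basis A n ` I)"
  unfolding V.basis_def
proof (intro conjI)
  show sub: "C_basis A n ` I \<subseteq> carrier V" using C_basis_closed by blast
  show "V.lin_indpt (C_basis A n ` I)"
  proof (rule V.finite_lin_indpt2)
    fix a assume a: "a \<in> C_basis A n ` I \<rightarrow> carrier F" and z: "V.lincomb a (C_basis A n ` I) = \<zero>\<^bsub>V\<^esub>"
    show "\<forall>v\<in>C_basis A n ` I. a v = \<zero>\<^bsub>F\<^esub>"
      using lincomb_C_basis[of a] a z by (auto simp: F_simps V_simps)
  qed (use finite_I sub in auto)
  show "V.span (C_basis A n ` I) = carrier V"
  proof (intro equalityI)
    show "V.span (C_basis A n ` I) \<subseteq> carrier V" by (rule V.span_is_subset2[OF sub])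
    show "carrier V \<subseteq> V.span (C_basis A n ` I)"
    proof
      fix v assume v: "v \<in> carrier V"
      define a where "a b = v (THE \<omega>. \<omega> \<in> I \<and> b = C_basis A n \<omega>)" for b
      have aC: "a (C_basis A n \<omega>) = v \<omega>" if "\<omega> \<in> I" for \<omega>
      proof -
        have "(THE \<omega>'. \<omega>' \<in> I \<and> C_basis A n \<omega> = C_basis A n \<omega>') = \<omega>"
          by (rule the_equality) (use that C_basis_inj[OF that] in blast)+
        then show ?thesis by (simp add: a_def)
      qed
      have a: "a \<in> C_basis A n ` I \<rightarrow> K" using aC v by (auto simp: V_simps)
      have closed: "V.lincomb a (C_basis A n ` I) \<in> carrier V"
        by (rule V.lincomb_closed) (use sub a in \<open>auto simp: F_simps\<close>)
      have "V.lincomb a (C_basis A n ` I) = v"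
      proof (rule PiE_ext)
        show "V.lincomb a (C_basis A n ` I) \<in> I \<rightarrow>\<^sub>E K" "v \<in> I \<rightarrow>\<^sub>E K" using closed v by (simp_all add: V_simps)
      qed (simp add: lincomb_C_basis[OF a] aC)
      then show "v \<in> V.span (C_basis A n ` I)"
        unfolding V.span_def using finite_I a by (auto simp: F_simps)
    qed
  qed
qed

theorem scalar_extension_rho: "scalar_extension F W V \<rho> rho_mat"
  unfolding scalar_extension_def
proof (intro exI[of _ "map (C_basis A n) ws"] conjI ballI allI impI)
  show "distinct (map (C_basis A n) ws)"
    unfolding distinct_map using ws by (auto simp: inj_on_def C_basis_inj)
  show "V.basis (set (map (C_basis A n) ws))" using basis_C_basis by (simp add: ws)
  fix g assume g: "g \<in> carrier W"
  show "rho_mat g \<in> carrier_mat (length (map (C_basis A n) ws)) (length (map (C_basis A n) ws))"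
    by (simp add: rho_mat_def)
  have entry: "rho_mat g $$ (i, j) \<in> K" if "i < N" "j < N" for i j
    using that sign_in_K[OF g ws_nth] K_closed by (simp add: rho_mat_def)
  show "elements_mat (rho_mat g) \<subseteq> carrier F"
  proof
    fix x assume "x \<in> elements_mat (rho_mat g)"
    then obtain i j where "i < dim_row (rho_mat g)" "j < dim_col (rho_mat g)" "x = rho_mat g $$ (i, j)"
      unfolding elements_mat_def by auto
    moreover have "dim_row (rho_mat g) = N" "dim_col (rho_mat g) = N" by (simp_all add: rho_mat_def)
    ultimately show "x \<in> carrier F" using entry by (simp add: F_simps)
  qed
  fix j assume "j < length (map (C_basis A n) ws)"
  then have j: "j < N" by simp
  have wj: "ws ! j \<in> I" by (rule ws_nth[OF j])
  have "(\<Oplus>\<^bsub>V\<^esub> i\<in>{..<N}. rho_mat g $$ (i, j) \<odot>\<^bsub>V\<^esub> C_basis A n (ws ! i)) =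
      (\<lambda>\<omega>\<in>I. \<Sum>i<N. (rho_mat g $$ (i, j) \<odot>\<^bsub>V\<^esub> C_basis A n (ws ! i)) \<omega>)"
    by (rule finsum_V) (use entry j C_basis_closed in \<open>auto simp: F_simps intro!: V.smult_closed\<close>)
  also have "\<dots> = (\<lambda>\<omega>\<in>I. if \<omega> = W.act g (ws ! j) then sign_G n sgA g (ws ! j) else 0)"
  proof (rule restrict_ext)
    fix \<omega> assume w: "\<omega> \<in> I"
    have "(\<Sum>i<N. (rho_mat g $$ (i, j) \<odot>\<^bsub>V\<^esub> C_basis A n (ws ! i)) \<omega>) =
        (\<Sum>i<N. (\<lambda>\<omega>'. if \<omega>' = \<omega> then if \<omega> = W.act g (ws ! j) then sign_G n sgA g (ws ! j) else 0 else 0) (ws ! i))"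
      using w j by (intro sum.cong) (auto simp: V_simps rho_mat_def C_basis_def)
    also have "\<dots> = (\<Sum>\<omega>'\<in>I. if \<omega>' = \<omega> then if \<omega> = W.act g (ws ! j) then sign_G n sgA g (ws ! j) else 0 else 0)"
      by (rule sum_ws)
    also have "\<dots> = (if \<omega> = W.act g (ws ! j) then sign_G n sgA g (ws ! j) else 0)" using w finite_I by simp
    finally show "(\<Sum>i<N. (rho_mat g $$ (i, j) \<odot>\<^bsub>V\<^esub> C_basis A n (ws ! i)) \<omega>) =
      (if \<omega> = W.act g (ws ! j) then sign_G n sgA g (ws ! j) else 0)" .
  qed
  also have "\<dots> = \<rho> g (C_basis A n (ws ! j))"
  proof (rule V_eqI[OF g])
    fix \<omega> assume w: "\<omega> \<in> I"
    show "(\<lambda>\<omega>\<in>I. if \<omega> = W.act g (ws ! j) then sign_G n sgA g (ws ! j) else 0) (W.act g \<omega>) = \<rho> g (C_basis A n (ws ! j)) (W.act g \<omega>)"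
      unfolding rho_act[OF g C_basis_closed w] using w act_I[OF g w] act_eq_iff[OF g w wj] by (simp add: C_basis_def)
  next
    show "(\<lambda>\<omega>\<in>I. if \<omega> = W.act g (ws ! j) then sign_G n sgA g (ws ! j) else 0) \<in> carrier V"
      using sign_in_K[OF g wj] K_closed by (auto simp: V_simps)
  qed (rule rho_closed[OF g C_basis_closed])
  finally have eq: "\<rho> g (C_basis A n (ws ! j)) = (\<Oplus>\<^bsub>V\<^esub> i\<in>{..<N}. rho_mat g $$ (i, j) \<odot>\<^bsub>V\<^esub> C_basis A n (ws ! i))" by simp
  have cong: "(\<Oplus>\<^bsub>V\<^esub> i\<in>{..<N}. rho_mat g $$ (i, j) \<odot>\<^bsub>V\<^esub> C_basis A n (ws ! i)) =
      (\<Oplus>\<^bsub>V\<^esub> i\<in>{..<N}. rho_mat g $$ (i, j) \<odot>\<^bsub>V\<^esub> map (C_basis A n) ws ! i)"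
    by (rule V.M.finsum_cong') (use entry j C_basis_closed in \<open>auto simp: F_simps intro!: V.smult_closed\<close>)
  show "\<rho> g (map (C_basis A n) ws ! j) = (\<Oplus>\<^bsub>V\<^esub> i\<in>{..<length (map (C_basis A n) ws)}. rho_mat g $$ (i, j) \<odot>\<^bsub>V\<^esub> (map (C_basis A n) ws ! i))"
    using eq j unfolding cong by simp
qed

theorem gelfand_model_rho: "gelfand_model F W V \<rho>"
  unfolding gelfand_model_def
  using representation_rho scalar_extension_rho
    W.gelfand_criterion[OF matrix_rep_rho tr_rho_mat conjugate_to_inverse_twist] by blast

end

theorem theorem5p1:
  fixes A :: "('a, 'b) monoid_scheme" and n :: nat and K :: "complex set"
    and sgA :: "'a \<Rightarrow> 'a \<Rightarrow> complex"
  assumes "comm_group A" and "finite (carrier A)" and "n \<ge> 1"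
    and "subfield K class_ring"
    and "is_character_sign A sgA \<or> is_cyclic_sign A sgA"
  shows "gelfand_model (subfield_ring K) (wreath A n) (model_space K A n) (rho K A n sgA)"
proof -
  interpret comm_group A by fact
  have "abelian_sign A sgA"
    using assms(5) character_sign_axioms[OF assms(2)] cyclic_sign_axioms[OF assms(2)] by blast
  then interpret wreath_model_over A sgA n K
    using assms(4) by (simp add: wreath_model_over_def wreath_model_def wreath_model_over_axioms_def)
  show ?thesis by (rule gelfand_model_rho)
qed

end
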